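(* Let $k \ge 2$ be a fixed integer and let $G$ be chosen uniformly at random from $\mathcal{G}(n,k+1,k+3)$. Then asymptotically almost surely (i.e. with probability tending to $1$ as $n \to \infty$), $\rho_k(G) = \Theta(\log n / n)$; in particular $\rho_k(G) = o(1)$.
   Context: For integers $n \ge 1$ and $d \ge 3$, $\mathcal{G}(n,d,d+2)$ denotes the set of simple bipartite graphs with (labeled) parts $X$ and $Y$, $|X| = (d+2)n$, $|Y| = dn$, in which every vertex of $X$ has degree $d$ and every vertex of $Y$ has degree $d+2$; it is equipped with the uniform distribution. The $k$-many firefighter process on a graph $G=(V,E)$: a fire breaks out at a vertex $v \in V$. In each subsequent time unit, a firefighter first protects up to $k$ vertices not yet on fire, and then the fire spreads to all unprotected neighbours of burning vertices; burning and protected vertices stay so forever. $\mathrm{sn}_k(G,v)$ is the maximum, over firefighter strategies, of the number of vertices not burned at the end when the fire starts at $v$, and $\rho_k(G) = \frac{1}{|V|^2}\sum_{v \in V}\mathrm{sn}_k(G,v)$. *)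

theory Defs
  imports "HOL-Probability.Probability"
begin

type_synonym 'a graph = "'a set \<times> 'a set set"

abbreviation verts :: "'a graph \<Rightarrow> 'a set" where "verts \<equiv> fst"
abbreviation edges :: "'a graph \<Rightarrow> 'a set set" where "edges \<equiv> snd"

definition simple_graph :: "'a graph \<Rightarrow> bool" where
  "simple_graph G \<longleftrightarrow> finite (verts G) \<and> (\<forall>e \<in> edges G. e \<subseteq> verts G \<and> card e = 2)"

definition degree :: "'a graph \<Rightarrow> 'a \<Rightarrow> nat" where
  "degree G v = card {w \<in> verts G. {v, w} \<in> edges G}"

definition partX :: "nat \<Rightarrow> nat \<Rightarrow> (nat + nat) set" where
  "partX n b = Inl ` {..<b * n}"

definition partY :: "nat \<Rightarrow> nat \<Rightarrow> (nat + nat) set" where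
  "partY n a = Inr ` {..<a * n}"

text \<open>Note the crossing of the parameters: the part of size \<open>b * n\<close> carries the degree \<open>a\<close>,
  and vice versa.\<close>

definition biregular_graphs :: "nat \<Rightarrow> nat \<Rightarrow> nat \<Rightarrow> (nat + nat) graph set" where
  "biregular_graphs n a b =
     {G. simple_graph G \<and> verts G = partX n b \<union> partY n a \<and>
         (\<forall>e \<in> edges G. \<exists>x \<in> partX n b. \<exists>y \<in> partY n a. e = {x, y}) \<and>
         (\<forall>x \<in> partX n b. degree G x = a) \<and>
         (\<forall>y \<in> partY n a. degree G y = b)}"

text \<open>The process is deterministic, so a strategy is a sequence of vertex sets: \<open>S t\<close> is the set
  protected in time unit \<open>t + 1\<close>, just before the fire spreads, and \<open>burned G v S t\<close> is the set
  of burning vertices after \<open>t\<close> time units.\<close>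

primrec burned :: "'a graph \<Rightarrow> 'a \<Rightarrow> (nat \<Rightarrow> 'a set) \<Rightarrow> nat \<Rightarrow> 'a set" where
  "burned G v S 0 = {v}"
| "burned G v S (Suc t) = burned G v S t \<union>
     {w \<in> verts G. w \<notin> (\<Union>s\<le>t. S s) \<and> (\<exists>u \<in> burned G v S t. {u, w} \<in> edges G)}"

definition strategy :: "nat \<Rightarrow> 'a graph \<Rightarrow> 'a \<Rightarrow> (nat \<Rightarrow> 'a set) \<Rightarrow> bool" where
  "strategy k G v S \<longleftrightarrow>
     (\<forall>t. S t \<subseteq> verts G - burned G v S t \<and> finite (S t) \<and> card (S t) \<le> k)"

definition saved :: "'a graph \<Rightarrow> 'a \<Rightarrow> (nat \<Rightarrow> 'a set) \<Rightarrow> nat" where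
  "saved G v S = card (verts G - (\<Union>t. burned G v S t))"

definition sn :: "nat \<Rightarrow> 'a graph \<Rightarrow> 'a \<Rightarrow> nat" where
  "sn k G v = Max {saved G v S | S. strategy k G v S}"

definition \<rho> :: "nat \<Rightarrow> 'a graph \<Rightarrow> real" where
  "\<rho> k G = (\<Sum>v \<in> verts G. real (sn k G v)) / (real (card (verts G)))\<^sup>2"

text \<open>The maximum in \<open>sn\<close> ranges over a finite nonempty set, and the uniform distribution on
  \<open>biregular_graphs n a b\<close> is well defined.\<close>

lemma sn_well_defined:
  assumes "finite (verts G)"
  shows "finite {saved G v S | S. strategy k G v S}" "{saved G v S | S. strategy k G v S} \<noteq> {}"
proof -
  have "saved G v S \<le> card (verts G)" for S
    unfolding saved_def using assms by (intro card_mono) auto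
  then have "{saved G v S | S. strategy k G v S} \<subseteq> {..card (verts G)}" by auto
  then show "finite {saved G v S | S. strategy k G v S}" by (rule finite_subset) simp
  have "strategy k G v (\<lambda>_. {})" by (simp add: strategy_def)
  then show "{saved G v S | S. strategy k G v S} \<noteq> {}" by blast
qed

lemma finite_biregular_graphs: "finite (biregular_graphs n a b)"
proof (rule finite_subset)
  let ?V = "partX n b \<union> partY n a"
  show "biregular_graphs n a b \<subseteq> {?V} \<times> Pow (Pow ?V)"
    unfolding biregular_graphs_def simple_graph_def by auto
  show "finite ({?V} \<times> Pow (Pow ?V))"
    by (simp add: partX_def partY_def)
qed

lemma card_residue_class:
  assumes "(n::nat) > 0" "r < n"
  shows "card {j. j < c * n \<and> j mod n = r} = c"
proof -
  have "{j. j < c * n \<and> j mod n = r} = (\<lambda>q. q * n + r) ` {..<c}"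
  proof (intro equalityI subsetI)
    fix j assume j: "j \<in> {j. j < c * n \<and> j mod n = r}"
    then have "j = (j div n) * n + r" using div_mult_mod_eq[of j n] by simp
    moreover have "j div n < c" using j by (simp add: less_mult_imp_div_less)
    ultimately show "j \<in> (\<lambda>q. q * n + r) ` {..<c}" by blast
  next
    fix j assume "j \<in> (\<lambda>q. q * n + r) ` {..<c}"
    then obtain q where q: "q < c" "j = q * n + r" by auto
    have "q * n + r < Suc q * n" using assms by simp
    also have "\<dots> \<le> c * n" using q by (intro mult_le_mono1) simp
    finally show "j \<in> {j. j < c * n \<and> j mod n = r}" using q assms by simp
  qed
  moreover have "inj_on (\<lambda>q. q * n + r) {..<c}" using assms by (auto simp: inj_on_def)
  ultimately show ?thesis by (simp add: card_image)
qed

lemma biregular_graphs_nonempty: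
  assumes "n \<ge> 1"
  shows "biregular_graphs n a b \<noteq> {}"
proof -
  define E :: "(nat + nat) set set" where
    "E = {{Inl i, Inr j} | i j. i < b * n \<and> j < a * n \<and> i mod n = j mod n}"
  let ?G = "(partX n b \<union> partY n a, E)"
  have EX: "{Inl i, w} \<in> E \<longleftrightarrow> (\<exists>j. w = Inr j \<and> i < b * n \<and> j < a * n \<and> i mod n = j mod n)"
    for i w unfolding E_def by (auto simp: doubleton_eq_iff)
  have EY: "{Inr j, w} \<in> E \<longleftrightarrow> (\<exists>i. w = Inl i \<and> i < b * n \<and> j < a * n \<and> i mod n = j mod n)"
    for j w unfolding E_def by (auto simp: doubleton_eq_iff)
  have "degree ?G (Inl i) = a" if "i < b * n" for i
  proof -
    have "{w \<in> verts ?G. {Inl i, w} \<in> edges ?G} = Inr ` {j. j < a * n \<and> j mod n = i mod n}"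
      using that by (auto simp: EX partX_def partY_def)
    then show ?thesis using assms by (simp add: degree_def card_image card_residue_class)
  qed
  moreover have "degree ?G (Inr j) = b" if "j < a * n" for j
  proof -
    have "{w \<in> verts ?G. {Inr j, w} \<in> edges ?G} = Inl ` {i. i < b * n \<and> i mod n = j mod n}"
      using that by (auto simp: EY partX_def partY_def)
    then show ?thesis using assms by (simp add: degree_def card_image card_residue_class)
  qed
  moreover have "simple_graph ?G"
    unfolding simple_graph_def E_def by (auto simp: partX_def partY_def)
  moreover have "\<forall>e \<in> E. \<exists>x \<in> partX n b. \<exists>y \<in> partY n a. e = {x, y}"
    unfolding E_def partX_def partY_def by blast
  ultimately have "?G \<in> biregular_graphs n a b"
    unfolding biregular_graphs_def by (auto simp: partX_def partY_def)
  then show ?thesis by blast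
qed

end

(* Lower bound: about log n / log (k + 4) vertices outside the ball of that radius around the origin
   can be protected one by one before the fire reaches them.

   For the upper bound, the fire is followed through two regimes. Near a vertex whose neighbourhood
   of a large constant depth is a tree, the number x of children of the fire front, less the number of
   vertices protected beyond it, satisfies x' >= c (x - k), where c is the number of children of a
   vertex on the next level; this grows exponentially from origins on either side. Afterwards expansion
   takes over: the fire, counted by degrees on alternating sides, grows by a constant factor per step
   until it has half of both sides, and from then on the unburnt part shrinks by a constant factor per
   step until it is of order log n.

   Both random inputs come from switchings x1y1, x2y2 -> x1y2, x2y1, which replace the configuration
   model. Prescribing m edges costs a factor (2/n)^m, so the expected number of origins near a short
   cycle is bounded. Removing the edges from S to the complement of T one at a time bounds the
   probability that N(S) is contained in T, up to a polynomial factor, by the hypergeometric value,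
   which beats the number of pairs (S, T) because 1/a + 1/b < 1 for the degrees a and b. *)

theory Submission
  imports Defs
begin

section \<open>Switchings in biregular relations\<close>

text \<open>The two regimes depend on each other. In step t up to k * (t + 1) vertices are
  protected, and expansion is available only from a constant size \<open>s0\<close> on; so the
  expander argument must start from a fire that already exceeds a constant multiple of the elapsed
  time. The tree argument supplies it: at depth D its bound is exponential in D, so one constant D
  suffices. From then on half of the expansion gain of 1 / 200 pays for every protected vertex and 1
  / 400 remains as growth.

  Expansion is used in both directions. Applied to the fire it gives growth; applied to the unburnt,
  unprotected vertices, whose neighbours must have been unburnt one step earlier, it gives decay.

  Origins whose ball of radius D is not a tree are not analysed. Asymptotically almost surely there
  are at most ln n of them, and each adds at most 1 / |V| to \<rho>, which is within the claimed
  order.\<close>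

definition birel :: "'v set \<Rightarrow> 'v set \<Rightarrow> nat \<Rightarrow> nat \<Rightarrow> ('v \<times> 'v) set set" where
  "birel A B a b = {R. R \<subseteq> A \<times> B \<and> (\<forall>x\<in>A. card (R `` {x}) = a) \<and> (\<forall>y\<in>B. card (R\<inverse> `` {y}) = b)}"

lemma birelD:
  assumes "R \<in> birel A B a b"
  shows "R \<subseteq> A \<times> B" "\<And>x. x \<in> A \<Longrightarrow> card (R `` {x}) = a" "\<And>y. y \<in> B \<Longrightarrow> card (R\<inverse> `` {y}) = b"
  using assms by (auto simp: birel_def)

lemma finite_birel: "finite A \<Longrightarrow> finite B \<Longrightarrow> finite (birel A B a b)"
  by (rule finite_subset[of _ "Pow (A \<times> B)"]) (auto simp: birel_def)

lemma birel_converse: "R\<inverse> \<in> birel B A b a \<longleftrightarrow> R \<in> birel A B a b"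
  by (auto simp: birel_def)

text \<open>Exchanging the parts swaps the degrees and preserves counts, so estimates for sets in
  \<open>A\<close> carry over to sets in \<open>B\<close>.\<close>

lemma bij_betw_converse_birel: "bij_betw converse (birel A B a b) (birel B A b a)"
  by (rule bij_betw_byWitness[where f' = converse]) (auto simp: birel_converse)

definition switchable :: "('v \<times> 'v) set \<Rightarrow> 'v \<times> 'v \<times> 'v \<times> 'v \<Rightarrow> bool" where
  "switchable R = (\<lambda>(x1, y1, x2, y2). (x1, y1) \<in> R \<and> (x2, y2) \<in> R \<and> (x1, y2) \<notin> R \<and> (x2, y1) \<notin> R)"

definition switch :: "('v \<times> 'v) set \<Rightarrow> 'v \<times> 'v \<times> 'v \<times> 'v \<Rightarrow> ('v \<times> 'v) set" where
  "switch R = (\<lambda>(x1, y1, x2, y2). R - {(x1, y1), (x2, y2)} \<union> {(x1, y2), (x2, y1)})"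

definition crossed :: "'v \<times> 'v \<times> 'v \<times> 'v \<Rightarrow> 'v \<times> 'v \<times> 'v \<times> 'v" where
  "crossed = (\<lambda>(x1, y1, x2, y2). (x1, y2, x2, y1))"

lemma switch_crossed: "switchable R q \<Longrightarrow> switch (switch R q) (crossed q) = R"
  by (cases q) (auto simp: switchable_def switch_def crossed_def)

lemma crossed_crossed: "crossed (crossed q) = q"
  by (cases q) (simp add: crossed_def)

lemma card_exchange:
  assumes "u \<in> S" "w \<notin> S"
  shows "card (insert w (S - {u})) = card S"
proof (cases "finite S")
  case True
  then show ?thesis using assms by (metis Diff_iff card_Suc_Diff1 card_insert_disjoint finite_Diff)
next
  case False
  then show ?thesis by simp
qed

lemma switch_in_birel:
  assumes R: "R \<in> birel A B a b" and q: "switchable R q"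
  shows "switch R q \<in> birel A B a b"
proof -
  obtain x1 y1 x2 y2 where qe: "q = (x1, y1, x2, y2)" by (cases q)
  have m: "(x1, y1) \<in> R" "(x2, y2) \<in> R" "(x1, y2) \<notin> R" "(x2, y1) \<notin> R"
    using q by (auto simp: switchable_def qe)
  have ne: "x1 \<noteq> x2" "y1 \<noteq> y2" using m by auto
  let ?R = "switch R q"
  have sub: "?R \<subseteq> A \<times> B" using birelD(1)[OF R] m by (auto simp: switch_def qe)
  have "card (?R `` {x}) = a" if "x \<in> A" for x
  proof -
    have "?R `` {x} = (if x = x1 then insert y2 (R `` {x} - {y1})
        else if x = x2 then insert y1 (R `` {x} - {y2}) else R `` {x})"
      using ne by (auto simp: switch_def qe)
    then show ?thesis using birelD(2)[OF R that] m card_exchange[of y1 "R `` {x}" y2]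
        card_exchange[of y2 "R `` {x}" y1] by auto
  qed
  moreover have "card (?R\<inverse> `` {y}) = b" if "y \<in> B" for y
  proof -
    have "?R\<inverse> `` {y} = (if y = y1 then insert x2 (R\<inverse> `` {y} - {x1})
        else if y = y2 then insert x1 (R\<inverse> `` {y} - {x2}) else R\<inverse> `` {y})"
      using ne by (auto simp: switch_def qe)
    then show ?thesis using birelD(3)[OF R that] m card_exchange[of x1 "R\<inverse> `` {y}" x2]
        card_exchange[of x2 "R\<inverse> `` {y}" x1] by auto
  qed
  ultimately show ?thesis using sub by (auto simp: birel_def)
qed

text \<open>The crossed quadruple undoes a switching, so the map on pairs of a relation and a move
  is its own inverse and hence injective. Many moves out of \<A> and few moves back from \<B> then
  bound the size of \<A>.\<close>

lemma switching_double_count: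
  fixes lo hi :: nat
  assumes fin: "finite \<A>" "finite \<B>"
    and Q: "\<And>R. R \<in> \<A> \<Longrightarrow> finite (Q R) \<and> lo \<le> card (Q R)"
    and Q': "\<And>R. R \<in> \<B> \<Longrightarrow> finite (Q' R) \<and> card (Q' R) \<le> hi"
    and step: "\<And>R q. R \<in> \<A> \<Longrightarrow> q \<in> Q R \<Longrightarrow> switchable R q \<and> switch R q \<in> \<B> \<and> crossed q \<in> Q' (switch R q)"
  shows "card \<A> * lo \<le> card \<B> * hi"
proof -
  let ?f = "\<lambda>(R, q). (switch R q, crossed q)"
  have "inj_on ?f (Sigma \<A> Q)"
  proof (rule inj_on_inverseI[where g = ?f])
    fix z assume "z \<in> Sigma \<A> Q"
    then show "?f (?f z) = z"
      using step by (auto simp: switch_crossed crossed_crossed)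
  qed
  moreover have "?f ` Sigma \<A> Q \<subseteq> Sigma \<B> Q'" using step by auto
  moreover have "finite (Sigma \<B> Q')" using fin Q' by auto
  ultimately have "card (Sigma \<A> Q) \<le> card (Sigma \<B> Q')" by (rule card_inj_on_le)
  moreover have "card (Sigma \<A> Q) = (\<Sum>R\<in>\<A>. card (Q R))" using fin Q by (intro card_SigmaI) auto
  moreover have "card (Sigma \<B> Q') = (\<Sum>R\<in>\<B>. card (Q' R))" using fin Q' by (intro card_SigmaI) auto
  moreover have "card \<A> * lo \<le> (\<Sum>R\<in>\<A>. card (Q R))" using sum_mono[of \<A> "\<lambda>_. lo"] Q by fastforce
  moreover have "(\<Sum>R\<in>\<B>. card (Q' R)) \<le> card \<B> * hi" using sum_mono[of \<B> _ "\<lambda>_. hi"] Q' by fastforce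
  ultimately show ?thesis by linarith
qed

lemma card_rel_rows:
  assumes "finite S" "\<And>x. x \<in> S \<Longrightarrow> card (R `` {x}) = a" "\<And>x. x \<in> S \<Longrightarrow> finite (R `` {x})"
  shows "card (R \<inter> S \<times> UNIV) = a * card S"
proof -
  have "R \<inter> S \<times> UNIV = Sigma S (\<lambda>x. R `` {x})" by auto
  then show ?thesis using assms by simp
qed

section \<open>Edge counts and the cost of prescribed edges\<close>

locale bireg =
  fixes A B :: "'v set" and a b n :: nat
  assumes fin: "finite A" "finite B" and cards: "card A = b * n" "card B = a * n"
begin

lemma fin_R: "R \<in> birel A B a b \<Longrightarrow> finite R"
  using birelD(1) fin by (metis finite_SigmaI finite_subset)

lemma fin_birel: "finite (birel A B a b)" by (rule finite_birel[OF fin])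

lemma card_from: 
  assumes R: "R \<in> birel A B a b" and S: "S \<subseteq> A"
  shows "card (R \<inter> S \<times> UNIV) = a * card S"
  using birelD[OF R] S fin fin_R[OF R]
  by (intro card_rel_rows) (auto intro: finite_subset finite_Image)

lemma card_to: 
  assumes R: "R \<in> birel A B a b" and T: "T \<subseteq> B"
  shows "card (R \<inter> UNIV \<times> T) = b * card T"
proof -
  have "card (R\<inverse> \<inter> T \<times> UNIV) = b * card T"
    using birelD[OF R] T fin fin_R[OF R]
    by (intro card_rel_rows) (auto intro: finite_subset finite_Image)
  moreover have "R\<inverse> \<inter> T \<times> UNIV = (R \<inter> UNIV \<times> T)\<inverse>" by auto
  ultimately show ?thesis by (metis card_inverse)
qed

lemma card_R: "R \<in> birel A B a b \<Longrightarrow> card R = a * b * n"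
proof -
  assume R: "R \<in> birel A B a b"
  have "R \<inter> A \<times> UNIV = R" using birelD(1)[OF R] by auto
  then show ?thesis using card_from[OF R, of A] cards by simp
qed

text \<open>These quadruples are the failed switchings whose new pair (x1, y2) is already an edge.
  An edge in \<open>Z\<close> leaves a choices for y1 and b choices for x2.\<close>

lemma card_squares_le:
  assumes R: "R \<in> birel A B a b" and Z: "Z \<subseteq> R"
  shows "finite {(x1, y1, x2, y2). (x1, y2) \<in> Z \<and> (x1, y1) \<in> R \<and> (x2, y2) \<in> R}"
    and "card {(x1, y1, x2, y2). (x1, y2) \<in> Z \<and> (x1, y1) \<in> R \<and> (x2, y2) \<in> R} \<le> a * b * card Z"
proof -
  let ?S = "Sigma Z (\<lambda>(x, y). R `` {x} \<times> R\<inverse> `` {y})"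
  have fZ: "finite Z" using Z fin_R[OF R] finite_subset by blast
  have fS: "finite ?S" using fZ fin_R[OF R] by auto
  have eq: "{(x1, y1, x2, y2). (x1, y2) \<in> Z \<and> (x1, y1) \<in> R \<and> (x2, y2) \<in> R}
    = (\<lambda>((x1, y2), (y1, x2)). (x1, y1, x2, y2)) ` ?S"
    by (force simp: image_iff)
  then show "finite {(x1, y1, x2, y2). (x1, y2) \<in> Z \<and> (x1, y1) \<in> R \<and> (x2, y2) \<in> R}" using fS by simp
  have "card (case z of (x, y) \<Rightarrow> R `` {x} \<times> R\<inverse> `` {y}) = a * b" if "z \<in> Z" for z
    using that Z birelD[OF R] by (cases z) (auto simp: card_cartesian_product)
  then have "card ?S = a * b * card Z" using fZ fin_R[OF R] by (subst card_SigmaI) auto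
  then show "card {(x1, y1, x2, y2). (x1, y2) \<in> Z \<and> (x1, y1) \<in> R \<and> (x2, y2) \<in> R} \<le> a * b * card Z"
    unfolding eq using card_image_le[OF fS] by metis
qed

text \<open>The other way to fail, with (x2, y1) already an edge; interchanging the two switched
  edges reduces it to the first.\<close>

lemma card_squares_le':
  assumes R: "R \<in> birel A B a b" and Z: "Z \<subseteq> R"
  shows "finite {(x1, y1, x2, y2). (x2, y1) \<in> Z \<and> (x1, y1) \<in> R \<and> (x2, y2) \<in> R}"
    and "card {(x1, y1, x2, y2). (x2, y1) \<in> Z \<and> (x1, y1) \<in> R \<and> (x2, y2) \<in> R} \<le> a * b * card Z"
proof -
  let ?f = "\<lambda>(x1, y1, x2, y2). (x2, y2, x1, y1)"
  have eq: "{(x1, y1, x2, y2). (x2, y1) \<in> Z \<and> (x1, y1) \<in> R \<and> (x2, y2) \<in> R}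
     = ?f ` {(x1, y1, x2, y2). (x1, y2) \<in> Z \<and> (x1, y1) \<in> R \<and> (x2, y2) \<in> R}" by (auto simp: image_iff)
  show "finite {(x1, y1, x2, y2). (x2, y1) \<in> Z \<and> (x1, y1) \<in> R \<and> (x2, y2) \<in> R}"
    unfolding eq using card_squares_le(1)[OF R Z] by simp
  show "card {(x1, y1, x2, y2). (x2, y1) \<in> Z \<and> (x1, y1) \<in> R \<and> (x2, y2) \<in> R} \<le> a * b * card Z"
    unfolding eq using card_image_le[OF card_squares_le(1)[OF R Z]] card_squares_le(2)[OF R Z] by (rule order_trans)
qed

text \<open>Switches \<open>(x, y)\<close> with the other edges outside \<open>F\<close>.\<close>

lemma card_insert_edge_le:
  assumes xy: "(x, y) \<in> A \<times> B" "(x, y) \<notin> F" and F: "finite F"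
  shows "card {R \<in> birel A B a b. insert (x, y) F \<subseteq> R} * (a * b * n - card F - 2 * (a * b))
    \<le> card {R \<in> birel A B a b. F \<subseteq> R} * (a * b)"
proof (rule switching_double_count)
  let ?Q = "\<lambda>R. {q. switchable R q \<and> (\<exists>x2 y2. q = (x, y, x2, y2) \<and> (x2, y2) \<notin> F)}"
  let ?Q' = "\<lambda>R. {(x1, y1, x2, y2). x1 = x \<and> y2 = y \<and> (x, y1) \<in> R \<and> (x2, y) \<in> R}"
  show "finite {R \<in> birel A B a b. insert (x, y) F \<subseteq> R}" "finite {R \<in> birel A B a b. F \<subseteq> R}"
    using fin_birel by auto
  show "finite (?Q' R) \<and> card (?Q' R) \<le> a * b" if "R \<in> {R \<in> birel A B a b. F \<subseteq> R}" for R
  proof -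
    have R: "R \<in> birel A B a b" using that by simp
    have eq: "?Q' R = (\<lambda>(y1, x2). (x, y1, x2, y)) ` (R `` {x} \<times> R\<inverse> `` {y})" by (auto simp: image_iff)
    have "card (R `` {x} \<times> R\<inverse> `` {y}) = a * b" using xy birelD[OF R] by (simp add: card_cartesian_product)
    moreover have fi: "finite (R `` {x} \<times> R\<inverse> `` {y})" using fin_R[OF R] by auto
    ultimately show ?thesis unfolding eq using card_image_le[OF fi] by (metis finite_imageI)
  qed
  show "finite (?Q R) \<and> a * b * n - card F - 2 * (a * b) \<le> card (?Q R)"
    if "R \<in> {R \<in> birel A B a b. insert (x, y) F \<subseteq> R}" for R
  proof -
    have R: "R \<in> birel A B a b" and sub: "insert (x, y) F \<subseteq> R" using that by auto
    \<comment> \<open>The edges (x2, y2) that cannot be switched with (x, y): those with y2 a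
      neighbour of x, stored in \<open>?B1\<close> with swapped components, and those with x2 a
      neighbour of y, in \<open>?B2\<close>. There are at most a * b of each kind.\<close>
    let ?B1 = "Sigma (R `` {x}) (\<lambda>y2. R\<inverse> `` {y2})" and ?B2 = "Sigma (R\<inverse> `` {y}) (\<lambda>x2. R `` {x2})"
    have fR: "finite R" by (rule fin_R[OF R])
    have eq: "?Q R = (\<lambda>(x2, y2). (x, y, x2, y2)) ` (R - F - prod.swap ` ?B1 - ?B2)"
      using sub by (auto simp: switchable_def image_iff)
    have "card (R `` {x}) = a" "card (R\<inverse> `` {y}) = b" using xy birelD[OF R] by auto
    moreover have "card (R\<inverse> `` {y2}) = b" if "y2 \<in> R `` {x}" for y2
      using that birelD[OF R] by auto
    moreover have "card (R `` {x2}) = a" if "x2 \<in> R\<inverse> `` {y}" for x2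
      using that birelD[OF R] by auto
    ultimately have c: "card ?B1 = a * b" "card ?B2 = b * a"
      using fR by (subst card_SigmaI; auto)+
    have fB: "finite ?B1" "finite ?B2" using fR by auto
    have c1: "card (prod.swap ` ?B1) \<le> a * b" using card_image_le[OF fB(1), of prod.swap] c by linarith
    have "a * b * n = card R" using card_R[OF R] by simp
    also have "\<dots> \<le> card ((R - F - prod.swap ` ?B1 - ?B2) \<union> F \<union> prod.swap ` ?B1 \<union> ?B2)"
      using fR F fB by (intro card_mono) auto
    also have "\<dots> \<le> card (R - F - prod.swap ` ?B1 - ?B2) + card F + card (prod.swap ` ?B1) + card ?B2"
      by (meson add_mono_thms_linordered_semiring(3) card_Un_le order_trans)
    finally have "a * b * n - card F - 2 * (a * b) \<le> card (R - F - prod.swap ` ?B1 - ?B2)"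
      using c c1 by (simp add: mult.commute)
    moreover have "card (?Q R) = card (R - F - prod.swap ` ?B1 - ?B2)"
      unfolding eq by (rule card_image) (auto simp: inj_on_def)
    moreover have "finite (?Q R)" unfolding eq using fR by simp
    ultimately show ?thesis by simp
  qed
  show "switchable R q \<and> switch R q \<in> {R \<in> birel A B a b. F \<subseteq> R} \<and> crossed q \<in> ?Q' (switch R q)"
    if RQ: "R \<in> {R \<in> birel A B a b. insert (x, y) F \<subseteq> R}" "q \<in> ?Q R" for R q
  proof -
    obtain x2 y2 where q: "q = (x, y, x2, y2)" "(x2, y2) \<notin> F" "switchable R q" using RQ(2) by auto
    then have "switch R q \<in> birel A B a b" using RQ(1) switch_in_birel by auto
    moreover have "F \<subseteq> switch R q" using RQ(1) q xy(2) by (auto simp: switch_def)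
    moreover have "crossed q \<in> ?Q' (switch R q)" unfolding q(1) by (simp add: switch_def crossed_def)
    ultimately show ?thesis using q(3) by blast
  qed
qed

text \<open>The size hypothesis leaves at least half of the a * b * n edges as partners at every
  insertion, against at most a * b reverse moves; so each further edge costs 2 / n.\<close>

lemma card_superset_le:
  assumes "finite F" "F \<subseteq> A \<times> B" "2 * (card F + 2 * (a * b)) \<le> a * b * n" "n > 0" "a > 0" "b > 0"
  shows "real (card {R \<in> birel A B a b. F \<subseteq> R}) \<le> (2 / real n) ^ card F * real (card (birel A B a b))"
  using assms(1-3)
proof (induction F rule: finite_induct)
  case empty
  then show ?case by simp
next
  case (insert e F)
  obtain x y where e: "e = (x, y)" by (cases e)
  let ?c = "\<lambda>F. card {R \<in> birel A B a b. F \<subseteq> R}"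
  have IH: "real (?c F) \<le> (2 / real n) ^ card F * real (card (birel A B a b))"
    using insert by auto
  have le1: "?c (insert e F) * (a * b * n - card F - 2 * (a * b)) \<le> ?c F * (a * b)"
    unfolding e using insert e by (intro card_insert_edge_le) auto
  have le2: "a * b * n \<le> 2 * (a * b * n - card F - 2 * (a * b))"
    using insert.prems(2) insert.hyps by simp
  have "?c (insert e F) * (a * b * n) \<le> ?c (insert e F) * (2 * (a * b * n - card F - 2 * (a * b)))"
    by (rule mult_le_mono2[OF le2])
  also have "\<dots> = 2 * (?c (insert e F) * (a * b * n - card F - 2 * (a * b)))" by (rule mult.left_commute)
  also have "\<dots> \<le> 2 * (?c F * (a * b))" by (rule mult_le_mono2[OF le1])
  finally have "?c (insert e F) * (a * b * n) \<le> 2 * (?c F * (a * b))" .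
  then have "a * b * (?c (insert e F) * n) \<le> a * b * (2 * ?c F)" by (simp add: algebra_simps)
  moreover have "0 < a * b" using assms(5,6) by simp
  ultimately have "?c (insert e F) * n \<le> 2 * ?c F" using nat_mult_le_cancel1 by blast
  from of_nat_mono[OF this, where 'a = real]
  have "real (?c (insert e F)) * real n \<le> 2 * real (?c F)"
    unfolding of_nat_mult of_nat_numeral .
  then have "real (?c (insert e F)) \<le> 2 / real n * real (?c F)" using assms(4) by (simp add: field_simps)
  also have "\<dots> \<le> 2 / real n * ((2 / real n) ^ card F * real (card (birel A B a b)))"
    by (intro mult_left_mono IH) auto
  finally show ?case using insert.hyps by simp
qed

section \<open>Edges that leave S for the complement of T\<close>

definition cut_graphs :: "'v set \<Rightarrow> 'v set \<Rightarrow> nat \<Rightarrow> ('v \<times> 'v) set set" where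
  "cut_graphs S T j = {R \<in> birel A B a b. card (R \<inter> S \<times> (B - T)) = j}"

text \<open>A move takes an edge from S to T and an edge from A - S to B - T and creates one more
  edge from S to B - T. Candidates are blocked by an existing edge, either one of the j from S to B
  - T or one of the p' + j from A - S to T, each blocking at most a * b of them. A reverse move
  picks one of Suc j and one of p' + j + 1 edges.\<close>

lemma card_cut_graphs_step:
  fixes j :: nat
  assumes S: "S \<subseteq> A" and T: "T \<subseteq> B" and le: "a * card S \<le> b * card T"
  defines "p \<equiv> a * card S" and "p' \<equiv> b * card T - a * card S" and "q' \<equiv> a * b * n - b * card T"
  shows "card (cut_graphs S T j) * ((p - j) * (q' - j) - a * b * (p' + 2 * j)) \<le> card (cut_graphs S T (Suc j)) * (Suc j * (p' + j + 1))"
proof (rule switching_double_count)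
  let ?Q = "\<lambda>R. {q. switchable R q \<and> (\<exists>x1 y1 x2 y2. q = (x1, y1, x2, y2) \<and>
      x1 \<in> S \<and> y1 \<in> T \<and> x2 \<in> A - S \<and> y2 \<in> B - T)}"
  let ?Q' = "\<lambda>R. (\<lambda>((x1, y1), (x2, y2)). (x1, y1, x2, y2)) ` ((R \<inter> S \<times> (B - T)) \<times> (R \<inter> (A - S) \<times> T))"
  have finST: "finite S" "finite T" using S T fin finite_subset by auto
  \<comment> \<open>The degree sums over S, T and B - T determine the whole two by two table of edge
    counts from its one entry i.\<close>
  have counts: "card (R \<inter> S \<times> T) = p - i" "card (R \<inter> (A - S) \<times> T) = p' + i"
      "card (R \<inter> (A - S) \<times> (B - T)) = q' - i"
    if "R \<in> cut_graphs S T i" for R i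
  proof -
    have R: "R \<in> birel A B a b" and c: "card (R \<inter> S \<times> (B - T)) = i" using that by (auto simp: cut_graphs_def)
    have RAB: "R \<subseteq> A \<times> B" by (rule birelD(1)[OF R])
    have fR: "finite R" by (rule fin_R[OF R])
    have "R \<inter> S \<times> UNIV = (R \<inter> S \<times> T) \<union> (R \<inter> S \<times> (B - T))" using RAB by auto
    moreover have "card ((R \<inter> S \<times> T) \<union> (R \<inter> S \<times> (B - T))) = card (R \<inter> S \<times> T) + i"
      using fR c by (subst card_Un_disjoint) auto
    ultimately have e1: "card (R \<inter> S \<times> T) + i = p" using card_from[OF R S] by (simp add: p_def)
    have "R \<inter> UNIV \<times> T = (R \<inter> S \<times> T) \<union> (R \<inter> (A - S) \<times> T)" using RAB S by auto
    moreover have "card ((R \<inter> S \<times> T) \<union> (R \<inter> (A - S) \<times> T)) = card (R \<inter> S \<times> T) + card (R \<inter> (A - S) \<times> T)"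
      using fR by (subst card_Un_disjoint) auto
    ultimately have e2: "card (R \<inter> S \<times> T) + card (R \<inter> (A - S) \<times> T) = b * card T"
      using card_to[OF R T] by simp
    have "R \<inter> UNIV \<times> (B - T) = (R \<inter> S \<times> (B - T)) \<union> (R \<inter> (A - S) \<times> (B - T))" using RAB S by auto
    moreover have "card ((R \<inter> S \<times> (B - T)) \<union> (R \<inter> (A - S) \<times> (B - T))) = i + card (R \<inter> (A - S) \<times> (B - T))"
      using fR c by (subst card_Un_disjoint) auto
    moreover have "card (R \<inter> UNIV \<times> (B - T)) = b * card (B - T)" by (rule card_to[OF R]) auto
    moreover have "b * card (B - T) = a * b * n - b * card T"
      using finST T by (simp add: card_Diff_subset cards algebra_simps)
    ultimately have e3: "i + card (R \<inter> (A - S) \<times> (B - T)) = q'" by (simp add: q'_def)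
    show "card (R \<inter> S \<times> T) = p - i" "card (R \<inter> (A - S) \<times> T) = p' + i"
      "card (R \<inter> (A - S) \<times> (B - T)) = q' - i"
      using e1 e2 e3 le unfolding p_def p'_def by linarith+
  qed
  show "finite (cut_graphs S T j)" "finite (cut_graphs S T (Suc j))" using fin_birel by (auto simp: cut_graphs_def)
  show "finite (?Q' R) \<and> card (?Q' R) \<le> Suc j * (p' + j + 1)" if "R \<in> cut_graphs S T (Suc j)" for R
  proof -
    have fR: "finite R" using that fin_R by (auto simp: cut_graphs_def)
    have f: "finite ((R \<inter> S \<times> (B - T)) \<times> (R \<inter> (A - S) \<times> T))" using fR by auto
    have "card ((R \<inter> S \<times> (B - T)) \<times> (R \<inter> (A - S) \<times> T)) = Suc j * (p' + j + 1)"
      using counts[OF that] that by (simp add: card_cartesian_product cut_graphs_def)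
    then show ?thesis using f card_image_le[OF f] by (metis finite_imageI)
  qed
  show "finite (?Q R) \<and> (p - j) * (q' - j) - a * b * (p' + 2 * j) \<le> card (?Q R)" if RA: "R \<in> cut_graphs S T j" for R
  proof -
    have R: "R \<in> birel A B a b" and c: "card (R \<inter> S \<times> (B - T)) = j" using RA by (auto simp: cut_graphs_def)
    have fR: "finite R" by (rule fin_R[OF R])
    let ?P = "(\<lambda>((x1, y1), (x2, y2)). (x1, y1, x2, y2)) ` ((R \<inter> S \<times> T) \<times> (R \<inter> (A - S) \<times> (B - T)))"
    let ?B1 = "{(x1, y1, x2, y2). (x1, y2) \<in> R \<inter> S \<times> (B - T) \<and> (x1, y1) \<in> R \<and> (x2, y2) \<in> R}"
    let ?B2 = "{(x1, y1, x2, y2). (x2, y1) \<in> R \<inter> (A - S) \<times> T \<and> (x1, y1) \<in> R \<and> (x2, y2) \<in> R}"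
    have cP: "card ?P = (p - j) * (q' - j)"
      using counts[OF RA] by (subst card_image) (auto simp: inj_on_def card_cartesian_product)
    have Z1: "R \<inter> S \<times> (B - T) \<subseteq> R" and Z2: "R \<inter> (A - S) \<times> T \<subseteq> R" by auto
    have B1: "finite ?B1" "card ?B1 \<le> a * b * j" using card_squares_le[OF R Z1] c by auto
    have B2: "finite ?B2" "card ?B2 \<le> a * b * (p' + j)" using card_squares_le'[OF R Z2] counts[OF RA] by auto
    have QP: "?Q R \<subseteq> ?P"
    proof
      fix q assume "q \<in> ?Q R"
      then obtain x1 y1 x2 y2 where "q = (x1, y1, x2, y2)" "(x1, y1) \<in> R \<inter> S \<times> T"
          "(x2, y2) \<in> R \<inter> (A - S) \<times> (B - T)" by (auto simp: switchable_def)
      then show "q \<in> ?P" by (intro image_eqI[of _ _ "((x1, y1), (x2, y2))"]) simp_all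
    qed
    have fQ: "finite (?Q R)" by (rule finite_subset[OF QP]) (use fR in auto)
    have "?P \<subseteq> ?Q R \<union> (?B1 \<union> ?B2)" by (auto simp: switchable_def)
    then have "card ?P \<le> card (?Q R \<union> (?B1 \<union> ?B2))" using fQ B1 B2 by (intro card_mono) auto
    also have "\<dots> \<le> card (?Q R) + (card ?B1 + card ?B2)"
      by (meson add_left_mono card_Un_le order_trans)
    finally have "(p - j) * (q' - j) \<le> card (?Q R) + (a * b * j + a * b * (p' + j))"
      using cP B1(2) B2(2) by linarith
    moreover have "a * b * j + a * b * (p' + j) = a * b * (p' + 2 * j)" by (simp add: algebra_simps)
    ultimately show ?thesis using fQ by simp
  qed
  show "switchable R q \<and> switch R q \<in> cut_graphs S T (Suc j) \<and> crossed q \<in> ?Q' (switch R q)"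
    if RQ: "R \<in> cut_graphs S T j" "q \<in> ?Q R" for R q
  proof -
    have R: "R \<in> birel A B a b" and c: "card (R \<inter> S \<times> (B - T)) = j" using RQ(1) by (auto simp: cut_graphs_def)
    obtain x1 y1 x2 y2 where q: "q = (x1, y1, x2, y2)" "x1 \<in> S" "y1 \<in> T" "x2 \<in> A - S" "y2 \<in> B - T"
      and sw: "switchable R q" using RQ(2) by auto
    have "switch R q \<inter> S \<times> (B - T) = insert (x1, y2) (R \<inter> S \<times> (B - T))"
      using q by (auto simp: switch_def)
    moreover have "(x1, y2) \<notin> R" using sw q(1) by (simp add: switchable_def)
    ultimately have "card (switch R q \<inter> S \<times> (B - T)) = Suc j"
      using fin_R[OF R] c by simp
    then have 1: "switch R q \<in> cut_graphs S T (Suc j)" using switch_in_birel[OF R sw] by (simp add: cut_graphs_def)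
    have "((x1, y2), (x2, y1)) \<in> (switch R q \<inter> S \<times> (B - T)) \<times> (switch R q \<inter> (A - S) \<times> T)"
      using q by (simp add: switch_def)
    then have "(\<lambda>((x1, y1), (x2, y2)). (x1, y1, x2, y2)) ((x1, y2), (x2, y1)) \<in> ?Q' (switch R q)" by (rule imageI)
    then have "crossed q \<in> ?Q' (switch R q)" by (simp add: q(1) crossed_def)
    with 1 sw show ?thesis by blast
  qed
qed

end

section \<open>Comparison with hypergeometric weights\<close>

lemma choose_Suc_mult: "(n choose Suc k) * Suc k = (n choose k) * (n - k)"
proof -
  have "Suc k * (n choose Suc k) = n * (n - 1 choose k)" by (rule binomial_absorption)
  also have "\<dots> = (n - k) * (n choose k)" using binomial_absorb_comp[of n k] by simp
  finally show ?thesis by (simp only: mult.commute)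
qed

text \<open>The factor \<open>(Suc j) ^ (4 * L)\<close> absorbs the error term \<open>L * (p' + 2 * j)\<close>; without the
  error the recursion gives \<open>c 0 * w j \<le> c j * w 0\<close>, where \<open>w\<close> is a hypergeometric weight.\<close>

lemma hypergeometric_recursion_bound:
  fixes c :: "nat \<Rightarrow> nat" and p p' q' L N :: nat
  assumes rec: "\<And>j. c j * ((p - j) * (q' - j) - L * (p' + 2 * j)) \<le> c (Suc j) * (Suc j * (p' + j + 1))"
    and cN: "\<And>j. c j \<le> N" and L: "L \<ge> 1" "16 * L \<le> p" "8 * L \<le> q'" "p' \<le> p"
  defines "M \<equiv> p + p' + q'"
  shows "c 0 * (M choose p) \<le> (M + 1) ^ (4 * L + 1) * (p + p' choose p) * N"
proof -
  \<comment> \<open>Among M points of which p are marked, \<open>w j\<close> counts the q'-subsets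
    with exactly j marked points; so the weights add up to M choose q'.\<close>
  define w where "w j = (p choose j) * (p' + q' choose (q' - j))" for j
  define u where "u j = (p - j) * (q' - j)" for j
  define v where "v j = Suc j * (p' + j + 1)" for j
  have w_rec: "w (Suc j) * v j = w j * u j" if "j < q'" for j
  proof -
    have "(p' + q' choose (q' - Suc j)) * (p' + j + 1) = (p' + q' choose (q' - j)) * (q' - j)"
    proof -
      have 1: "Suc (q' - Suc j) = q' - j" and 2: "p' + q' - (q' - Suc j) = p' + j + 1" using that by simp_all
      show ?thesis using choose_Suc_mult[of "p' + q'" "q' - Suc j"] unfolding 1 2 by simp
    qed
    moreover have "(p choose Suc j) * Suc j = (p choose j) * (p - j)" by (rule choose_Suc_mult)
    ultimately have "((p choose Suc j) * Suc j) * ((p' + q' choose (q' - Suc j)) * (p' + j + 1))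
      = ((p choose j) * (p - j)) * ((p' + q' choose (q' - j)) * (q' - j))" by simp
    then show ?thesis unfolding w_def u_def v_def by (simp only: ac_simps)
  qed
  have sumw: "(\<Sum>j\<le>q'. w j) = (M choose q')"
    using vandermonde[of p "p' + q'" q'] by (simp add: w_def M_def add.assoc)
  \<comment> \<open>The largest of the q' + 1 weights carries at least the average, so it is enough
    to compare \<open>c 0\<close> with \<open>c J\<close>.\<close>
  obtain J where J: "J \<le> q'" "\<And>j. j \<le> q' \<Longrightarrow> w j \<le> w J"
  proof -
    have "Max (w ` {..q'}) \<in> w ` {..q'}" by (rule Max_in) auto
    then obtain J where J: "Max (w ` {..q'}) = w J" "J \<in> {..q'}" by (rule imageE)
    have "w j \<le> w J" if "j \<le> q'" for j using that unfolding J(1)[symmetric] by (intro Max_ge) auto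
    then show ?thesis using that[of J] J(2) by simp
  qed
  have "(M choose q') \<le> (\<Sum>j\<le>q'. w J)" unfolding sumw[symmetric] using J by (intro sum_mono) auto
  then have wJ: "(M choose q') \<le> (q' + 1) * w J" by simp
  have "0 < (M choose q')" by (simp add: M_def)
  then have wJpos: "0 < w J" using wJ by (cases "w J = 0") auto
  then have Jp: "J \<le> p" unfolding w_def by (metis binomial_eq_0 linorder_not_le mult_0 less_irrefl)
  have wpos: "0 < w j" if "j \<le> J" for j
    unfolding w_def using that J(1) Jp by simp
  \<comment> \<open>Up to the maximal weight the ratio of consecutive weights is at least 1: this
    holds just below J, and going down \<open>u\<close> increases while \<open>v\<close> decreases.
    It lets the error, which is comparable to \<open>v\<close>, be measured against
    \<open>u\<close>.\<close>
  have uv: "v j \<le> u j" if jJ: "j < J" for j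
  proof -
    obtain i where i: "J = Suc i" using less_imp_Suc_add[OF jJ] by blast
    have "w i * v i \<le> w (Suc i) * v i" using J(2)[of i] J(1) i by simp
    also have "\<dots> = w i * u i" using w_rec J(1) i by simp
    finally have "v i \<le> u i" using wpos[of i] i by simp
    moreover have "v j \<le> v i" unfolding v_def using that i by (intro mult_le_mono) auto
    moreover have "u i \<le> u j" unfolding u_def using that i by (intro mult_le_mono) auto
    ultimately show ?thesis by linarith
  qed
  have main: "real (c 0) * real (w j) \<le> real (Suc j) ^ (4 * L) * real (c j) * real (w 0)" if "j \<le> J" for j
    using that
  proof (induction j)
    case 0
    then show ?case by simp
  next
    case (Suc j)
    then have jJ: "j < J" by simp
    \<comment> \<open>The increase of the factor (Suc j) ^ (4 * L) from j to Suc j has to pay for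
      the loss e. What is needed is \<open>gu\<close>, and Bernoulli's inequality gives \<gamma> *
      (1 + y) \<le> 1.\<close>
    define \<gamma> where "\<gamma> = (real (Suc j) / real (Suc (Suc j))) ^ (4 * L)"
    define e where "e = L * (p' + 2 * j)"
    define y where "y = 4 * real L / real (Suc j)"
    have y0: "0 \<le> y" by (simp add: y_def)
    have "1 + real (4 * L) * (1 / real (Suc j)) \<le> (1 + 1 / real (Suc j)) ^ (4 * L)"
      by (rule Bernoulli_inequality) (auto simp: field_simps)
    then have "1 + y \<le> (1 + 1 / real (Suc j)) ^ (4 * L)" by (simp add: y_def)
    moreover have "1 + 1 / real (Suc j) = inverse (real (Suc j) / real (Suc (Suc j)))"
      by (simp add: field_simps)
    ultimately have "1 + y \<le> inverse \<gamma>" by (simp only: \<gamma>_def power_inverse)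
    moreover have g0: "0 < \<gamma>" by (simp add: \<gamma>_def)
    ultimately have g1: "\<gamma> * (1 + y) \<le> 1" by (simp add: field_simps)
    have gu: "\<gamma> * real (u j) + real e \<le> real (u j)"
    \<comment> \<open>For large j, \<gamma> \<le> 1 - y / 2 and the error is at most y / 2 * v j.
      For small j the error may exceed that, but \<gamma> \<le> 1 / 2 and e is at most half of u j
      because p and q' are large compared with L.\<close>
    proof (cases "4 * L \<le> Suc j")
      case True
      then have y1: "y \<le> 1" by (simp add: y_def field_simps)
      have "\<gamma> \<le> 1 / (1 + y)" using g1 y0 by (simp add: field_simps)
      also have "\<dots> \<le> 1 - y / 2" using y0 y1 mult_left_le[of y y] by (simp add: field_simps power2_eq_square)
      finally have gy: "\<gamma> \<le> 1 - y / 2" .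
      have "real e \<le> real (2 * L * (p' + j + 1))" unfolding e_def of_nat_le_iff by (simp add: algebra_simps)
      also have "\<dots> = y / 2 * real (v j)"
        unfolding y_def v_def of_nat_mult by (simp add: field_simps)
      also have "\<dots> \<le> y / 2 * real (u j)" using uv[OF jJ] y0 by (intro mult_left_mono) auto
      finally have "real e \<le> y / 2 * real (u j)" .
      moreover have "\<gamma> * real (u j) \<le> (1 - y / 2) * real (u j)" by (intro mult_right_mono gy) simp
      ultimately show ?thesis by (simp add: algebra_simps)
    next
      case False
      then have y1: "1 \<le> y" by (simp add: y_def field_simps)
      have "\<gamma> * 2 \<le> \<gamma> * (1 + y)" using g0 y1 by simp
      then have gy: "\<gamma> \<le> 1 / 2" using g1 by simp
      have j: "j < 4 * L" using False by simp
      have "2 * e = (p' + 2 * j) * (2 * L)" by (simp add: e_def)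
      also have "\<dots> \<le> (2 * (p - 4 * L)) * (2 * L)" using j L by (intro mult_le_mono1) linarith
      also have "\<dots> = (p - 4 * L) * (4 * L)" by simp
      also have "\<dots> \<le> (p - j) * (q' - j)" using j L by (intro mult_le_mono) linarith+
      finally have "2 * real e \<le> real (u j)" unfolding u_def by (metis of_nat_le_iff of_nat_mult of_nat_numeral)
      moreover have "\<gamma> * real (u j) \<le> 1 / 2 * real (u j)" by (intro mult_right_mono gy) simp
      ultimately show ?thesis by simp
    qed
    then have eu: "e \<le> u j" using g0 by (smt (verit) mult_nonneg_nonneg of_nat_0_le_iff of_nat_le_iff)
    have "c j * (u j - e) \<le> c (Suc j) * v j" using rec[of j] by (simp only: u_def v_def e_def)
    then have "real (c j) * real (u j - e) \<le> real (c (Suc j)) * real (v j)" by (metis of_nat_le_iff of_nat_mult)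
    then have cu: "real (c j) * (\<gamma> * real (u j)) \<le> real (c (Suc j)) * real (v j)"
      using gu eu mult_left_mono[of "\<gamma> * real (u j)" "real (u j - e)" "real (c j)"] by (simp add: of_nat_diff)
    have IH: "real (c 0) * real (w j) \<le> real (Suc j) ^ (4 * L) * real (c j) * real (w 0)" using Suc by simp
    have wr: "real (w (Suc j)) * real (v j) = real (w j) * real (u j)"
      using w_rec[of j] jJ J(1) by (metis of_nat_mult less_le_trans)
    have S: "real (Suc j) ^ (4 * L) = \<gamma> * real (Suc (Suc j)) ^ (4 * L)"
      unfolding \<gamma>_def by (simp add: power_divide)
    have "(real (c 0) * real (w (Suc j))) * real (v j) = (real (c 0) * real (w j)) * real (u j)"
      using wr by (simp add: mult.assoc)
    also have "\<dots> \<le> (real (Suc j) ^ (4 * L) * real (c j) * real (w 0)) * real (u j)"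
      by (intro mult_right_mono IH) simp
    also have "\<dots> = real (Suc (Suc j)) ^ (4 * L) * real (w 0) * (real (c j) * (\<gamma> * real (u j)))"
      unfolding S by (simp only: ac_simps)
    also have "\<dots> \<le> real (Suc (Suc j)) ^ (4 * L) * real (w 0) * (real (c (Suc j)) * real (v j))"
      by (intro mult_left_mono cu) simp
    also have "\<dots> = (real (Suc (Suc j)) ^ (4 * L) * real (c (Suc j)) * real (w 0)) * real (v j)"
      by (simp only: ac_simps)
    finally have "(real (c 0) * real (w (Suc j))) * real (v j)
      \<le> (real (Suc (Suc j)) ^ (4 * L) * real (c (Suc j)) * real (w 0)) * real (v j)" .
    moreover have "0 < real (v j)" unfolding v_def of_nat_0_less_iff by simp
    ultimately show ?case by (rule mult_right_le_imp_le)
  qed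
  have "real (c 0) * real (w J) \<le> real (Suc J) ^ (4 * L) * real (c J) * real (w 0)" by (rule main) simp
  then have "c 0 * w J \<le> Suc J ^ (4 * L) * c J * w 0" by (metis of_nat_le_iff of_nat_mult of_nat_power)
  also have "\<dots> \<le> (M + 1) ^ (4 * L) * N * (p' + q' choose q')"
    using J(1) cN[of J] unfolding w_def by (intro mult_le_mono power_mono) (auto simp: M_def)
  finally have step: "c 0 * w J \<le> (M + 1) ^ (4 * L) * N * (p' + q' choose q')" .
  have "c 0 * (M choose q') \<le> c 0 * ((M + 1) * w J)"
    using wJ by (intro mult_le_mono2 order_trans[OF wJ] mult_le_mono1) (simp add: M_def)
  also have "\<dots> = (M + 1) * (c 0 * w J)" by (rule mult.left_commute)
  also have "\<dots> \<le> (M + 1) * ((M + 1) ^ (4 * L) * N * (p' + q' choose q'))" by (intro mult_le_mono2 step)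
  finally have fin: "c 0 * (M choose q') \<le> (M + 1) ^ (4 * L + 1) * (p' + q' choose q') * N"
    unfolding power_add power_one_right by (simp only: ac_simps)
  \<comment> \<open>The quotient of \<open>w 0\<close> by M choose q' is the probability that a
    random q'-set avoids a fixed p-set. Counted from the p-set instead, it is the quotient of p + p'
    choose p by M choose p.\<close>
  have "(M choose (p + p')) * (p + p' choose p) = (M choose p) * (M - p choose (p + p' - p))"
    by (rule choose_mult) (auto simp: M_def)
  moreover have "(M choose (p + p')) = (M choose q')"
    using binomial_symmetric[of "p + p'" M] by (simp add: M_def)
  moreover have "(M - p choose (p + p' - p)) = (p' + q' choose q')"
    using binomial_symmetric[of p' "p' + q'"] by (simp add: M_def)
  ultimately have id: "(M choose q') * (p + p' choose p) = (M choose p) * (p' + q' choose q')" by simp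
  have pos: "0 < (p' + q' choose q')" by simp
  have "(c 0 * (M choose p)) * (p' + q' choose q') = (c 0 * (M choose q')) * (p + p' choose p)"
    using id by (simp only: ac_simps)
  also have "\<dots> \<le> ((M + 1) ^ (4 * L + 1) * (p' + q' choose q') * N) * (p + p' choose p)"
    by (intro mult_le_mono1 fin)
  also have "\<dots> = ((M + 1) ^ (4 * L + 1) * (p + p' choose p) * N) * (p' + q' choose q')" by (simp only: ac_simps)
  finally show ?thesis using pos by (metis mult_le_cancel2)
qed

text \<open>The quotient of the binomials is the chance that the a * card S half-edges at S, matched
  uniformly, all end among the b * card T half-edges at T. The size hypotheses are those of the
  recursion with L = a * b.\<close>

lemma (in bireg) card_no_cut_edges_le:
  assumes S: "S \<subseteq> A" and T: "T \<subseteq> B" and "a \<ge> 1" "b \<ge> 1"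
    and p: "a * card S \<le> b * card T" "b * card T \<le> 2 * (a * card S)" "16 * (a * b) \<le> a * card S"
    and q: "b * card T + 8 * (a * b) \<le> a * b * n"
  shows "card {R \<in> birel A B a b. R `` S \<subseteq> T} * (a * b * n choose (a * card S))
    \<le> (a * b * n + 1) ^ (4 * (a * b) + 1) * (b * card T choose (a * card S)) * card (birel A B a b)"
proof -
  define p where "p = a * card S"
  define p' where "p' = b * card T - a * card S"
  define q' where "q' = a * b * n - b * card T"
  have "card (cut_graphs S T 0) * (p + p' + q' choose p)
    \<le> (p + p' + q' + 1) ^ (4 * (a * b) + 1) * (p + p' choose p) * card (birel A B a b)"
  proof (rule hypergeometric_recursion_bound)
    show "card (cut_graphs S T j) * ((p - j) * (q' - j) - a * b * (p' + 2 * j)) \<le> card (cut_graphs S T (Suc j)) * (Suc j * (p' + j + 1))" for j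
      unfolding p_def p'_def q'_def by (rule card_cut_graphs_step[OF S T assms(5)])
    show "card (cut_graphs S T j) \<le> card (birel A B a b)" for j
      unfolding cut_graphs_def by (intro card_mono fin_birel) auto
  qed (use assms in \<open>auto simp: p_def p'_def q'_def\<close>)
  moreover have "cut_graphs S T 0 = {R \<in> birel A B a b. R `` S \<subseteq> T}"
  proof -
    have "card (R \<inter> S \<times> (B - T)) = 0 \<longleftrightarrow> R `` S \<subseteq> T" if "R \<in> birel A B a b" for R
      using fin_R[OF that] birelD(1)[OF that] by auto
    then show ?thesis unfolding cut_graphs_def by auto
  qed
  moreover have "p + p' + q' = a * b * n" "p + p' = b * card T" using assms by (auto simp: p_def p'_def q'_def)
  ultimately show ?thesis by (simp add: p_def)
qed

section \<open>Expansion\<close>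

lemma binomial_mult_le_binomial_add: "(m choose p) * (n choose q) \<le> (m + n choose (p + q))"
proof -
  have "(m choose p) * (n choose (p + q - p)) \<le> (\<Sum>k\<le>p + q. (m choose k) * (n choose (p + q - k)))"
    by (rule member_le_sum) auto
  then show ?thesis by (simp add: vandermonde)
qed

lemma binomial_power_le: "(n choose s) ^ r \<le> (r * n choose (r * s))"
proof (induction r)
  case (Suc r)
  have "(n choose s) ^ Suc r \<le> (n choose s) * (r * n choose (r * s))" using Suc by simp
  also have "\<dots> \<le> (n + r * n choose (s + r * s))" by (rule binomial_mult_le_binomial_add)
  finally show ?case by simp
qed simp

text \<open>Chernoff's trick: \<open>(m choose x) * y ^ x\<close> is a term of \<open>(1 + y) ^ m\<close>, with \<open>y = \<delta> * p / m\<close>.\<close>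

lemma ln_binomial_le:
  fixes \<delta> :: real
  assumes p: "0 < p" "p \<le> m" and x: "real x \<le> \<delta> * real p" "x \<le> m" and \<delta>: "0 < \<delta>" "\<delta> \<le> 1"
  shows "ln (real (m choose x)) \<le> \<delta> * real p * (1 + ln (1 / \<delta>) + ln (real m / real p))"
proof -
  define y where "y = \<delta> * real p / real m"
  have m: "0 < real m" using p by simp
  have y: "0 < y" "y \<le> 1" using p \<delta> m mult_mono[of \<delta> 1 "real p" "real m"] by (auto simp: y_def)
  have "real (m choose x) * y ^ x \<le> (\<Sum>k\<le>m. real (m choose k) * y ^ k)"
    using y x by (intro member_le_sum) auto
  also have "\<dots> = (1 + y) ^ m" using binomial_ring[of y 1 m] by (simp add: add.commute)
  also have "\<dots> \<le> exp y ^ m" using y by (intro power_mono) (auto intro: exp_ge_add_one_self)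
  also have "\<dots> = exp (\<delta> * real p)" using m by (simp add: exp_of_nat_mult[symmetric] y_def)
  finally have "real (m choose x) * y ^ x \<le> exp (\<delta> * real p)" .
  then have "ln (real (m choose x) * y ^ x) \<le> \<delta> * real p"
    using y x by (subst ln_le_cancel_iff[symmetric, of _ "exp (\<delta> * real p)", simplified, symmetric])
      (auto simp: ln_le_cancel_iff)
  moreover have "ln (real (m choose x) * y ^ x) = ln (real (m choose x)) + real x * ln y"
    using y x by (simp add: ln_mult ln_realpow)
  moreover have "\<delta> * real p * ln y \<le> real x * ln y"
    using x y by (intro mult_right_mono_neg) auto
  moreover have "ln y = - ln (1 / \<delta>) - ln (real m / real p)"
    using p \<delta> m by (simp add: y_def ln_mult ln_div)
  ultimately show ?thesis by (simp add: algebra_simps)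
qed

lemma ln_binomial_ge:
  assumes "0 < p" "p \<le> m"
  shows "real p * ln (real m / real p) \<le> ln (real (m choose p))"
proof -
  have "(real m / real p) ^ p \<le> real (m choose p)"
    by (rule binomial_ge_n_over_k_pow_k) (use assms in auto)
  then have "ln ((real m / real p) ^ p) \<le> ln (real (m choose p))"
    using assms by (subst ln_le_cancel_iff) auto
  then show ?thesis using assms by (simp add: ln_realpow)
qed

lemma ln_200_le: "ln (200::real) \<le> 6"
proof -
  have "ln (200::real) \<le> ln (2 ^ 8)" by (subst ln_le_cancel_iff) auto
  also have "\<dots> = 8 * ln 2" by (subst ln_realpow) auto
  finally show ?thesis using ln2_le_25_over_36 by simp
qed

text \<open>Since 2 * p \<le> m, the logarithm l of m / p is at least 2 / 3. So 1 + ln 200 + l \<le>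
  7 + l \<le> 16 * l, and 12 * 16 / 200 = 24 / 25 is below 1.\<close>

lemma ln_binomial_small_le:
  assumes p: "0 < p" "2 * p \<le> m" and x: "200 * x \<le> p"
  shows "12 * ln (real (m choose x)) \<le> ln (real (m choose p))"
proof -
  define l where "l = ln (real m / real p)"
  have "2 \<le> real m / real p" using p by (simp add: field_simps)
  then have "ln 2 \<le> l" unfolding l_def by (subst ln_le_cancel_iff) auto
  then have l: "2 / 3 \<le> l" using ln2_ge_two_thirds by simp
  have "ln (real (m choose x)) \<le> 1 / 200 * real p * (1 + ln (1 / (1 / 200)) + l)"
    unfolding l_def by (rule ln_binomial_le) (use p x in auto)
  also have "\<dots> \<le> 1 / 200 * real p * (16 * l)"
    using ln_200_le l by (intro mult_left_mono) auto
  also have "\<dots> = 2 / 25 * (real p * l)" by simp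
  moreover have "0 \<le> real p * l" using l by simp
  ultimately have "12 * ln (real (m choose x)) \<le> real p * l" by linarith
  also have "\<dots> \<le> ln (real (m choose p))" unfolding l_def by (rule ln_binomial_ge) (use p in auto)
  finally show ?thesis .
qed

text \<open>The rate \<open>201 / 200\<close> is close enough to 1 for \<open>(m choose x) ^ 12 \<le> (m choose p)\<close> with
  \<open>200 * x \<le> p\<close>.\<close>

definition expanding :: "('v \<times> 'v) set \<Rightarrow> 'v set \<Rightarrow> nat \<Rightarrow> nat \<Rightarrow> nat \<Rightarrow> nat \<Rightarrow> bool" where
  "expanding R A a b n s0 \<longleftrightarrow> (\<forall>S \<subseteq> A. s0 \<le> card S \<longrightarrow> 2 * (a * card S) \<le> a * b * n \<longrightarrow>
     201 * (a * card S) \<le> 200 * (b * card (R `` S)))"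

section \<open>Union bound over the sets that do not expand\<close>

lemma ln_binomial_nonneg: "k \<le> n \<Longrightarrow> 0 \<le> ln (real (n choose k))"
  using zero_less_binomial[of k n] by (simp add: Suc_le_eq)

text \<open>The union bound over \<open>S\<close> and \<open>T\<close> beats the number of choices because \<open>1 / a + 1 / b < 1\<close>:
  \<open>(b * n choose s) ^ a\<close> and \<open>(a * n choose t) ^ b\<close> are at most \<open>a * b * n choose (a * s)\<close> and
  \<open>a * b * n choose (b * t)\<close>.\<close>

lemma choices_bound:
  fixes a b n s t s0 r :: nat
  assumes ab: "a \<ge> 3" "b \<ge> 3" and s: "s0 \<le> s" "0 < s0" "2 * (a * s) \<le> a * b * n" "s0 = 6 * r"
    and t: "a * s \<le> b * t" "200 * (b * t) < 201 * (a * s)" "t \<le> a * n"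
  shows "real (b * n choose s) * real (a * n choose t) * real (b * t choose (a * s)) / real (a * b * n choose (a * s))
    \<le> (real (a * s0) / real (a * b * n)) ^ (a * r)"
proof -
  \<comment> \<open>x is the number of edges at T beyond those coming from S. Failure of expansion
    makes it at most p / 200, so \<open>lZ\<close> is small against \<open>lN\<close>.\<close>
  define M p x where "M = a * b * n" and "p = a * s" and "x = b * t - a * s"
  define lN lZ where "lN = ln (real (M choose p))" and "lZ = ln (real (M choose x))"
  have pM: "2 * p \<le> M" "0 < p" using s ab by (auto simp: p_def M_def)
  have bt: "b * t = p + x" using t by (simp add: p_def x_def)
  have btM: "b * t \<le> M" using t mult_le_mono2[of t "a * n" b] by (simp add: M_def ac_simps)
  have bnd: "12 * lZ \<le> lN" unfolding lZ_def lN_def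
    by (rule ln_binomial_small_le) (use pM t in \<open>auto simp: p_def x_def\<close>)
  have sn: "s \<le> b * n"
  proof -
    have "a * s \<le> a * b * n" using s(3) by linarith
    then have "a * s \<le> a * (b * n)" by (simp only: mult.assoc)
    then show ?thesis using ab unfolding nat_mult_le_cancel_disj by auto
  qed
  have lN0: "0 \<le> lN" unfolding lN_def by (rule ln_binomial_nonneg) (use pM in linarith)
  have lZ0: "0 \<le> lZ" unfolding lZ_def by (rule ln_binomial_nonneg) (use bt btM in linarith)
  have l1: "3 * ln (real (b * n choose s)) \<le> lN"
  proof -
    have "real ((b * n choose s) ^ a) \<le> real (M choose p)"
      unfolding of_nat_le_iff M_def p_def mult.assoc by (rule binomial_power_le)
    then have "ln (real (b * n choose s) ^ a) \<le> lN"
      unfolding lN_def using sn pM by (subst ln_le_cancel_iff) auto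
    then have "real a * ln (real (b * n choose s)) \<le> lN" using sn by (simp add: ln_realpow)
    moreover have "3 * ln (real (b * n choose s)) \<le> real a * ln (real (b * n choose s))"
      using ab sn by (intro mult_right_mono ln_binomial_nonneg) simp_all
    ultimately show ?thesis by linarith
  qed
  have W: "ln (real (b * t choose p)) \<le> lZ"
  proof -
    have "(b * t choose p) = (b * t choose x)" using binomial_symmetric[of p "b * t"] bt by simp
    also have "\<dots> \<le> (M choose x)" by (rule binomial_right_mono[OF btM])
    finally show ?thesis unfolding lZ_def using bt btM by (subst ln_le_cancel_iff) auto
  qed
  have l2: "3 * ln (real (a * n choose t)) \<le> lN + lZ"
  proof -
    have "real ((a * n choose t) ^ b) \<le> real (M choose (b * t))"
      unfolding of_nat_le_iff M_def using binomial_power_le[of "a * n" t b] by (simp add: ac_simps)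
    then have "ln (real (a * n choose t) ^ b) \<le> ln (real (M choose (b * t)))"
      using t btM by (subst ln_le_cancel_iff) auto
    then have l2': "real b * ln (real (a * n choose t)) \<le> ln (real (M choose (b * t)))"
      using t by (simp add: ln_realpow)
    have l2'': "3 * ln (real (a * n choose t)) \<le> real b * ln (real (a * n choose t))"
      using ab t by (intro mult_right_mono ln_binomial_nonneg) simp_all
    \<comment> \<open>A (b * t)-set with a marked p-subset is a p-set with x further elements; this
      replaces the binomial at b * t by those at p and x.\<close>
    have cm: "(M choose (b * t)) * (b * t choose p) = (M choose p) * (M - p choose (b * t - p))"
      by (rule choose_mult) (use bt btM in auto)
    have "(M choose (b * t)) \<le> (M choose p) * (M choose x)"
    proof -
      have "(M - p choose (b * t - p)) \<le> (M choose x)" using bt by (simp add: binomial_right_mono)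
      then have "(M choose p) * (M - p choose (b * t - p)) \<le> (M choose p) * (M choose x)"
        by (rule mult_le_mono2)
      moreover have "(M choose (b * t)) * 1 \<le> (M choose (b * t)) * (b * t choose p)"
        by (intro mult_le_mono2) (use bt zero_less_binomial[of p "b * t"] in linarith)
      ultimately show ?thesis unfolding cm by linarith
    qed
    then have "real (M choose (b * t)) \<le> real (M choose p) * real (M choose x)"
      unfolding of_nat_mult[symmetric] of_nat_le_iff .
    then have "ln (real (M choose (b * t))) \<le> ln (real (M choose p) * real (M choose x))"
      using bt btM by (subst ln_le_cancel_iff) auto
    then have "ln (real (M choose (b * t))) \<le> lN + lZ"
      using bt btM pM by (simp add: lN_def lZ_def ln_mult)
    with l2' l2'' show ?thesis by linarith
  qed
  define l where "l = ln (real M / real (a * s0))"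
  have "a * s0 \<le> p" using s by (simp add: p_def)
  then have as0: "a * s0 \<le> M" "0 < a * s0" using pM s ab by auto
  have "real (a * s0) * l \<le> ln (real (M choose (a * s0)))" unfolding l_def by (rule ln_binomial_ge) (use as0 in auto)
  also have "\<dots> \<le> lN"
    unfolding lN_def using as0 pM \<open>a * s0 \<le> p\<close> binomial_mono[of "a * s0" p M]
    by (subst ln_le_cancel_iff) auto
  finally have lNge: "6 * (real (a * r) * l) \<le> lN" using s(4) by (simp add: algebra_simps)
  let ?V = "real (b * n choose s) * real (a * n choose t) * real (b * t choose p) / real (M choose p)"
  have pos: "0 < ?V" using sn t bt pM by (intro divide_pos_pos mult_pos_pos) auto
  have "ln ?V = ln (real (b * n choose s)) + ln (real (a * n choose t)) + ln (real (b * t choose p)) - lN"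
    unfolding lN_def using sn t bt pM by (simp add: ln_mult ln_div)
  \<comment> \<open>The balance is lN / 3 + (lN + lZ) / 3 + lZ - lN, at most - 2 / 9 * lN because 12
    * lZ \<le> lN. The factor 6 in s0 = 6 * r makes a sixth of lN sufficient.\<close>
  also have "\<dots> \<le> - (real (a * r) * l)" using l1 l2 W bnd lNge lN0 lZ0 by linarith
  finally have "exp (ln ?V) \<le> exp (- (real (a * r) * l))" unfolding exp_le_cancel_iff .
  then have "?V \<le> exp (- (real (a * r) * l))" unfolding exp_ln[OF pos] .
  also have "\<dots> = exp (- l) ^ (a * r)" by (simp add: exp_of_nat_mult[symmetric] algebra_simps)
  also have "exp (- l) = real (a * s0) / real M"
  proof -
    have "0 < real M / real (a * s0)"
      by (intro divide_pos_pos; unfold of_nat_0_less_iff; use as0 in linarith)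
    then show ?thesis unfolding l_def exp_minus exp_ln by simp
  qed
  finally show ?thesis by (simp add: M_def p_def)
qed

text \<open>A set S that does not expand is counted through the pair of S and its neighbourhood,
  whose weighted sizes differ by a factor below 201 / 200. Summing over the pairs of sizes costs (M
  + 1) ^ 2, which raises the exponent from 4 * (a * b) + 1 to 4 * (a * b) + 3.\<close>

lemma (in bireg) card_not_expanding_le:
  assumes ab: "a \<ge> 3" "b \<ge> 3" and r: "r = 4 * (a * b) + 5" and n: "n \<ge> 17"
  shows "real (card {R \<in> birel A B a b. \<not> expanding R A a b n (6 * r)})
    \<le> (real (a * b * n) + 1) ^ (4 * (a * b) + 3) * (real (a * (6 * r)) / real (a * b * n)) ^ (a * r)
       * real (card (birel A B a b))"
proof -
  define M where "M = a * b * n"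
  define X where "X = real (card (birel A B a b))"
  define G where "G = (real (a * (6 * r)) / real M) ^ (a * r)"
  define I where "I = {(s, t). s \<le> b * n \<and> t \<le> a * n \<and> 6 * r \<le> s \<and> 2 * (a * s) \<le> M \<and>
    a * s \<le> b * t \<and> 200 * (b * t) < 201 * (a * s)}"
  define E where "E S T = {R \<in> birel A B a b. R `` S \<subseteq> T}" for S T
  define \<S> where "\<S> = (\<lambda>(s, t). {S. S \<subseteq> A \<and> card S = s} \<times> {T. T \<subseteq> B \<and> card T = t})"
  have sub: "{R \<in> birel A B a b. \<not> expanding R A a b n (6 * r)} \<subseteq> (\<Union>i\<in>I. \<Union>(S, T)\<in>\<S> i. E S T)"
  proof
    fix R assume "R \<in> {R \<in> birel A B a b. \<not> expanding R A a b n (6 * r)}"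
    then obtain S where R: "R \<in> birel A B a b" and S: "S \<subseteq> A" "6 * r \<le> card S" "2 * (a * card S) \<le> M"
        "200 * (b * card (R `` S)) < 201 * (a * card S)"
      by (auto simp: expanding_def M_def not_le)
    have RS: "R `` S \<subseteq> B" using birelD(1)[OF R] by auto
    have "a * card S = card (R \<inter> S \<times> UNIV)" using card_from[OF R S(1)] by simp
    also have "\<dots> \<le> card (R \<inter> UNIV \<times> R `` S)" using fin_R[OF R] by (intro card_mono) auto
    also have "\<dots> = b * card (R `` S)" by (rule card_to[OF R RS])
    finally have le: "a * card S \<le> b * card (R `` S)" .
    have "(card S, card (R `` S)) \<in> I"
      using S le card_mono[OF fin(1) S(1)] card_mono[OF fin(2) RS] cards by (simp add: I_def)
    moreover have "(S, R `` S) \<in> \<S> (card S, card (R `` S))" using S(1) RS by (simp add: \<S>_def)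
    moreover have "R \<in> E S (R `` S)" using R by (simp add: E_def)
    ultimately show "R \<in> (\<Union>i\<in>I. \<Union>(S, T)\<in>\<S> i. E S T)" by blast
  qed
  have I: "I \<subseteq> {..b * n} \<times> {..a * n}" by (auto simp: I_def)
  then have fI: "finite I" by (rule finite_subset) simp
  have M: "0 < M" using ab n by (simp add: M_def)
  have fS: "finite (\<S> i)" and cS: "card (\<S> (s, t)) = (b * n choose s) * (a * n choose t)" for i s t
    using fin n_subsets[OF fin(1), of s] n_subsets[OF fin(2), of t]
    by (auto simp: \<S>_def cards card_cartesian_product split: prod.splits)
  have fE: "finite (E S T)" for S T using fin_birel by (simp add: E_def)
  have bound: "real (card (\<Union>(S, T)\<in>\<S> i. E S T)) \<le> (real M + 1) ^ (4 * (a * b) + 1) * G * X" if "i \<in> I" for i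
  proof -
    obtain s t where i: "i = (s, t)" by (cases i)
    have st: "s \<le> b * n" "t \<le> a * n" "6 * r \<le> s" "2 * (a * s) \<le> M" "a * s \<le> b * t" "200 * (b * t) < 201 * (a * s)"
      using that by (auto simp: I_def i)
    have ch: "0 < (M choose (a * s))" using st by simp
    define K where "K = (real M + 1) ^ (4 * (a * b) + 1) * real (b * t choose (a * s)) * X / real (M choose (a * s))"
    have one: "real (card (E S T)) \<le> K" if "(S, T) \<in> \<S> i" for S T
    proof -
      have c: "card (E S T) * (M choose (a * s)) \<le> (M + 1) ^ (4 * (a * b) + 1) * (b * t choose (a * s)) * card (birel A B a b)"
      proof -
        have ST: "S \<subseteq> A" "card S = s" "T \<subseteq> B" "card T = t" using that by (auto simp: \<S>_def i)
        have "16 * (a * b) \<le> a * s"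
        proof -
          have "a * (16 * b) \<le> a * s" using st(3) r ab by (intro mult_le_mono2) (simp, use mult_le_mono1[of 1 a b] in linarith)
          then show ?thesis by (simp add: ac_simps)
        qed
        moreover have "b * t + 8 * (a * b) \<le> a * b * n"
        proof -
          \<comment> \<open>b * t is below 201 / 400 of M, and n \<ge> 17 makes 8 * (a * b) at most
            8 / 17 of M; together they stay below M.\<close>
          have "a * b * 17 \<le> a * b * n" using n by (rule mult_le_mono2)
          then show ?thesis using st(4,6) unfolding M_def by linarith
        qed
        ultimately show ?thesis
          using card_no_cut_edges_le[OF ST(1,3)] ST(2,4) ab st(5,6) by (simp add: E_def M_def)
      qed
      from of_nat_mono[OF this, where 'a = real]
      have "real (card (E S T)) * real (M choose (a * s))
        \<le> (real M + 1) ^ (4 * (a * b) + 1) * real (b * t choose (a * s)) * X"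
        by (simp only: of_nat_mult of_nat_power of_nat_add of_nat_1 X_def)
      then show ?thesis unfolding K_def using ch by (subst pos_le_divide_eq) auto
    qed
    have "real (card (\<Union>(S, T)\<in>\<S> i. E S T)) \<le> real (\<Sum>(S, T)\<in>\<S> i. card (E S T))"
      unfolding of_nat_le_iff using card_UN_le[OF fS, of "\<lambda>(S, T). E S T" i] by (simp add: case_prod_unfold)
    also have "\<dots> = (\<Sum>(S, T)\<in>\<S> i. real (card (E S T)))" by (simp add: case_prod_unfold)
    also have "\<dots> \<le> (\<Sum>(S, T)\<in>\<S> i. K)" using one by (intro sum_mono) auto
    also have "\<dots> = real ((b * n choose s) * (a * n choose t)) * K"
      using cS[of s t] by (simp add: i case_prod_unfold)
    also have "\<dots> = (real M + 1) ^ (4 * (a * b) + 1) *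
      (real (b * n choose s) * real (a * n choose t) * real (b * t choose (a * s)) / real (M choose (a * s))) * X"
      unfolding K_def by simp
    also have "\<dots> \<le> (real M + 1) ^ (4 * (a * b) + 1) * G * X"
      unfolding G_def M_def
      by (intro mult_right_mono mult_left_mono choices_bound)
        (use ab st r in \<open>auto simp: X_def M_def\<close>)
    finally show ?thesis .
  qed
  have "card {R \<in> birel A B a b. \<not> expanding R A a b n (6 * r)} \<le> card (\<Union>i\<in>I. \<Union>(S, T)\<in>\<S> i. E S T)"
    by (rule card_mono[OF _ sub]) (use fI fS fE in auto)
  also have "\<dots> \<le> (\<Sum>i\<in>I. card (\<Union>(S, T)\<in>\<S> i. E S T))" by (rule card_UN_le[OF fI])
  finally have "real (card {R \<in> birel A B a b. \<not> expanding R A a b n (6 * r)})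
    \<le> (\<Sum>i\<in>I. real (card (\<Union>(S, T)\<in>\<S> i. E S T)))" unfolding of_nat_sum[symmetric] of_nat_le_iff .
  also have "\<dots> \<le> (\<Sum>i\<in>I. (real M + 1) ^ (4 * (a * b) + 1) * G * X)" by (rule sum_mono[OF bound])
  also have "\<dots> = real (card I) * ((real M + 1) ^ (4 * (a * b) + 1) * G * X)" by simp
  also have "\<dots> \<le> (real M + 1) ^ 2 * ((real M + 1) ^ (4 * (a * b) + 1) * G * X)"
  proof (rule mult_right_mono)
    have "card I \<le> (b * n + 1) * (a * n + 1)"
      using card_mono[OF _ I] by (simp add: card_cartesian_product)
    also have "\<dots> \<le> (M + 1) * (M + 1)"
      using ab by (intro mult_le_mono) (auto simp: M_def)
    finally have "real (card I) \<le> real ((M + 1) * (M + 1))" by (rule of_nat_mono)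
    then show "real (card I) \<le> (real M + 1) ^ 2" by (simp add: power2_eq_square algebra_simps)
  qed (simp add: G_def X_def)
  also have "\<dots> = (real M + 1) ^ (4 * (a * b) + 3) * G * X"
    by (simp add: power_add power2_eq_square power3_eq_cube)
  finally show ?thesis by (simp only: G_def X_def M_def)
qed

lemma card_not_expanding_small:
  fixes a b :: nat
  assumes ab: "a \<ge> 3" "b \<ge> 3"
  shows "\<exists>s0 n0. s0 > 0 \<and> (\<forall>n \<ge> n0. \<forall>A B :: 'v set. bireg A B a b n \<longrightarrow>
    real n * real (card {R \<in> birel A B a b. \<not> expanding R A a b n s0}) \<le> real (card (birel A B a b)))"
proof -
  \<comment> \<open>Two more than the degree of the polynomial factor, which leaves a failure
    probability of order 1 / M ^ 2.\<close>
  define r where "r = 4 * (a * b) + 5"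
  define c where "c = real (a * (6 * r))"
  define C where "C = 2 ^ (4 * (a * b) + 3) * c ^ r"
  define n0 where "n0 = nat \<lceil>C + c\<rceil> + 17"
  have c0: "0 < c" unfolding c_def of_nat_0_less_iff using ab by (simp add: r_def)
  show ?thesis
  proof (rule exI[of _ "6 * r"], rule exI[of _ n0], intro conjI allI impI)
    show "0 < 6 * r" by (simp add: r_def)
    fix n and A B :: "'v set"
    assume n: "n0 \<le> n" and br: "bireg A B a b n"
    define M where "M = real (a * b * n)"
    have "n \<le> a * b * n" using ab by simp
    then have nM: "real n \<le> M" unfolding M_def by (rule of_nat_mono)
    have nC: "C + c \<le> real n" "17 \<le> n" using n by (auto simp: n0_def) linarith
    have C0: "0 < C" using c0 by (simp add: C_def)
    have M: "C \<le> M" "c \<le> M" "1 \<le> M" using nM nC C0 c0 by auto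
    let ?b = "real (card {R \<in> birel A B a b. \<not> expanding R A a b n (6 * r)})"
    have "?b \<le> (M + 1) ^ (4 * (a * b) + 3) * (c / M) ^ (a * r) * real (card (birel A B a b))"
      unfolding M_def c_def by (rule bireg.card_not_expanding_le[OF br ab r_def nC(2)])
    also have "\<dots> \<le> (2 * M) ^ (4 * (a * b) + 3) * (c / M) ^ r * real (card (birel A B a b))"
    proof (intro mult_right_mono mult_mono power_mono power_decreasing)
      show "r \<le> a * r" using ab by simp
    qed (use M c0 in auto)
    also have "\<dots> = C / M ^ 2 * real (card (birel A B a b))"
    proof -
      have "M ^ r = M ^ (4 * (a * b) + 3) * M ^ 2" unfolding r_def power_add[symmetric] by (simp add: add.commute)
      then show ?thesis using M by (simp add: C_def power_mult_distrib power_divide)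
    qed
    finally have "real n * ?b \<le> M * (C / M ^ 2 * real (card (birel A B a b)))"
      using nM by (intro mult_mono) auto
    also have "\<dots> = (C / M) * real (card (birel A B a b))" using M by (simp add: power2_eq_square)
    also have "\<dots> \<le> 1 * real (card (birel A B a b))" using M C0 by (intro mult_right_mono) auto
    finally show "real n * ?b \<le> real (card (birel A B a b))" by simp
  qed
qed

section \<open>The fire in a tree-like ball\<close>

definition nb :: "'a graph \<Rightarrow> 'a set \<Rightarrow> 'a set" where
  "nb G U = {w \<in> verts G. \<exists>u\<in>U. {u, w} \<in> edges G}"

abbreviation prot :: "(nat \<Rightarrow> 'a set) \<Rightarrow> nat \<Rightarrow> 'a set" where
  "prot S t \<equiv> (\<Union>s<t. S s)"

text \<open>A ball is a fire without firefighters, so facts about \<open>burned\<close> hold for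
  balls as well.\<close>

abbreviation ball_at :: "'a graph \<Rightarrow> 'a \<Rightarrow> nat \<Rightarrow> 'a set" where
  "ball_at G v \<equiv> burned G v (\<lambda>_. {})"

primrec level :: "'a graph \<Rightarrow> 'a \<Rightarrow> nat \<Rightarrow> 'a set" where
  "level G v 0 = {v}"
| "level G v (Suc t) = ball_at G v (Suc t) - ball_at G v t"

text \<open>In a bipartite graph no edge joins two vertices of the same level, so unique parents up
  to level D make the ball of radius D a tree.\<close>

definition tree_like :: "'a graph \<Rightarrow> 'a \<Rightarrow> nat \<Rightarrow> bool" where
  "tree_like G v D \<longleftrightarrow> (\<forall>t<D. \<forall>w\<in>level G v (Suc t). \<forall>u\<in>level G v t. \<forall>u'\<in>level G v t.
     {u, w} \<in> edges G \<longrightarrow> {u', w} \<in> edges G \<longrightarrow> u = u')"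

lemma burned_Suc: "burned G v S (Suc t) = burned G v S t \<union> (nb G (burned G v S t) - prot S (Suc t))"
  by (auto simp: nb_def lessThan_Suc_atMost)

lemma ball_at_Suc: "ball_at G v (Suc t) = ball_at G v t \<union> nb G (ball_at G v t)"
  by (auto simp: nb_def)

lemma burned_mono: "s \<le> t \<Longrightarrow> burned G v S s \<subseteq> burned G v S t"
  by (rule lift_Suc_mono_le[of "burned G v S"]) auto

lemma nb_mono: "U \<subseteq> U' \<Longrightarrow> nb G U \<subseteq> nb G U'"
  by (auto simp: nb_def)

lemma burned_subset: "v \<in> verts G \<Longrightarrow> burned G v S t \<subseteq> verts G"
  by (induction t) auto

lemma ball_at_levels: "w \<in> ball_at G v t \<Longrightarrow> \<exists>s\<le>t. w \<in> level G v s"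
proof (induction t)
  case (Suc t)
  show ?case
  proof (cases "w \<in> ball_at G v t")
    case True
    then show ?thesis using Suc.IH le_SucI by blast
  next
    case False
    then have "w \<in> level G v (Suc t)" using Suc.prems by simp
    then show ?thesis by blast
  qed
qed simp

lemma level_subset_ball: "level G v t \<subseteq> ball_at G v t"
  by (cases t) auto

lemma level_not_ball: "w \<in> level G v t \<Longrightarrow> s < t \<Longrightarrow> w \<notin> ball_at G v s"
proof -
  assume w: "w \<in> level G v t" and s: "s < t"
  then obtain t' where t': "t = Suc t'" by (cases t) auto
  then have "w \<notin> ball_at G v t'" using w by simp
  then show ?thesis using burned_mono[of s t' G v "\<lambda>_. {}"] s t' by auto
qed

lemma level_unique: "w \<in> level G v s \<Longrightarrow> w \<in> level G v t \<Longrightarrow> s = t"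
  using level_not_ball level_subset_ball by (metis linorder_neqE_nat subsetD)

lemma nb_level_near:
  assumes "u \<in> level G v t" "w \<in> verts G" "{u, w} \<in> edges G"
  shows "w \<in> ball_at G v (Suc t)"
  using assms level_subset_ball[of G v t] unfolding ball_at_Suc nb_def by auto

lemma level_parent:
  assumes w: "w \<in> level G v (Suc t)"
  shows "w \<in> verts G" "\<exists>u\<in>level G v t. {u, w} \<in> edges G"
proof -
  have "w \<in> ball_at G v (Suc t)" "w \<notin> ball_at G v t" using w unfolding level.simps by blast+
  then have "w \<in> nb G (ball_at G v t)" unfolding ball_at_Suc by blast
  then obtain u where u: "u \<in> ball_at G v t" "w \<in> verts G" "{u, w} \<in> edges G"
    unfolding nb_def by blast
  obtain s where s: "s \<le> t" "u \<in> level G v s" using ball_at_levels[OF u(1)] by blast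
  have "w \<in> ball_at G v (Suc s)" by (rule nb_level_near[OF s(2) u(2,3)])
  then have "\<not> Suc s < Suc t" using level_not_ball[OF w] by blast
  then have "s = t" using s(1) by simp
  then show "w \<in> verts G" "\<exists>u\<in>level G v t. {u, w} \<in> edges G" using u s by auto
qed

lemma card_prot_le:
  assumes "strategy k G v S"
  shows "finite (prot S t)" "card (prot S t) \<le> k * t"
proof -
  show "finite (prot S t)" using assms by (auto simp: strategy_def)
  have "card (prot S t) \<le> (\<Sum>s<t. card (S s))" by (rule card_UN_le) simp
  also have "\<dots> \<le> (\<Sum>s<t. k)" using assms by (intro sum_mono) (auto simp: strategy_def)
  finally show "card (prot S t) \<le> k * t" by (simp add: mult.commute)
qed

text \<open>Sides and degrees are indexed with period two, so that \<open>V t\<close> is the side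
  containing level t around an origin in \<open>V 0\<close>. Origins in either part are then treated
  alike, by choosing which part is \<open>V 0\<close>.\<close>

locale parity_graph =
  fixes G :: "'a graph" and V :: "nat \<Rightarrow> 'a set" and dg :: "nat \<Rightarrow> nat"
  assumes per: "V (Suc (Suc i)) = V i" "dg (Suc (Suc i)) = dg i"
    and finite_verts: "finite (verts G)"
    and verts_eq: "verts G = V i \<union> V (Suc i)"
    and disj: "V i \<inter> V (Suc i) = {}"
    and edge_parity: "u \<in> V i \<Longrightarrow> {u, w} \<in> edges G \<Longrightarrow> w \<in> V (Suc i)"
    and deg: "u \<in> V i \<Longrightarrow> degree G u = dg i"
begin

lemma V_parity: "V i = V (i mod 2)" "dg i = dg (i mod 2)"
proof -
  have "V i = V (i mod 2) \<and> dg i = dg (i mod 2)"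
  proof (induction i rule: less_induct)
    case (less i)
    consider "i = 0" | "i = 1" | j where "i = Suc (Suc j)" by (metis One_nat_def not0_implies_Suc)
    then show ?case
    proof cases
      case 3
      then show ?thesis using less[of j] per[of j] by simp
    qed simp_all
  qed
  then show "V i = V (i mod 2)" "dg i = dg (i mod 2)" by auto
qed

lemma same_parity: "w \<in> V i \<Longrightarrow> w \<in> V j \<Longrightarrow> even i = even j"
  using V_parity(1)[of i] V_parity(1)[of j] disj[of 0] by (auto simp: even_iff_mod_2_eq_zero odd_iff_mod_2_eq_one)

lemma finite_V: "finite (V i)"
  using finite_verts verts_eq[of i] by auto

lemma nb_V: "U \<subseteq> V i \<Longrightarrow> nb G U \<subseteq> V (Suc i)"
  using edge_parity by (auto simp: nb_def)

lemma finite_nb: "finite (nb G U)"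
  using finite_verts by (auto simp: nb_def)

definition children :: "nat \<Rightarrow> nat" where
  "children t = (if t = 0 then dg 0 else dg t - 1)"

context
  fixes v assumes v: "v \<in> V 0"
begin

lemma v_verts: "v \<in> verts G" using v verts_eq[of 0] by auto

lemma finite_burned: "finite (burned G v S t)"
  using burned_subset[OF v_verts] finite_verts finite_subset by blast

lemma level_parity: "level G v t \<subseteq> V t"
proof (induction t)
  case (Suc t)
  show ?case
  proof
    fix w assume w: "w \<in> level G v (Suc t)"
    obtain u where u: "u \<in> level G v t" "{u, w} \<in> edges G" using level_parent(2)[OF w] by blast
    have "u \<in> V t" using Suc.IH u(1) by auto
    then show "w \<in> V (Suc t)" using u(2) by (rule edge_parity)
  qed
qed (simp add: v)

text \<open>Along an edge the distance from v changes by at most one, and parity excludes no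
  change.\<close>

lemma nb_level:
  assumes "u \<in> level G v t" "w \<in> verts G" "{u, w} \<in> edges G"
  shows "w \<in> level G v (Suc t) \<or> (\<exists>s. t = Suc s \<and> w \<in> level G v s)"
proof -
  obtain s where s: "s \<le> Suc t" "w \<in> level G v s" using ball_at_levels[OF nb_level_near[OF assms]] by blast
  have uV: "u \<in> V t" using assms level_parity by auto
  have wu: "{w, u} \<in> edges G" using assms(3) by (simp add: insert_commute)
  have "u \<in> ball_at G v (Suc s)" by (rule nb_level_near[OF s(2) _ wu]) (use uV verts_eq[of t] in auto)
  then have "t \<le> Suc s" using level_not_ball[OF assms(1)] by (meson not_le_imp_less)
  moreover have "w \<in> V (Suc t)" by (rule edge_parity[OF uV assms(3)])
  then have "even s = even (Suc t)" using s(2) level_parity same_parity by blast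
  then have "s \<noteq> t" by auto
  ultimately have "s = Suc t \<or> t = Suc s" using s(1) by auto
  then show ?thesis using s(2) by auto
qed

text \<open>Below the root a vertex loses only its unique parent. Level D is included because the
  parents of u matter here, not those of its children.\<close>

lemma card_children:
  assumes tree: "tree_like G v D" and t: "t \<le> D" and u: "u \<in> level G v t"
  shows "children t \<le> card (nb G {u} \<inter> level G v (Suc t))"
proof -
  have nbu: "nb G {u} = {w \<in> verts G. {u, w} \<in> edges G}" by (auto simp: nb_def)
  have d: "card (nb G {u}) = dg t" using deg[of u t] u level_parity nbu by (auto simp: degree_def)
  show ?thesis
  proof (cases t)
    case 0
    then have "nb G {u} \<subseteq> level G v (Suc t)" using nb_level[OF u] unfolding nbu by blast
    then have "nb G {u} \<inter> level G v (Suc t) = nb G {u}" by blast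
    then show ?thesis using d 0 by (simp only: children_def) simp
  next
    case (Suc s)
    let ?P = "nb G {u} \<inter> level G v s"
    have "nb G {u} \<subseteq> (nb G {u} \<inter> level G v (Suc t)) \<union> ?P" using nb_level[OF u] Suc unfolding nbu by blast
    then have "card (nb G {u}) \<le> card ((nb G {u} \<inter> level G v (Suc t)) \<union> ?P)"
      using finite_nb by (intro card_mono) auto
    also have "\<dots> \<le> card (nb G {u} \<inter> level G v (Suc t)) + card ?P" by (rule card_Un_le)
    finally have 1: "dg t \<le> card (nb G {u} \<inter> level G v (Suc t)) + card ?P" using d by simp
    have "x = y" if "x \<in> ?P" "y \<in> ?P" for x y
    proof -
      have "{x, u} \<in> edges G" "{y, u} \<in> edges G" "x \<in> level G v s" "y \<in> level G v s"
        using that by (auto simp: nb_def insert_commute)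
      then show ?thesis using tree Suc t u unfolding tree_like_def by (meson Suc_le_lessD)
    qed
    then have "card ?P \<le> Suc 0" using finite_nb by (intro card_le_Suc0_iff_eq[THEN iffD2]) auto
    then show ?thesis using 1 Suc by (simp only: children_def) simp
  qed
qed

text \<open>Protecting ahead of the front gains nothing: a protected child of the front leaves the stock of
  vertices protected beyond the front, so the difference bounded here loses at most \<open>k\<close> per step
  before it is multiplied by the number of children.\<close>

lemma tree_phase:
  fixes f :: "nat \<Rightarrow> int"
  assumes st: "strategy k G v S" and tree: "tree_like G v D"
    and f0: "f 0 = int (dg 0)" and fS: "\<And>t. f (Suc t) = int (children (Suc t)) * (f t - int k)"
    and ch: "\<And>t. 1 \<le> children t" and t: "t \<le> D"
  shows "f t \<le> int (children t) * int (card (burned G v S t \<inter> level G v t)) - int (card (prot S t - ball_at G v t))"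
  using t
proof (induction t)
  case 0
  then show ?case by (simp add: f0 children_def)
next
  case (Suc t)
  let ?B = "burned G v S t \<inter> level G v t"
  define Ch where "Ch = nb G ?B \<inter> level G v (Suc t)"
  define U where "U = Ch \<inter> prot S (Suc t)"
  let ?h = "\<lambda>t. card (prot S t - ball_at G v t)"
  have fin: "finite ?B" "finite Ch" "finite U" using finite_burned finite_nb by (auto simp: Ch_def U_def)
  have "children t * card ?B = (\<Sum>u\<in>?B. children t)" by simp
  also have "\<dots> \<le> (\<Sum>u\<in>?B. card (nb G {u} \<inter> level G v (Suc t)))"
    using card_children[OF tree] Suc.prems by (intro sum_mono) auto
  also have "\<dots> = card (\<Union>u\<in>?B. nb G {u} \<inter> level G v (Suc t))"
  proof (rule card_UN_disjoint[symmetric])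
    show "\<forall>u\<in>?B. \<forall>u'\<in>?B. u \<noteq> u' \<longrightarrow> (nb G {u} \<inter> level G v (Suc t)) \<inter> (nb G {u'} \<inter> level G v (Suc t)) = {}"
    proof (intro ballI impI equals0I)
      fix u u' w assume u: "u \<in> ?B" "u' \<in> ?B" "u \<noteq> u'"
        and w: "w \<in> (nb G {u} \<inter> level G v (Suc t)) \<inter> (nb G {u'} \<inter> level G v (Suc t))"
      have "{u, w} \<in> edges G" "{u', w} \<in> edges G" using w by (auto simp: nb_def)
      then show False using tree Suc.prems u w unfolding tree_like_def by (meson IntD2 IntD1 Suc_le_lessD)
    qed
  qed (use fin finite_nb in auto)
  also have "(\<Union>u\<in>?B. nb G {u} \<inter> level G v (Suc t)) = Ch" by (auto simp: Ch_def nb_def)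
  finally have cCh: "children t * card ?B \<le> card Ch" .
  have "Ch - U \<subseteq> burned G v S (Suc t) \<inter> level G v (Suc t)"
    unfolding burned_Suc U_def Ch_def by (auto simp: nb_def)
  then have "card (Ch - U) \<le> card (burned G v S (Suc t) \<inter> level G v (Suc t))"
    by (intro card_mono finite_Int disjI1 finite_burned)
  moreover have "card Ch = card (Ch - U) + card U"
    using fin by (subst card_Un_disjoint[symmetric]) (auto simp: U_def intro: arg_cong[of _ _ card])
  ultimately have b: "card Ch \<le> card (burned G v S (Suc t) \<inter> level G v (Suc t)) + card U" by linarith
  have fp: "finite (prot S t)" "finite (S t)" "card (S t) \<le> k" for t
    using card_prot_le[OF st] st by (auto simp: strategy_def)
  \<comment> \<open>Both sets on the left are protected and lie outside the ball of radius t, so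
    they are paid for by the old stock and the new set S t; being on level t + 1 or beyond it
    separates them.\<close>
  have "U \<union> (prot S (Suc t) - ball_at G v (Suc t)) \<subseteq> (prot S t - ball_at G v t) \<union> S t"
    using burned_mono[of t "Suc t" G v "\<lambda>_. {}"] unfolding U_def Ch_def by (auto simp: less_Suc_eq)
  then have "card (U \<union> (prot S (Suc t) - ball_at G v (Suc t))) \<le> card ((prot S t - ball_at G v t) \<union> S t)"
    using fp by (intro card_mono) auto
  also have "\<dots> \<le> ?h t + card (S t)" by (rule card_Un_le)
  also have "card (U \<union> (prot S (Suc t) - ball_at G v (Suc t))) = card U + ?h (Suc t)"
    using fin fp(1)[of "Suc t"] by (intro card_Un_disjoint) (auto simp: U_def Ch_def)
  finally have h: "card U + ?h (Suc t) \<le> ?h t + k" using fp(3)[of t] by linarith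
  let ?b' = "card (burned G v S (Suc t) \<inter> level G v (Suc t))"
  have IH: "f t \<le> int (children t) * int (card ?B) - int (?h t)" using Suc by simp
  have cCh': "int (children t) * int (card ?B) \<le> int (card Ch)" using cCh by (metis of_nat_le_iff of_nat_mult)
  have "f t - int k \<le> int ?b' - int (?h (Suc t))" using IH cCh' b h by linarith
  then have "int (children (Suc t)) * (f t - int k) \<le> int (children (Suc t)) * (int ?b' - int (?h (Suc t)))"
    by (intro mult_left_mono) auto
  also have "\<dots> \<le> int (children (Suc t)) * int ?b' - int (?h (Suc t))"
  proof -
    have "1 * int (?h (Suc t)) \<le> int (children (Suc t)) * int (?h (Suc t))"
      using ch[of "Suc t"] by (intro mult_right_mono) auto
    then show ?thesis by (simp add: right_diff_distrib)
  qed
  finally show ?case using fS[of t] by simp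
qed

end

end

section \<open>The fire in an expander\<close>

locale expander_fire = parity_graph G V dg for G :: "'a graph" and V dg +
  fixes v k S M \<Delta> s0
  assumes v: "v \<in> V 0" and st: "strategy k G v S"
    and M: "\<And>i. dg i * card (V i) = M" and dg: "\<And>i. 1 \<le> dg i" "\<And>i. dg i \<le> \<Delta>"
    and expand: "\<And>i X. X \<subseteq> V i \<Longrightarrow> s0 \<le> card X \<Longrightarrow> 2 * (dg i * card X) \<le> M \<Longrightarrow>
      201 * (dg i * card X) \<le> 200 * (dg (Suc i) * card (nb G X))"
    and M_large: "2 * (\<Delta> * (s0 + 1)) \<le> M"
begin

abbreviation bt :: "nat \<Rightarrow> 'a set" where "bt \<equiv> burned G v S"

text \<open>Weighted by degree, both sides have the same total M, the number of edges, and half of a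
  side means M / 2 on either. Only the side that the front reaches at time t is counted.\<close>

definition mass :: "nat \<Rightarrow> real" where
  "mass t = real (dg t * card (bt t \<inter> V t))"

definition left :: "nat \<Rightarrow> nat \<Rightarrow> real" where
  "left i t = real (dg i * card (V i - bt t))"

lemma finite_bt: "finite (bt t)" by (rule finite_burned[OF v])

text \<open>A neighbour of a burning set burns one step later unless it is among the at most k * (t
  + 1) vertices protected so far, each of weight at most \<Delta>.\<close>

lemma spread:
  assumes X: "X \<subseteq> bt t \<inter> V i"
  shows "real (dg (Suc i)) * real (card (nb G X)) \<le>
    real (dg (Suc i) * card (bt (Suc t) \<inter> V (Suc i))) + real \<Delta> * (real k * (real t + 1))"
proof -
  have "nb G X \<subseteq> (bt (Suc t) \<inter> V (Suc i)) \<union> prot S (Suc t)"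
    using X nb_V[of X i] nb_mono[of X "bt t" G] unfolding burned_Suc by blast
  then have "card (nb G X) \<le> card ((bt (Suc t) \<inter> V (Suc i)) \<union> prot S (Suc t))"
    using finite_bt card_prot_le(1)[OF st, of "Suc t"] by (intro card_mono finite_UnI finite_Int disjI1)
  also have "\<dots> \<le> card (bt (Suc t) \<inter> V (Suc i)) + k * Suc t"
    using card_prot_le(2)[OF st, of "Suc t"] card_Un_le by (meson add_left_mono order_trans)
  finally have "real (card (nb G X)) \<le> real (card (bt (Suc t) \<inter> V (Suc i))) + real k * (real t + 1)"
    unfolding of_nat_le_iff[where 'a = real, symmetric]
    by (simp add: algebra_simps del: burned.simps)
  then have "real (dg (Suc i)) * real (card (nb G X)) \<le>
    real (dg (Suc i)) * (real (card (bt (Suc t) \<inter> V (Suc i))) + real k * (real t + 1))"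
    by (rule mult_left_mono) simp
  also have "\<dots> = real (dg (Suc i) * card (bt (Suc t) \<inter> V (Suc i))) + real (dg (Suc i)) * (real k * (real t + 1))"
    unfolding distrib_left of_nat_mult ..
  also have "\<dots> \<le> real (dg (Suc i) * card (bt (Suc t) \<inter> V (Suc i))) + real \<Delta> * (real k * (real t + 1))"
    using dg(2)[of "Suc i"] by (intro add_left_mono mult_right_mono) simp_all
  finally show ?thesis .
qed

lemma mass_step_aux:
  assumes X: "X \<subseteq> bt t \<inter> V t" "s0 \<le> card X" "2 * (dg t * card X) \<le> M"
  shows "201 / 200 * real (dg t * card X) - real \<Delta> * (real k * (real t + 1)) \<le> mass (Suc t)"
proof -
  have "201 * (dg t * card X) \<le> 200 * (dg (Suc t) * card (nb G X))" by (rule expand) (use X in auto)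
  then have "201 * real (dg t * card X) \<le> 200 * (real (dg (Suc t)) * real (card (nb G X)))"
    unfolding of_nat_le_iff[where 'a = real, symmetric] by simp
  then show ?thesis using spread[OF X(1)] unfolding mass_def by linarith
qed

lemma mass_step:
  assumes "real \<Delta> * real s0 \<le> mass t" "2 * mass t \<le> real M"
  shows "201 / 200 * mass t - real \<Delta> * (real k * (real t + 1)) \<le> mass (Suc t)"
proof -
  have "\<Delta> * s0 \<le> dg t * card (bt t \<inter> V t)"
    using assms(1) unfolding mass_def of_nat_mult[symmetric] of_nat_le_iff .
  also have "\<dots> \<le> \<Delta> * card (bt t \<inter> V t)" using dg(2) by (rule mult_le_mono1)
  finally have "s0 \<le> card (bt t \<inter> V t)" using dg[of 0] unfolding nat_mult_le_cancel_disj by linarith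
  moreover have "2 * (dg t * card (bt t \<inter> V t)) \<le> M"
    using assms(2) unfolding mass_def by linarith
  ultimately show ?thesis using mass_step_aux[of "bt t \<inter> V t" t] unfolding mass_def by simp
qed

text \<open>The burning set is now too large for the expansion hypothesis, so expansion is applied
  to a subset of the largest size q whose weight is at most M / 2. Rounding loses at most
  \<Delta>.\<close>

lemma mass_stays:
  assumes "real M < 2 * mass t"
  shows "201 / 200 * (real M / 2 - real \<Delta>) - real \<Delta> * (real k * (real t + 1)) \<le> mass (Suc t)"
proof -
  define q where "q = M div (2 * dg t)"
  have d: "1 \<le> dg t" by (rule dg)
  have q1: "2 * (dg t * q) \<le> M" unfolding q_def using times_div_less_eq_dividend[of "2 * dg t" M] by (simp add: ac_simps)
  have "M < 2 * dg t * Suc q" unfolding q_def using d dividend_less_times_div[of "2 * dg t" M] by simp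
  then have q2: "M < 2 * (dg t * q) + 2 * dg t" by (simp add: algebra_simps)
  have M2: "M < 2 * (dg t * card (bt t \<inter> V t))" using assms unfolding mass_def by linarith
  then have "dg t * q < dg t * card (bt t \<inter> V t)" using q1 by linarith
  then have "q \<le> card (bt t \<inter> V t)" by simp
  then obtain X where X: "X \<subseteq> bt t \<inter> V t" "card X = q" by (metis obtain_subset_with_card_n)
  have "s0 \<le> q"
  proof -
    have "2 * (dg t * (s0 + 1)) \<le> 2 * (\<Delta> * (s0 + 1))" using dg(2)[of t] by (intro mult_le_mono2 mult_le_mono1)
    moreover have "2 * (dg t * q) + 2 * dg t = 2 * (dg t * (q + 1))" by (simp add: distrib_left)
    ultimately have "dg t * (s0 + 1) < dg t * (q + 1)" using M_large q2 by linarith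
    then show ?thesis by simp
  qed
  then have next_mass: "201 / 200 * real (dg t * card X) - real \<Delta> * (real k * (real t + 1)) \<le> mass (Suc t)"
    using X q1 by (intro mass_step_aux) auto
  have "real M / 2 - real \<Delta> \<le> real (dg t * card X)"
  proof -
    have "M \<le> 2 * (dg t * card X) + 2 * \<Delta>" using q2 dg(2)[of t] X(2) by simp
    then show ?thesis by linarith
  qed
  then have "201 / 200 * (real M / 2 - real \<Delta>) \<le> 201 / 200 * real (dg t * card X)" by (rule mult_left_mono) simp
  from order_trans[OF diff_right_mono[OF this] next_mass] show ?thesis .
qed

text \<open>Expansion is applied to the set W of unburnt and unprotected vertices. A neighbour of W
  burning at time t would have set W on fire, so all neighbours of W are unburnt at time t, and W is
  smaller than what is unburnt there by the factor 200 / 201. The term with \<open>s0\<close> covers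
  sets W too small to expand.\<close>

lemma left_step:
  assumes "2 * left (Suc i) (Suc t) \<le> real M"
  shows "left (Suc i) (Suc t) \<le> 200 / 201 * left i t + real \<Delta> * (real k * (real t + 1) + real s0)"
proof -
  define W where "W = V (Suc i) - bt (Suc t) - prot S (Suc t)"
  have fW: "finite W" using finite_V by (simp add: W_def)
  have "V (Suc i) - bt (Suc t) \<subseteq> W \<union> prot S (Suc t)" by (auto simp: W_def)
  then have "card (V (Suc i) - bt (Suc t)) \<le> card (W \<union> prot S (Suc t))"
    using fW card_prot_le(1)[OF st, of "Suc t"] by (intro card_mono finite_UnI)
  also have "\<dots> \<le> card W + k * Suc t"
    using card_prot_le(2)[OF st, of "Suc t"] card_Un_le by (meson add_left_mono order_trans)
  finally have "dg (Suc i) * card (V (Suc i) - bt (Suc t)) \<le> dg (Suc i) * (card W + k * Suc t)" by (rule mult_le_mono2)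
  also have "\<dots> \<le> dg (Suc i) * card W + \<Delta> * (k * Suc t)"
    unfolding distrib_left using dg(2)[of "Suc i"] by (intro add_left_mono mult_le_mono1)
  finally have "dg (Suc i) * card (V (Suc i) - bt (Suc t)) \<le> dg (Suc i) * card W + \<Delta> * (k * Suc t)" .
  from of_nat_mono[OF this, where 'a = real]
  have 1: "left (Suc i) (Suc t) \<le> real (dg (Suc i) * card W) + real \<Delta> * (real k * (real t + 1))"
    unfolding left_def by (simp add: algebra_simps del: burned.simps)
  have "real (dg (Suc i) * card W) \<le> 200 / 201 * left i t + real \<Delta> * real s0"
  proof (cases "s0 \<le> card W")
    case True
    have "dg (Suc i) * card W \<le> dg (Suc i) * card (V (Suc i) - bt (Suc t))"
      using finite_V by (intro mult_le_mono2 card_mono) (auto simp: W_def)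
    then have "2 * (dg (Suc i) * card W) \<le> M" using assms unfolding left_def by linarith
    then have "201 * (dg (Suc i) * card W) \<le> 200 * (dg (Suc (Suc i)) * card (nb G W))"
      using True by (intro expand) (auto simp: W_def)
    also have "\<dots> \<le> 200 * (dg i * card (V i - bt t))"
    proof -
      have "nb G W \<subseteq> V (Suc (Suc i))" by (rule nb_V) (auto simp: W_def)
      then have nV: "nb G W \<subseteq> V i" by (simp add: per)
      have "nb G W \<inter> bt t = {}"
      proof (intro equals0I)
        fix u assume u: "u \<in> nb G W \<inter> bt t"
        then obtain w where w: "w \<in> W" "{w, u} \<in> edges G" by (auto simp: nb_def)
        then have "w \<in> nb G (bt t)"
          using u verts_eq[of i] by (auto simp: nb_def W_def insert_commute)
        then have "w \<in> bt (Suc t)" using w(1) unfolding burned_Suc W_def by blast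
        then show False using w(1) by (simp add: W_def)
      qed
      then have "card (nb G W) \<le> card (V i - bt t)" using nV finite_V by (intro card_mono) auto
      then show ?thesis by (simp add: per)
    qed
    finally have "201 * real (dg (Suc i) * card W) \<le> 200 * left i t"
      unfolding left_def of_nat_le_iff[where 'a = real, symmetric] by simp
    moreover have "0 \<le> real \<Delta> * real s0" by simp
    ultimately show ?thesis by linarith
  next
    case False
    then have "dg (Suc i) * card W \<le> \<Delta> * s0" using dg(2)[of "Suc i"] by (intro mult_le_mono) auto
    then have "real (dg (Suc i) * card W) \<le> real \<Delta> * real s0" unfolding of_nat_mult[symmetric] of_nat_le_iff .
    moreover have "0 \<le> left i t" by (simp add: left_def)
    ultimately show ?thesis by linarith
  qed
  then show ?thesis using 1 by (simp add: distrib_left)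
qed

text \<open>The fire grows from time D to D + \<tau>, one step brings the other side past half, and
  \<tau> further steps of decay end at T. The same \<tau> serves twice because 401 / 400 is below
  201 / 200.\<close>

lemma expansion_phase:
  fixes K :: real and D \<tau> :: nat
  assumes D: "400 \<le> D" and K: "400 * real \<Delta> * real k \<le> K" "real \<Delta> * real s0 \<le> K" "1 \<le> K"
    and start: "K * (real D + 1) \<le> mass D"
    and \<tau>: "real M \<le> (401 / 400) ^ \<tau>"
    and T: "T = D + 2 * \<tau> + 1"
    and large: "402 * real \<Delta> + 400 * (real \<Delta> * (real k * (real T + 1))) < real M"
  shows "real (saved G v S) \<le> 2 * (1 + 201 * (real \<Delta> * (real k * (real T + 1) + real s0)))"
proof -
  define y where "y t = (401 / 400) ^ (t - D) * (K * (real D + 1))" for t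
  have Mpos: "0 < real M" using large by (smt (verit) mult_nonneg_nonneg of_nat_0_le_iff)
  \<comment> \<open>The growth must keep ahead of the linearly increasing number of protected
    vertices. Each step adds at least (D + 1) / 400 to the factor of K, which exceeds 1 since D
    \<ge> 400.\<close>
  have y_ge: "K * (real t + 1) \<le> y t" if "D \<le> t" for t
  proof -
    define j where "j = t - D"
    have t: "real t = real D + real j" using that by (simp add: j_def of_nat_diff)
    have "1 + real j * (1 / 400) \<le> (1 + 1 / 400) ^ j" by (rule Bernoulli_inequality) simp
    then have "1 + real j / 400 \<le> (401 / 400) ^ j" by simp
    then have up: "(1 + real j / 400) * (real D + 1) \<le> (401 / 400) ^ j * (real D + 1)" by (rule mult_right_mono) simp
    have "real j * 400 \<le> real j * real D" using D by (intro mult_left_mono) auto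
    then have "real t + 1 \<le> (1 + real j / 400) * (real D + 1)" by (simp add: t algebra_simps)
    from order_trans[OF this up]
    have "K * (real t + 1) \<le> K * ((401 / 400) ^ j * (real D + 1))" using K by (intro mult_left_mono) auto
    then show ?thesis by (simp add: y_def j_def ac_simps)
  qed
  \<comment> \<open>As 400 * \<Delta> * k \<le> K, the loss in a step is at most 1 / 400 of the
    mass, half of the gain 1 / 200.\<close>
  have grow: "real M < 2 * mass t \<or> y t \<le> mass t" if "D \<le> t" "t \<le> T" for t
    using that
  proof (induction t rule: dec_induct)
    case base
    then show ?case using start by (simp add: y_def)
  next
    case (step t)
    have tT: "real t + 1 \<le> real T + 1" using step.prems by simp
    have kt: "real \<Delta> * (real k * (real t + 1)) \<le> real \<Delta> * (real k * (real T + 1))"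
      by (intro mult_left_mono tT) auto
    show ?case
    proof (cases "real M < 2 * mass t")
      case True
      \<comment> \<open>The assumption \<open>large\<close> says exactly that the gain M / 400 above
        half exceeds the rounding loss and the protected vertices.\<close>
      then have "real M < 2 * mass (Suc t)" using mass_stays[OF True] kt large by argo
      then show ?thesis ..
    next
      case False
      then have yt: "y t \<le> mass t" using step by auto
      have Kt: "K * (real t + 1) \<le> mass t" using y_ge[OF step.hyps(1)] yt by linarith
      have "K * 1 \<le> K * (real t + 1)" using K by (intro mult_left_mono) auto
      then have "real \<Delta> * real s0 \<le> mass t" using Kt K by linarith
      then have m: "201 / 200 * mass t - real \<Delta> * (real k * (real t + 1)) \<le> mass (Suc t)"
        using False by (intro mass_step) auto
      have "400 * real \<Delta> * real k * (real t + 1) \<le> K * (real t + 1)" using K by (intro mult_right_mono) auto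
      then have "400 * (real \<Delta> * (real k * (real t + 1))) \<le> mass t" using Kt by (simp only: mult.assoc)
      then have "401 / 400 * mass t \<le> mass (Suc t)" using m by linarith
      moreover have "y (Suc t) = 401 / 400 * y t" using step.hyps by (simp add: y_def Suc_diff_le)
      ultimately show ?thesis using yt by linarith
    qed
  qed
  have half: "real M < 2 * mass t" if "D + \<tau> \<le> t" "t \<le> T" for t
  proof -
    have "(401 / 400) ^ \<tau> \<le> (401 / 400 :: real) ^ (t - D)" using that by (intro power_increasing) auto
    then have "real M \<le> (401 / 400) ^ (t - D)" using \<tau> by linarith
    moreover have "1 * 1 \<le> K * (real D + 1)" using K by (intro mult_mono) auto
    ultimately have "real M * 1 \<le> y t" unfolding y_def using Mpos by (intro mult_mono) auto
    then show ?thesis using grow[of t] that Mpos by auto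
  qed
  have left_half: "2 * left i t \<le> real M" if t: "D + \<tau> + 1 \<le> t" "t \<le> T" for i t
  proof -
    \<comment> \<open>\<open>mass\<close> controls only the side of the parity of its time. One of t
      and t - 1 has the parity of i, which is why the claim starts at D + \<tau> + 1.\<close>
    obtain s where s: "s \<le> t" "D + \<tau> \<le> s" "even i = even s"
    proof (cases "even i = even t")
      case True
      then show ?thesis using that[of t] t by simp
    next
      case False
      then have "even i = even (t - 1)" using t by (cases t) auto
      then show ?thesis using that[of "t - 1"] t by simp
    qed
    have "i mod 2 = s mod 2" using s(3) by (simp add: mod2_eq_if)
    then have Vs: "V i = V s" "dg i = dg s" using V_parity[of i] V_parity[of s] by simp_all
    have "card (bt s \<inter> V s) \<le> card (bt t \<inter> V s)"
      using burned_mono[OF s(1), of G v S] finite_bt by (intro card_mono finite_Int disjI1) auto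
    then have "dg s * card (bt s \<inter> V s) \<le> dg s * card (bt t \<inter> V s)" by (rule mult_le_mono2)
    then have "mass s \<le> real (dg s * card (bt t \<inter> V s))" unfolding mass_def of_nat_le_iff .
    moreover have "card (V s) = card (bt t \<inter> V s) + card (V s - bt t)"
      using card_Int_Diff[OF finite_V, of s "bt t"] by (simp add: Int_commute)
    then have "M = dg s * card (bt t \<inter> V s) + dg s * card (V s - bt t)"
      using M[of s] by (metis distrib_left)
    then have "real M = real (dg s * card (bt t \<inter> V s)) + left i t"
      unfolding left_def Vs by (metis of_nat_add)
    ultimately show ?thesis using half[of s] s t by linarith
  qed
  define E where "E = real \<Delta> * (real k * (real T + 1) + real s0)"
  have E0: "0 \<le> E" by (simp add: E_def)
  \<comment> \<open>201 * E is the fixed point of the map that sends x to 200 / 201 * x + E.\<close>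
  have shrink: "left i (D + \<tau> + 1 + j) \<le> (200 / 201) ^ j * real M + 201 * E" if "j \<le> \<tau>" for i j
    using that
  proof (induction j arbitrary: i)
    case 0
    have "2 * left i (D + \<tau> + 1) \<le> real M" by (rule left_half) (auto simp: T)
    then show ?case using E0 Mpos by simp
  next
    case (Suc j)
    let ?t = "D + \<tau> + 1 + j"
    have "2 * left (Suc (Suc i)) (Suc ?t) \<le> real M" by (rule left_half) (use Suc.prems in \<open>auto simp: T\<close>)
    then have "left (Suc (Suc i)) (Suc ?t) \<le> 200 / 201 * left (Suc i) ?t + real \<Delta> * (real k * (real ?t + 1) + real s0)"
      by (rule left_step)
    also have "\<dots> \<le> 200 / 201 * ((200 / 201) ^ j * real M + 201 * E) + E"
    proof (intro add_mono mult_left_mono)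
      show "left (Suc i) ?t \<le> (200 / 201) ^ j * real M + 201 * E" using Suc by simp
      show "real \<Delta> * (real k * (real ?t + 1) + real s0) \<le> E"
        unfolding E_def using Suc.prems by (intro mult_left_mono add_right_mono) (auto simp: T)
    qed simp
    also have "left (Suc (Suc i)) (Suc ?t) = left i (Suc ?t)" by (simp add: left_def per)
    finally have "left i (Suc ?t) \<le> 200 / 201 * ((200 / 201) ^ j * real M + 201 * E) + E" .
    then show ?case by (simp add: algebra_simps)
  qed
  have fin: "left i T \<le> 1 + 201 * E" for i
  proof -
    have "real M \<le> (201 / 200) ^ \<tau>"
    proof -
      have "(401 / 400 :: real) ^ \<tau> \<le> (201 / 200) ^ \<tau>" by (intro power_mono) auto
      then show ?thesis using \<tau> by linarith
    qed
    then have "(200 / 201) ^ \<tau> * real M \<le> (200 / 201) ^ \<tau> * (201 / 200) ^ \<tau>" by (intro mult_left_mono) auto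
    also have "\<dots> = 1" by (simp add: power_mult_distrib[symmetric])
    finally have small: "(200 / 201) ^ \<tau> * real M \<le> 1" .
    have "T = D + \<tau> + 1 + \<tau>" by (simp add: T)
    then have "left i T \<le> (200 / 201) ^ \<tau> * real M + 201 * E" using shrink[of \<tau> i] by simp
    with small show ?thesis by linarith
  qed
  have card_left: "real (card (V i - bt T)) \<le> left i T" for i
    unfolding left_def of_nat_le_iff using mult_le_mono1[OF dg(1)[of i], of "card (V i - bt T)"] by simp
  have "verts G - (\<Union>t. bt t) \<subseteq> (V 0 - bt T) \<union> (V (Suc 0) - bt T)" using verts_eq[of 0] by auto
  then have "saved G v S \<le> card ((V 0 - bt T) \<union> (V (Suc 0) - bt T))"
    unfolding saved_def using finite_V by (intro card_mono) auto
  also have "\<dots> \<le> card (V 0 - bt T) + card (V (Suc 0) - bt T)" by (rule card_Un_le)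
  finally have "real (saved G v S) \<le> real (card (V 0 - bt T)) + real (card (V (Suc 0) - bt T))"
    unfolding of_nat_add[symmetric] of_nat_le_iff .
  also have "\<dots> \<le> (1 + 201 * E) + (1 + 201 * E)"
    by (intro add_mono order_trans[OF card_left fin])
  finally show ?thesis unfolding E_def by simp
qed

end

section \<open>Short cycles\<close>

text \<open>The bound m + 2 < length keeps the closing edge from being the last edge of the path, so
  a genuine cycle closes at position m.\<close>

definition lollipop :: "'a graph \<Rightarrow> 'a list \<Rightarrow> nat \<Rightarrow> bool" where
  "lollipop G vs m \<longleftrightarrow> distinct vs \<and> set vs \<subseteq> verts G \<and> successively (\<lambda>u w. {u, w} \<in> edges G) vs \<and>
     m + 2 < length vs \<and> {last vs, vs ! m} \<in> edges G"

lemma level_path: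
  "u \<in> level G v t \<Longrightarrow> \<exists>p. p t = u \<and> (\<forall>s\<le>t. p s \<in> level G v s) \<and> (\<forall>s<t. {p s, p (Suc s)} \<in> edges G)"
proof (induction t arbitrary: u)
  case 0
  then show ?case by (intro exI[of _ "\<lambda>_. v"]) simp
next
  case (Suc t)
  obtain u' where u': "u' \<in> level G v t" "{u', u} \<in> edges G" using level_parent(2)[OF Suc.prems] by blast
  obtain p where p: "p t = u'" "\<forall>s\<le>t. p s \<in> level G v s" "\<forall>s<t. {p s, p (Suc s)} \<in> edges G"
    using Suc.IH[OF u'(1)] by blast
  show ?case
    by (rule exI[of _ "p(Suc t := u)"]) (use p u' Suc.prems in \<open>auto simp: le_Suc_eq less_Suc_eq simp del: level.simps\<close>)
qed

lemma level_verts: "v \<in> verts G \<Longrightarrow> level G v t \<subseteq> verts G"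
  using level_subset_ball burned_subset by (metis subset_trans)

text \<open>Two shortest paths to a vertex with two parents, glued at their last common vertex, form a path
  that ends in a cycle. It has as many edges as vertices.\<close>

lemma not_tree_like_lollipop:
  assumes v: "v \<in> verts G" and not: "\<not> tree_like G v D"
  shows "\<exists>vs m. lollipop G vs m \<and> hd vs = v \<and> length vs \<le> 2 * D"
proof -
  obtain t w u u' where t: "t < D" and w: "w \<in> level G v (Suc t)" and u: "u \<in> level G v t" "u' \<in> level G v t"
    and e: "{u, w} \<in> edges G" "{u', w} \<in> edges G" and ne: "u \<noteq> u'"
    using not unfolding tree_like_def by blast
  obtain p where p: "p t = u" "\<And>s. s \<le> t \<Longrightarrow> p s \<in> level G v s" "\<And>s. s < t \<Longrightarrow> {p s, p (Suc s)} \<in> edges G"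
    using level_path[OF u(1)] by blast
  obtain q where q: "q t = u'" "\<And>s. s \<le> t \<Longrightarrow> q s \<in> level G v s" "\<And>s. s < t \<Longrightarrow> {q s, q (Suc s)} \<in> edges G"
    using level_path[OF u(2)] by blast
  \<comment> \<open>Levels are disjoint, so the two paths can meet only at equal indices; after the
    last such index l they stay apart.\<close>
  define I where "I = {s. s \<le> t \<and> p s = q s}"
  define l where "l = Max I"
  have "0 \<in> I" using p(2)[of 0] q(2)[of 0] by (simp add: I_def)
  moreover have fI: "finite I" by (rule finite_subset[of _ "{..t}"]) (auto simp: I_def)
  ultimately have "l \<in> I" unfolding l_def by (intro Max_in) auto
  then have l: "l \<le> t" "p l = q l" by (auto simp: I_def)
  have lmax: "p s \<noteq> q s" if "l < s" "s \<le> t" for s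
  proof
    assume "p s = q s"
    then have "s \<in> I" using that by (simp add: I_def)
    then have "s \<le> l" unfolding l_def by (rule Max_ge[OF fI])
    then show False using that by simp
  qed
  have lt: "l < t" using l p(1) q(1) ne by (cases "l = t") auto
  have lev: "r = s" if "p r = q s" "r \<le> t" "s \<le> t" for r s
    using that p(2)[of r] q(2)[of s] level_unique[of "p r" G v r s] by auto
  have levp: "r = s" if "p r = p s" "r \<le> t" "s \<le> t" for r s
    using that p(2)[of r] p(2)[of s] level_unique[of "p r" G v r s] by auto
  have levq: "r = s" if "q r = q s" "r \<le> t" "s \<le> t" for r s
    using that q(2)[of r] q(2)[of s] level_unique[of "q r" G v r s] by auto
  have levw: "w \<noteq> p s" "w \<noteq> q s" if "s \<le> t" for s
    using that p(2)[of s] q(2)[of s] level_unique[OF w, of s] by auto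
  \<comment> \<open>The list follows p from v to u, continues to w and returns along q down to level
    l + 1; the closing edge leads to p l, at position l. Its length is 2 * t + 2 - l, at most 2 *
    D.\<close>
  define ps qs where "ps = map p [0..<Suc t]" and "qs = rev (map q [Suc l..<Suc t])"
  define vs where "vs = ps @ w # qs"
  have set_ps: "set ps = p ` {..t}" and set_qs: "set qs = q ` {l<..t}"
  proof -
    have "{0..<Suc t} = {..t}" "{Suc l..<Suc t} = {l<..t}" by auto
    then show "set ps = p ` {..t}" "set qs = q ` {l<..t}"
      unfolding ps_def qs_def by (simp_all only: set_map set_rev set_upt)
  qed
  have ps: "ps \<noteq> []" "hd ps = p 0" "last ps = u" "length ps = Suc t"
    using p(1) by (auto simp: ps_def hd_map hd_upt last_map simp del: upt_Suc)
  have qs: "qs \<noteq> []" "hd qs = u'" "last qs = q (Suc l)" "length qs = t - l"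
    using lt q(1) by (auto simp: qs_def hd_rev last_rev last_map hd_map simp del: upt_Suc)
  have "distinct vs"
  proof -
    have "inj_on p {..t}" using levp by (auto simp: inj_on_def)
    then have "distinct ps"
      unfolding ps_def distinct_map by (auto simp: atLeast0LessThan lessThan_Suc_atMost simp del: upt_Suc)
    moreover have "inj_on q {Suc l..<Suc t}" using levq by (auto simp: inj_on_def)
    then have "distinct qs" unfolding qs_def by (simp add: distinct_map del: upt_Suc)
    moreover have "set ps \<inter> set qs = {}" unfolding set_ps set_qs
    proof (intro equals0I)
      fix x assume "x \<in> p ` {..t} \<inter> q ` {l<..t}"
      then obtain r s where rs: "r \<le> t" "x = p r" "l < s" "s \<le> t" "x = q s" by auto
      then show False using lev[of r s] lmax[of s] by auto
    qed
    moreover have "w \<notin> set ps" unfolding set_ps using levw(1) by (metis atMost_iff imageE)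
    moreover have "w \<notin> set qs" unfolding set_qs using levw(2) by (metis greaterThanAtMost_iff imageE)
    ultimately show ?thesis by (auto simp: vs_def)
  qed
  moreover have "set vs \<subseteq> verts G"
  proof -
    have "p s \<in> verts G" "q s \<in> verts G" if "s \<le> t" for s
      using level_verts[OF v] p(2)[OF that] q(2)[OF that] by blast+
    moreover have "w \<in> verts G" using level_verts[OF v] w by blast
    ultimately show ?thesis unfolding vs_def set_append list.set set_ps set_qs by auto
  qed
  moreover have "successively (\<lambda>u w. {u, w} \<in> edges G) vs"
  proof -
    have "successively (\<lambda>u w. {u, w} \<in> edges G) ps"
      unfolding successively_conv_nth ps_def using p(3) by (auto simp del: upt_Suc)
    moreover have "successively (\<lambda>u w. {u, w} \<in> edges G) qs"
      unfolding qs_def successively_rev unfolding successively_conv_nth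
      using q(3) by (auto simp: insert_commute simp del: upt_Suc)
    ultimately show ?thesis using ps qs e
      by (auto simp: vs_def successively_append_iff successively_Cons insert_commute)
  qed
  moreover have "l + 2 < length vs" using lt ps qs by (simp add: vs_def)
  moreover have "{last vs, vs ! l} \<in> edges G"
  proof -
    have "vs ! l = p l" using l(1) ps(4) by (simp add: vs_def nth_append ps_def del: upt_Suc)
    moreover have "last vs = q (Suc l)" using qs by (simp add: vs_def)
    ultimately show ?thesis using q(3)[OF lt] l(2) by (simp add: insert_commute)
  qed
  moreover have "hd vs = v" using ps p(2)[of 0] by (simp add: vs_def)
  moreover have "length vs \<le> 2 * D" using t ps qs by (simp add: vs_def)
  ultimately show ?thesis unfolding lollipop_def by blast
qed

section \<open>Expected number of origins near a short cycle\<close>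

definition graph_of :: "'v set \<Rightarrow> 'v set \<Rightarrow> ('v \<times> 'v) set \<Rightarrow> 'v graph" where
  "graph_of A B R = (A \<union> B, (\<lambda>(x, y). {x, y}) ` R)"

text \<open>Defined from the list alone, without R, so that one can sum over lists first and then
  count the relations containing the prescribed edges. The last index has m as its
  successor.\<close>

definition lollipop_edges :: "'v set \<Rightarrow> 'v set \<Rightarrow> 'v list \<Rightarrow> nat \<Rightarrow> ('v \<times> 'v) set" where
  "lollipop_edges A B vs m = {(x, y) \<in> A \<times> B. \<exists>r<length vs. {x, y} = {vs ! r, vs ! (if Suc r < length vs then Suc r else m)}}"

text \<open>Every index gives the edge to its successor. Two different indices with the same edge
  would be successors of each other, which m + 2 < length excludes.\<close>

lemma lollipop_edges:
  assumes AB: "A \<inter> B = {}" and R: "R \<subseteq> A \<times> B" and lol: "lollipop (graph_of A B R) vs m"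
  shows "lollipop_edges A B vs m \<subseteq> R" "card (lollipop_edges A B vs m) = length vs"
proof -
  define nx where "nx r = (if Suc r < length vs then Suc r else m)" for r
  have d: "distinct vs" and m: "m + 2 < length vs" using lol by (auto simp: lollipop_def)
  have in_edges: "{x, y} \<in> edges (graph_of A B R) \<longleftrightarrow> (x, y) \<in> R \<or> (y, x) \<in> R" for x y
    by (auto simp: graph_of_def doubleton_eq_iff image_iff)
  have edge: "{vs ! r, vs ! nx r} \<in> edges (graph_of A B R)" if "r < length vs" for r
  proof (cases "Suc r < length vs")
    case True
    then show ?thesis using lol by (auto simp: lollipop_def nx_def successively_conv_nth)
  next
    case False
    then have "r = length vs - 1" using that by simp
    moreover have "vs \<noteq> []" using that by auto
    ultimately have "vs ! r = last vs" by (simp add: last_conv_nth)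
    then show ?thesis using lol False by (simp add: lollipop_def nx_def)
  qed
  define f where "f r = (if (vs ! r, vs ! nx r) \<in> R then (vs ! r, vs ! nx r) else (vs ! nx r, vs ! r))" for r
  have fR: "f r \<in> R" if "r < length vs" for r
    using edge[OF that] unfolding in_edges f_def by auto
  have fset: "{fst (f r), snd (f r)} = {vs ! r, vs ! nx r}" for r
    by (auto simp: f_def)
  have eq: "lollipop_edges A B vs m = f ` {..<length vs}"
  proof (intro equalityI subsetI)
    fix z assume "z \<in> lollipop_edges A B vs m"
    then obtain x y r where z: "z = (x, y)" "x \<in> A" "y \<in> B" "r < length vs" "{x, y} = {vs ! r, vs ! nx r}"
      by (auto simp: lollipop_edges_def nx_def)
    obtain x' y' where f: "f r = (x', y')" by (cases "f r")
    have "x' \<in> A" "y' \<in> B" using fR[OF z(4)] f R by auto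
    moreover have "{x', y'} = {x, y}" using fset[of r] z(5) by (simp add: f)
    ultimately have "x' = x" "y' = y" using z AB by (auto simp: doubleton_eq_iff)
    then show "z \<in> f ` {..<length vs}" using z f by force
  next
    fix z assume "z \<in> f ` {..<length vs}"
    then obtain r where r: "r < length vs" "z = f r" by auto
    obtain x y where f: "f r = (x, y)" by (cases "f r")
    have "{x, y} = {vs ! r, vs ! nx r}" using fset[of r] by (simp add: f)
    moreover have "(x, y) \<in> A \<times> B" using fR[OF r(1)] R f by auto
    ultimately show "z \<in> lollipop_edges A B vs m" using r f by (auto simp: lollipop_edges_def nx_def)
  qed
  then show "lollipop_edges A B vs m \<subseteq> R" using fR by auto
  have "inj_on f {..<length vs}"
  proof (rule inj_onI)
    fix r s assume rs: "r \<in> {..<length vs}" "s \<in> {..<length vs}" and "f r = f s"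
    then have "{vs ! r, vs ! nx r} = {vs ! s, vs ! nx s}" using fset[of r] fset[of s] by simp
    moreover have "nx r < length vs" "nx s < length vs" using m rs by (auto simp: nx_def)
    ultimately have "(r = s \<and> nx r = nx s) \<or> (r = nx s \<and> nx r = s)"
      using rs nth_eq_iff_index_eq[OF d] by (auto simp: doubleton_eq_iff)
    then show "r = s" using m rs by (auto simp: nx_def split: if_splits)
  qed
  then show "card (lollipop_edges A B vs m) = length vs" unfolding eq by (simp add: card_image)
qed

text \<open>There are ((a + b) * n) ^ N lists of N vertices, and N prescribed edges cost (2 / n) ^
  N. The powers of n cancel, so the bound depends on D and the degrees only; the factor N counts the
  positions m.\<close>

lemma (in bireg) sum_not_tree_like_le:
  assumes AB: "A \<inter> B = {}" and n: "n > 0" "a > 0" "b > 0" "2 * (2 * D + 2 * (a * b)) \<le> a * b * n"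
  shows "(\<Sum>R\<in>birel A B a b. real (card {v \<in> A \<union> B. \<not> tree_like (graph_of A B R) v D}))
    \<le> (\<Sum>N\<le>2 * D. real N * (2 * real (a + b)) ^ N) * real (card (birel A B a b))"
proof -
  let ?X = "birel A B a b"
  define LL where "LL N = {vs. set vs \<subseteq> A \<union> B \<and> length vs = N}" for N
  define F where "F = lollipop_edges A B"
  define L where "L N m R = {vs \<in> LL N. card (F vs m) = N \<and> F vs m \<subseteq> R}" for N m R
  have fAB: "finite (A \<union> B)" using fin by simp
  have fLL: "finite (LL N)" for N unfolding LL_def by (rule finite_lists_length_eq[OF fAB])
  have cAB: "card (A \<union> B) = (a + b) * n" using fin AB by (simp add: card_Un_disjoint cards algebra_simps)
  have cLL: "card (LL N) = ((a + b) * n) ^ N" for N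
    unfolding LL_def using card_lists_length_eq[OF fAB] cAB by simp
  have bad: "real (card {v \<in> A \<union> B. \<not> tree_like (graph_of A B R) v D}) \<le> (\<Sum>N\<le>2 * D. \<Sum>m<N. real (card (L N m R)))"
    if R: "R \<in> ?X" for R
  proof -
    have "{v \<in> A \<union> B. \<not> tree_like (graph_of A B R) v D} \<subseteq> (\<Union>N\<in>{..2 * D}. \<Union>m\<in>{..<N}. hd ` L N m R)"
    proof
      fix v assume "v \<in> {v \<in> A \<union> B. \<not> tree_like (graph_of A B R) v D}"
      then have v: "v \<in> verts (graph_of A B R)" "\<not> tree_like (graph_of A B R) v D" by (auto simp: graph_of_def)
      obtain vs m where vs: "lollipop (graph_of A B R) vs m" "hd vs = v" "length vs \<le> 2 * D"
        using not_tree_like_lollipop[OF v] by blast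
      have "vs \<in> L (length vs) m R"
        using lollipop_edges[OF AB birelD(1)[OF R] vs(1)] vs(1) by (auto simp: L_def LL_def F_def lollipop_def graph_of_def)
      moreover have "m < length vs" using vs(1) by (simp add: lollipop_def)
      ultimately show "v \<in> (\<Union>N\<in>{..2 * D}. \<Union>m\<in>{..<N}. hd ` L N m R)" using vs(2,3) by blast
    qed
    then have "card {v \<in> A \<union> B. \<not> tree_like (graph_of A B R) v D} \<le> card (\<Union>N\<in>{..2 * D}. \<Union>m\<in>{..<N}. hd ` L N m R)"
      using fLL by (intro card_mono) (auto simp: L_def)
    also have "\<dots> \<le> (\<Sum>N\<le>2 * D. card (\<Union>m\<in>{..<N}. hd ` L N m R))" by (rule card_UN_le) simp
    also have "\<dots> \<le> (\<Sum>N\<le>2 * D. \<Sum>m<N. card (hd ` L N m R))" by (intro sum_mono card_UN_le) simp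
    also have "\<dots> \<le> (\<Sum>N\<le>2 * D. \<Sum>m<N. card (L N m R))"
      using fLL by (intro sum_mono card_image_le) (simp add: L_def)
    finally show ?thesis unfolding of_nat_sum[symmetric] of_nat_le_iff .
  qed
  have one: "(\<Sum>R\<in>?X. real (card (L N m R))) \<le> (2 * real (a + b)) ^ N * real (card ?X)" if N: "N \<le> 2 * D" for N m
  proof -
    let ?LN = "{vs \<in> LL N. card (F vs m) = N}"
    have fLN: "finite ?LN" using fLL by simp
    have "L N m R = {vs \<in> ?LN. F vs m \<subseteq> R}" for R by (auto simp: L_def)
    then have "(\<Sum>R\<in>?X. card (L N m R)) = (\<Sum>R\<in>?X. \<Sum>vs\<in>?LN. if F vs m \<subseteq> R then 1 else 0)"
      using fLN by (simp add: sum.If_cases Int_def)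
    also have "\<dots> = (\<Sum>vs\<in>?LN. \<Sum>R\<in>?X. if F vs m \<subseteq> R then 1 else 0)" by (rule sum.swap)
    also have "\<dots> = (\<Sum>vs\<in>?LN. card {R \<in> ?X. F vs m \<subseteq> R})"
      using fin_birel by (simp add: sum.If_cases Int_def)
    finally have "(\<Sum>R\<in>?X. real (card (L N m R))) = (\<Sum>vs\<in>?LN. real (card {R \<in> ?X. F vs m \<subseteq> R}))"
      unfolding of_nat_sum[symmetric] by (rule arg_cong)
    also have "\<dots> \<le> (\<Sum>vs\<in>?LN. (2 / real n) ^ N * real (card ?X))"
    proof (rule sum_mono)
      fix vs assume vs: "vs \<in> ?LN"
      have sub: "F vs m \<subseteq> A \<times> B" by (auto simp: F_def lollipop_edges_def)
      then have "finite (F vs m)" using fin finite_subset by blast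
      then have "real (card {R \<in> ?X. F vs m \<subseteq> R}) \<le> (2 / real n) ^ card (F vs m) * real (card ?X)"
        using vs sub n N by (intro card_superset_le) auto
      then show "real (card {R \<in> ?X. F vs m \<subseteq> R}) \<le> (2 / real n) ^ N * real (card ?X)" using vs by simp
    qed
    also have "\<dots> = real (card ?LN) * ((2 / real n) ^ N * real (card ?X))" by simp
    also have "\<dots> \<le> real (((a + b) * n) ^ N) * ((2 / real n) ^ N * real (card ?X))"
      unfolding cLL[symmetric] using fLL by (intro mult_right_mono of_nat_mono card_mono) auto
    also have "\<dots> = (real ((a + b) * n) * (2 / real n)) ^ N * real (card ?X)"
      by (subst power_mult_distrib) (simp only: of_nat_power mult.assoc)
    also have "real ((a + b) * n) * (2 / real n) = 2 * real (a + b)" using n(1) by simp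
    finally show ?thesis .
  qed
  have "(\<Sum>R\<in>?X. real (card {v \<in> A \<union> B. \<not> tree_like (graph_of A B R) v D}))
    \<le> (\<Sum>R\<in>?X. \<Sum>N\<le>2 * D. \<Sum>m<N. real (card (L N m R)))" by (intro sum_mono bad)
  also have "\<dots> = (\<Sum>N\<le>2 * D. \<Sum>R\<in>?X. \<Sum>m<N. real (card (L N m R)))" by (rule sum.swap)
  also have "\<dots> = (\<Sum>N\<le>2 * D. \<Sum>m<N. \<Sum>R\<in>?X. real (card (L N m R)))" by (intro sum.cong refl sum.swap)
  also have "\<dots> \<le> (\<Sum>N\<le>2 * D. \<Sum>m<N. (2 * real (a + b)) ^ N * real (card ?X))" by (intro sum_mono one) auto
  also have "\<dots> = (\<Sum>N\<le>2 * D. real N * (2 * real (a + b)) ^ N) * real (card ?X)"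
    by (simp add: sum_distrib_right mult.assoc)
  finally show ?thesis .
qed

section \<open>Bounds on the number of saved vertices\<close>

lemma burned_subset_ball: "burned G v S t \<subseteq> ball_at G v t"
proof (induction t)
  case (Suc t)
  then show ?case unfolding burned_Suc[of G v S] ball_at_Suc using nb_mono[OF Suc, of G] by blast
qed simp

lemma card_ball_le:
  assumes fin: "finite (verts G)" and v: "v \<in> verts G" and deg: "\<And>u. u \<in> verts G \<Longrightarrow> degree G u \<le> \<Delta>"
  shows "card (ball_at G v t) \<le> (\<Delta> + 1) ^ t"
proof (induction t)
  case (Suc t)
  let ?U = "ball_at G v t"
  have U: "?U \<subseteq> verts G" by (rule burned_subset[OF v])
  then have fU: "finite ?U" using fin finite_subset by blast
  have "nb G ?U = (\<Union>u\<in>?U. {w \<in> verts G. {u, w} \<in> edges G})" by (auto simp: nb_def)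
  then have "card (nb G ?U) \<le> (\<Sum>u\<in>?U. card {w \<in> verts G. {u, w} \<in> edges G})"
    by (simp only:) (rule card_UN_le[OF fU])
  also have "\<dots> \<le> (\<Sum>u\<in>?U. \<Delta>)" using deg U by (intro sum_mono) (auto simp: degree_def)
  finally have "card (nb G ?U) \<le> \<Delta> * card ?U" by (simp add: mult.commute)
  then have "card (ball_at G v (Suc t)) \<le> card ?U + \<Delta> * card ?U"
    unfolding ball_at_Suc using card_Un_le[of ?U "nb G ?U"] by linarith
  also have "\<dots> = (\<Delta> + 1) * card ?U" by simp
  also have "\<dots> \<le> (\<Delta> + 1) * (\<Delta> + 1) ^ t" by (intro mult_le_mono2 Suc)
  finally show ?case by simp
qed simp

lemma saved_le_sn:
  assumes "finite (verts G)" "strategy k G v S"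
  shows "saved G v S \<le> sn k G v"
  unfolding sn_def using sn_well_defined(1)[OF assms(1)] assms(2) by (intro Max_ge) auto

lemma sn_le:
  assumes "finite (verts G)" "\<And>S. strategy k G v S \<Longrightarrow> real (saved G v S) \<le> x"
  shows "real (sn k G v) \<le> x"
proof -
  have "sn k G v \<in> {saved G v S | S. strategy k G v S}"
    unfolding sn_def by (intro Max_in sn_well_defined[OF assms(1)])
  then show ?thesis using assms(2) by auto
qed

lemma sn_ge:
  assumes fin: "finite (verts G)" and v: "v \<in> verts G" and deg: "\<And>u. u \<in> verts G \<Longrightarrow> degree G u \<le> \<Delta>"
    and k: "1 \<le> k" and m: "(\<Delta> + 1) ^ m + m \<le> card (verts G)"
  shows "m \<le> sn k G v"
proof -
  have U: "ball_at G v m \<subseteq> verts G" by (rule burned_subset[OF v])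
  then have "card (verts G - ball_at G v m) = card (verts G) - card (ball_at G v m)"
    using fin finite_subset by (intro card_Diff_subset) auto
  then have "m \<le> card (verts G - ball_at G v m)" using card_ball_le[OF fin v deg, of m] m by simp
  then obtain P where P: "P \<subseteq> verts G - ball_at G v m" "card P = m" "finite P"
    by (rule obtain_subset_with_card_n)
  obtain h where h: "bij_betw h {0..<m} P" using ex_bij_betw_nat_finite[OF P(3)] P(2) by auto
  define S where "S t = (if t < m then {h t} else {})" for t
  have hP: "h t \<in> P" if "t < m" for t using h that by (auto simp: bij_betw_def)
  have near: "burned G v S t \<subseteq> ball_at G v m" if "t \<le> m" for t
    using burned_subset_ball[of G v S t] burned_mono[OF that, of G v "\<lambda>_. {}"] by blast
  have "strategy k G v S"
    unfolding strategy_def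
  proof (intro allI conjI)
    fix t
    show "S t \<subseteq> verts G - burned G v S t"
    proof (cases "t < m")
      case True
      have "h t \<in> verts G - ball_at G v m" using hP[OF True] P(1) by blast
      then show ?thesis using near[OF less_imp_le[OF True]] True by (auto simp: S_def)
    qed (simp add: S_def)
    show "finite (S t)" "card (S t) \<le> k" using k by (auto simp: S_def)
  qed
  moreover have "m \<le> saved G v S"
  proof -
    have "burned G v S t \<inter> P = {}" for t
    proof (induction t)
      case 0
      then show ?case using near[of 0] P(1) by auto
    next
      case (Suc t)
      show ?case
      proof (cases "Suc t \<le> m")
        case True
        then show ?thesis using near[of "Suc t"] P(1) by blast
      next
        case False
        have "P \<subseteq> prot S (Suc t)"
        proof
          fix x assume "x \<in> P"
          then obtain s where s: "s < m" "x = h s" using h by (auto simp: bij_betw_def)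
          then have "x \<in> S s" by (simp add: S_def)
          then show "x \<in> prot S (Suc t)" using s False by auto
        qed
        then show ?thesis unfolding burned_Suc using Suc by blast
      qed
    qed
    then have "P \<subseteq> verts G - (\<Union>t. burned G v S t)" using P(1) by blast
    then have "card P \<le> saved G v S" unfolding saved_def using fin by (intro card_mono) auto
    then show ?thesis using P(2) by simp
  qed
  ultimately show ?thesis using saved_le_sn[OF fin] by (meson order_trans)
qed

text \<open>The recursion starts with little room: with root degree k + 1 only 1 is left after
  subtracting k. Four steps, computed for both kinds of origin, bring it to at least 3 * k. From x
  \<ge> 3 * k on, two children already give 2 * (x - k) \<ge> 4 / 3 * x.\<close>

lemma (in parity_graph) tree_phase_growth:
  assumes v: "v \<in> V 0" and st: "strategy k G v S" and tree: "tree_like G v D" and D: "4 \<le> D"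
    and k: "2 \<le> k" and d: "dg 0 = k + 1 \<and> dg (Suc 0) = k + 3 \<or> dg 0 = k + 3 \<and> dg (Suc 0) = k + 1"
  shows "3 * real k * (4 / 3) ^ (D - 4) \<le> real (dg D * card (burned G v S D \<inter> V D))"
proof -
  define c where "c = children"
  define f where "f = rec_nat (int (dg 0)) (\<lambda>t x. int (c (Suc t)) * (x - int k))"
  have f0: "f 0 = int (dg 0)" and fS: "f (Suc t) = int (c (Suc t)) * (f t - int k)" for t
    by (simp_all add: f_def)
  have cS: "c (Suc (Suc (Suc t))) = c (Suc t)" for t by (simp add: c_def children_def per)
  have c12: "dg 0 = k + 1 \<and> c (Suc 0) = k + 2 \<and> c (Suc (Suc 0)) = k \<or>
    dg 0 = k + 3 \<and> c (Suc 0) = k \<and> c (Suc (Suc 0)) = k + 2"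
    using d by (auto simp: c_def children_def per)
  have ck: "2 \<le> c (Suc t)" for t
  proof (induction t rule: less_induct)
    case (less t)
    consider "t = 0" | "t = 1" | s where "t = Suc (Suc s)" by (metis One_nat_def not0_implies_Suc)
    then show ?case using less[of "t - 2"] c12 k by cases (auto simp: cS)
  qed
  have c1: "1 \<le> c t" for t using ck[of "t - 1"] d by (cases t) (auto simp: c_def children_def)
  have f4: "3 * int k \<le> f 4"
  proof -
    have k2: "2 \<le> int k" using k by simp
    have kk: "4 \<le> int k * int k" using mult_mono[OF k2 k2] by simp
    have e: "f 4 = int (c (Suc (Suc 0))) * (int (c (Suc 0)) * (int (c (Suc (Suc 0))) * (int (c (Suc 0)) * (int (dg 0) - int k) - int k) - int k) - int k)"
      by (simp add: eval_nat_numeral fS f0 cS)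
    from c12 show ?thesis
    proof
      assume A: "dg 0 = k + 1 \<and> c (Suc 0) = k + 2 \<and> c (Suc (Suc 0)) = k"
      then have "f 4 = int k * (int k * int k + int k)" unfolding e by (simp add: algebra_simps)
      moreover have "int k * 3 \<le> int k * (int k * int k + int k)" using kk k2 by (intro mult_left_mono) linarith+
      ultimately show ?thesis by linarith
    next
      assume A: "dg 0 = k + 3 \<and> c (Suc 0) = k \<and> c (Suc (Suc 0)) = k + 2"
      define x where "x = int k * (2 * (int k * int k) + 3 * int k - 1)"
      have "f 4 = (int k + 2) * x" using A unfolding e x_def by (simp add: algebra_simps)
      moreover have x: "int k * 3 \<le> x" unfolding x_def using kk k2 by (intro mult_left_mono) linarith+
      then have "1 * x \<le> (int k + 2) * x" by (intro mult_right_mono) linarith+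
      ultimately show ?thesis using x by linarith
    qed
  qed
  have "3 * real k * (4 / 3) ^ j \<le> real_of_int (f (4 + j))" for j
  proof (induction j)
    case 0
    have "real_of_int (3 * int k) \<le> real_of_int (f 4)" using f4 by (simp only: of_int_le_iff)
    then show ?case by simp
  next
    case (Suc j)
    have "1 \<le> (4 / 3 :: real) ^ j" by (rule one_le_power) simp
    then have "3 * real k * 1 \<le> 3 * real k * (4 / 3) ^ j" by (intro mult_left_mono) auto
    then have f3: "3 * real k \<le> real_of_int (f (4 + j))" using Suc by linarith
    have "2 * (real_of_int (f (4 + j)) - real k) \<le> real (c (Suc (4 + j))) * (real_of_int (f (4 + j)) - real k)"
      using ck[of "4 + j"] f3 by (intro mult_right_mono) auto
    also have "\<dots> = real_of_int (f (4 + Suc j))" using fS[of "4 + j"] by simp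
    finally have "4 / 3 * real_of_int (f (4 + j)) \<le> real_of_int (f (4 + Suc j))" using f3 by argo
    then show ?case using Suc by simp
  qed
  from this[of "D - 4"] have "3 * real k * (4 / 3) ^ (D - 4) \<le> real_of_int (f D)" using D by simp
  also have "f D \<le> int (c D) * int (card (burned G v S D \<inter> level G v D)) - int (card (prot S D - ball_at G v D))"
    unfolding c_def by (rule tree_phase[OF v st tree, where f = f, OF f0]) (use fS c1 in \<open>auto simp: c_def\<close>)
  then have "f D \<le> int (c D * card (burned G v S D \<inter> level G v D))" by simp
  also have "c D * card (burned G v S D \<inter> level G v D) \<le> dg D * card (burned G v S D \<inter> V D)"
    using level_parity[OF v, of D] finite_burned[OF v, of S D]
    by (intro mult_le_mono card_mono) (auto simp: c_def children_def)
  finally show ?thesis by simp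
qed

section \<open>The fire in the graph of a relation\<close>

lemma graph_of_converse: "graph_of B A (R\<inverse>) = graph_of A B R"
proof -
  have "(\<lambda>(x, y). {x, y}) ` (R\<inverse>) = (\<lambda>(x, y). {x, y}) ` R" by (auto simp: image_iff insert_commute)
  then show ?thesis by (auto simp: graph_of_def)
qed

lemma edges_graph_of: "{x, y} \<in> edges (graph_of A B R) \<longleftrightarrow> (x, y) \<in> R \<or> (y, x) \<in> R"
  by (auto simp: graph_of_def doubleton_eq_iff image_iff)

context bireg
begin

lemma parity_graph_of:
  assumes AB: "A \<inter> B = {}" and R: "R \<in> birel A B a b"
  shows "parity_graph (graph_of A B R) (\<lambda>i. if even i then A else B) (\<lambda>i. if even i then a else b)"
proof
  have R': "R \<subseteq> A \<times> B" by (rule birelD(1)[OF R])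
  have v: "verts (graph_of A B R) = A \<union> B" by (simp add: graph_of_def)
  show "finite (verts (graph_of A B R))" using fin v by simp
  show "degree (graph_of A B R) u = (if even i then a else b)" if "u \<in> (if even i then A else B)" for u and i :: nat
  proof (cases "even i")
    case True
    then have "{w \<in> verts (graph_of A B R). {u, w} \<in> edges (graph_of A B R)} = R `` {u}"
      using that R' AB unfolding edges_graph_of v by auto
    then show ?thesis using True that birelD(2)[OF R] by (simp add: degree_def)
  next
    case False
    then have "{w \<in> verts (graph_of A B R). {u, w} \<in> edges (graph_of A B R)} = R\<inverse> `` {u}"
      using that R' AB unfolding edges_graph_of v by auto
    then show ?thesis using False that birelD(3)[OF R] by (simp add: degree_def)
  qed
  show "w \<in> (if even (Suc i) then A else B)"
    if "u \<in> (if even i then A else B)" "{u, w} \<in> edges (graph_of A B R)" for u w and i :: nat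
    using that AB by (auto simp: edges_graph_of split: if_splits dest!: subsetD[OF R'])
qed (use AB in \<open>auto simp: graph_of_def\<close>)

text \<open>Only origins in A are treated. Both orders of the degrees are allowed, so that origins
  in B are covered by the converse relation.\<close>

lemma sn_graph_of_le:
  fixes K :: real
  assumes AB: "A \<inter> B = {}" and R: "R \<in> birel A B a b"
    and ex: "expanding R A a b n s0" "expanding (R\<inverse>) B b a n s0"
    and k: "2 \<le> k" and ab: "a = k + 1 \<and> b = k + 3 \<or> a = k + 3 \<and> b = k + 1"
    and v: "v \<in> A" and tree: "tree_like (graph_of A B R) v D"
    and D: "400 \<le> D" and K: "400 * real (k + 3) * real k \<le> K" "real (k + 3) * real s0 \<le> K" "1 \<le> K"
    and DK: "K * (real D + 1) \<le> 3 * real k * (4 / 3) ^ (D - 4)"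
    and M: "2 * ((k + 3) * (s0 + 1)) \<le> a * b * n" and \<tau>: "real (a * b * n) \<le> (401 / 400) ^ \<tau>"
    and T: "T = D + 2 * \<tau> + 1"
    and large: "402 * real (k + 3) + 400 * (real (k + 3) * (real k * (real T + 1))) < real (a * b * n)"
  shows "real (sn k (graph_of A B R) v) \<le> 2 * (1 + 201 * (real (k + 3) * (real k * (real T + 1) + real s0)))"
proof (rule sn_le)
  interpret parity_graph "graph_of A B R" "\<lambda>i. if even i then A else B" "\<lambda>i. if even i then a else b"
    by (rule parity_graph_of[OF AB R])
  show "finite (verts (graph_of A B R))" by (rule finite_verts)
  fix S assume st: "strategy k (graph_of A B R) v S"
  have R': "R \<subseteq> A \<times> B" by (rule birelD(1)[OF R])
  have nbA: "nb (graph_of A B R) X = R `` X" if "X \<subseteq> A" for X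
    using that R' AB by (auto simp: nb_def edges_graph_of) (auto simp: graph_of_def)
  have nbB: "nb (graph_of A B R) X = R\<inverse> `` X" if "X \<subseteq> B" for X
    using that R' AB by (auto simp: nb_def edges_graph_of) (auto simp: graph_of_def)
  interpret expander_fire "graph_of A B R" "\<lambda>i. if even i then A else B" "\<lambda>i. if even i then a else b"
    v k S "a * b * n" "k + 3" s0
  proof
    show "v \<in> (if even (0::nat) then A else B)" using v by simp
    show "strategy k (graph_of A B R) v S" by (rule st)
    show "(if even i then a else b) * card (if even i then A else B) = a * b * n" for i :: nat
      by (simp add: cards)
    show "1 \<le> (if even i then a else b)" "(if even i then a else b) \<le> k + 3" for i :: nat using ab by auto
    show "2 * ((k + 3) * (s0 + 1)) \<le> a * b * n" by (rule M)
    show "201 * ((if even i then a else b) * card X) \<le> 200 * ((if even (Suc i) then a else b) * card (nb (graph_of A B R) X))"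
      if "X \<subseteq> (if even i then A else B)" "s0 \<le> card X" "2 * ((if even i then a else b) * card X) \<le> a * b * n"
      for i :: nat and X
    proof (cases "even i")
      case True
      then show ?thesis using that ex(1) nbA[of X] unfolding expanding_def by auto
    next
      case False
      then show ?thesis using that ex(2) nbB[of X] unfolding expanding_def by (auto simp: mult.commute[of b a])
    qed
  qed
  have "3 * real k * (4 / 3) ^ (D - 4) \<le> mass D"
    unfolding mass_def by (rule tree_phase_growth[OF _ st tree _ k]) (use v D ab in auto)
  then have "K * (real D + 1) \<le> mass D" using DK by linarith
  then show "real (saved (graph_of A B R) v S) \<le> 2 * (1 + 201 * (real (k + 3) * (real k * (real T + 1) + real s0)))"
    by (intro expansion_phase[OF D _ _ _ _ \<tau> T]) (use K large in auto)
qed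

end

section \<open>Depth of the tree phase and time horizon\<close>

lemma exists_depth:
  fixes K :: real
  assumes K: "1 \<le> K" and k: "2 \<le> k"
  shows "\<exists>D\<ge>400. K * (real D + 1) \<le> 3 * real k * (4 / 3) ^ (D - 4)"
proof -
  \<comment> \<open>With D = j + 4 the claim reads K * (j + 5) * (3 / 4) ^ j \<le> 3 * k, and 3 * k
    is at least 6.\<close>
  have "(\<lambda>j. real j * (3 / 4) ^ j + 5 * (3 / 4) ^ j) \<longlonglongrightarrow> 0 + 5 * (0 :: real)"
    by (intro tendsto_add tendsto_mult_left powser_times_n_limit_0 LIMSEQ_realpow_zero) auto
  then have "\<forall>\<^sub>F j in sequentially. real j * (3 / 4) ^ j + 5 * (3 / 4) ^ j < 6 / K"
    using K by (intro order_tendstoD) auto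
  then obtain N where N: "\<And>j. N \<le> j \<Longrightarrow> real j * (3 / 4) ^ j + 5 * (3 / 4) ^ j < 6 / K"
    by (auto simp: eventually_sequentially)
  define j where "j = N + 400"
  have "(real j + 5) * (3 / 4) ^ j < 6 / K" using N[of j] by (simp add: j_def algebra_simps)
  then have "K * (real j + 5) * (3 / 4) ^ j \<le> 6" using K by (simp add: field_simps)
  then have "K * (real j + 5) * (3 / 4) ^ j * (4 / 3) ^ j \<le> 6 * (4 / 3) ^ j" by (rule mult_right_mono) simp
  moreover have "(3 / 4) ^ j * (4 / 3) ^ j = (1 :: real)" by (simp add: power_mult_distrib[symmetric])
  ultimately have "K * (real j + 5) \<le> 6 * (4 / 3) ^ j" by (simp add: mult.assoc)
  also have "\<dots> \<le> 3 * real k * (4 / 3) ^ j" using k by (intro mult_right_mono) auto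
  finally show ?thesis by (intro exI[of _ "j + 4"]) (auto simp: j_def ac_simps)
qed

lemma eventually_affine_ln_less:
  fixes p q :: real
  shows "\<forall>\<^sub>F n in sequentially. p + q * ln (real n) < real n"
proof -
  have "(\<lambda>n. p * inverse (real n) + q * (ln (real n) / real n)) \<longlonglongrightarrow> p * 0 + q * 0"
    by (intro tendsto_add tendsto_mult_left lim_inverse_n lim_ln_over_n)
  then have "\<forall>\<^sub>F n in sequentially. p * inverse (real n) + q * (ln (real n) / real n) < 1"
    by (rule order_tendstoD) simp
  then show ?thesis using eventually_gt_at_top[of 0]
    by eventually_elim (simp add: field_simps)
qed

lemma eventually_le_ln: "\<forall>\<^sub>F n in sequentially. p \<le> ln (real n)"
  using filterlim_compose[OF ln_at_top filterlim_real_sequentially] by (simp add: filterlim_at_top)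

text \<open>The growth phase needs \<tau> of order ln (c * n), so T and all losses are affine in ln
  n: they are eventually below n, and the final bound is of order ln n.\<close>

lemma exists_time_horizon:
  fixes c k D s0 :: nat
  assumes c: "1 \<le> c"
  shows "\<exists>C>0. \<forall>\<^sub>F n in sequentially. \<exists>\<tau>. real (c * n) \<le> (401 / 400) ^ \<tau> \<and>
    402 * real (k + 3) + 400 * (real (k + 3) * (real k * (real (D + 2 * \<tau> + 1) + 1))) < real (c * n) \<and>
    2 * ((k + 3) * (s0 + 1)) \<le> c * n \<and>
    2 * (1 + 201 * (real (k + 3) * (real k * (real (D + 2 * \<tau> + 1) + 1) + real s0))) \<le> C * ln (real n)"
proof -
  define \<beta> where "\<beta> = ln (401 / 400 :: real)"
  have \<beta>: "0 < \<beta>" by (simp add: \<beta>_def)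
  \<comment> \<open>\<alpha> + \<gamma> * ln n bounds T + 1 = D + 2 + 2 * \<tau>; rounding \<tau> up
    costs the other 2 in D + 4.\<close>
  define \<alpha> where "\<alpha> = real D + 4 + 2 * ln (real c) / \<beta>"
  define \<gamma> where "\<gamma> = 2 / \<beta>"
  define h where "h = real (k + 3) * real k"
  have h0: "0 \<le> h" by (simp add: h_def)
  \<comment> \<open>The summand 1 absorbs all terms independent of n once ln n exceeds them.\<close>
  define C where "C = 402 * h * \<gamma> + 1"
  have C: "0 < C" using h0 \<beta> by (auto simp: C_def \<gamma>_def intro!: add_nonneg_pos)
  have "\<forall>\<^sub>F n in sequentially. \<exists>\<tau>. real (c * n) \<le> (401 / 400) ^ \<tau> \<and>
    402 * real (k + 3) + 400 * (real (k + 3) * (real k * (real (D + 2 * \<tau> + 1) + 1))) < real (c * n) \<and>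
    2 * ((k + 3) * (s0 + 1)) \<le> c * n \<and>
    2 * (1 + 201 * (real (k + 3) * (real k * (real (D + 2 * \<tau> + 1) + 1) + real s0))) \<le> C * ln (real n)"
    using eventually_affine_ln_less[of "402 * real (k + 3) + 400 * h * \<alpha>" "400 * h * \<gamma>"]
      eventually_ge_at_top[of "2 * ((k + 3) * (s0 + 1))"]
      eventually_le_ln[of "2 + 402 * h * \<alpha> + 402 * (real (k + 3) * real s0)"]
  proof eventually_elim
    case (elim n)
    define L where "L = ln (real n)"
    define \<tau> where "\<tau> = nat \<lceil>ln (real (c * n)) / \<beta>\<rceil>"
    have n: "1 \<le> n" using elim(2) by simp
    have ncn: "n \<le> c * n" using c by simp
    then have cn: "1 \<le> real (c * n)" using n by linarith
    have lncn: "ln (real (c * n)) = ln (real c) + L" using c n by (simp add: ln_mult L_def)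
    have ln0: "0 \<le> ln (real (c * n)) / \<beta>" using cn \<beta> by (intro divide_nonneg_pos ln_ge_zero) auto
    have t1: "ln (real (c * n)) / \<beta> \<le> real \<tau>" unfolding \<tau>_def by linarith
    have t2: "real \<tau> \<le> ln (real (c * n)) / \<beta> + 1" unfolding \<tau>_def using ln0 by linarith
    have "ln (real (c * n)) \<le> real \<tau> * \<beta>" using t1 \<beta> by (simp add: field_simps)
    then have "ln (real (c * n)) \<le> ln ((401 / 400) ^ \<tau>)" by (simp add: \<beta>_def ln_realpow)
    then have 1: "real (c * n) \<le> (401 / 400) ^ \<tau>" using cn by (subst (asm) ln_le_cancel_iff) auto
    define t where "t = real (D + 2 * \<tau> + 1) + 1"
    have "t \<le> \<alpha> + \<gamma> * L"
    proof -
      have "t = real D + 2 + 2 * real \<tau>" by (simp add: t_def)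
      moreover have "2 * (ln (real (c * n)) / \<beta>) = 2 * ln (real c) / \<beta> + \<gamma> * L"
        unfolding lncn \<gamma>_def by (simp add: add_divide_distrib)
      ultimately show ?thesis using t2 unfolding \<alpha>_def by linarith
    qed
    then have ht: "h * t \<le> h * \<alpha> + h * \<gamma> * L" using h0 mult_left_mono[of t "\<alpha> + \<gamma> * L" h] by (simp add: algebra_simps)
    have e1: "402 * real (k + 3) + 400 * h * \<alpha> + 400 * h * \<gamma> * L < real n" using elim(1) unfolding L_def .
    have hk: "real (k + 3) * (real k * t) = h * t" by (simp add: h_def)
    have "400 * (h * t) \<le> 400 * h * \<alpha> + 400 * h * \<gamma> * L" using ht by (simp add: algebra_simps)
    moreover have "real n \<le> real (c * n)" using ncn by (rule of_nat_mono)
    ultimately have 2: "402 * real (k + 3) + 400 * (real (k + 3) * (real k * t)) < real (c * n)"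
      unfolding hk using e1 by argo
    have 3: "2 * ((k + 3) * (s0 + 1)) \<le> c * n" using elim(2) ncn by (rule order_trans)
    have "2 * (1 + 201 * (real (k + 3) * (real k * t + real s0))) = 2 + 402 * (h * t) + 402 * (real (k + 3) * real s0)"
      unfolding h_def by (simp add: algebra_simps)
    also have "\<dots> \<le> 2 + 402 * (h * \<alpha> + h * \<gamma> * L) + 402 * (real (k + 3) * real s0)" using ht by simp
    also have "\<dots> = (2 + 402 * h * \<alpha> + 402 * (real (k + 3) * real s0)) + 402 * h * \<gamma> * L" by (simp add: algebra_simps)
    also have "\<dots> \<le> L + 402 * h * \<gamma> * L" using elim(3) unfolding L_def by (intro add_right_mono)
    also have "\<dots> = C * L" by (simp add: C_def algebra_simps)
    finally have 4: "2 * (1 + 201 * (real (k + 3) * (real k * t + real s0))) \<le> C * L" .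
    show ?case using 1 2 3 4 unfolding t_def L_def by blast
  qed
  then show ?thesis using C by blast
qed

section \<open>Averaging over the origins\<close>

lemma expanding_mono: "expanding R A a b n s \<Longrightarrow> s \<le> s' \<Longrightarrow> expanding R A a b n s'"
  by (auto simp: expanding_def)

lemma sn_le_card: "finite (verts G) \<Longrightarrow> real (sn k G v) \<le> real (card (verts G))"
  by (rule sn_le) (auto simp: saved_def intro!: card_mono)

context bireg
begin

text \<open>A bad origin is charged all N vertices. At most ln n such origins add N * ln n to the
  sum, no more in order than the good ones.\<close>

lemma rho_le:
  fixes C :: real
  assumes AB: "A \<inter> B = {}" and n: "1 \<le> n" and ab: "1 \<le> a" and C: "0 \<le> C"
    and good: "\<And>v. v \<in> A \<union> B \<Longrightarrow> tree_like (graph_of A B R) v D \<Longrightarrow> real (sn k (graph_of A B R) v) \<le> C * ln (real n)"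
    and bad: "real (card {v \<in> A \<union> B. \<not> tree_like (graph_of A B R) v D}) \<le> ln (real n)"
  shows "\<rho> k (graph_of A B R) \<le> (C + 1) * (ln (real n) / real n)"
proof -
  let ?G = "graph_of A B R"
  let ?bad = "{v \<in> A \<union> B. \<not> tree_like ?G v D}"
  have v: "verts ?G = A \<union> B" by (simp add: graph_of_def)
  have fV: "finite (A \<union> B)" using fin by simp
  define N where "N = real (card (A \<union> B))"
  have "card A + card B = card (A \<union> B)" using fin AB by (simp add: card_Un_disjoint)
  moreover have "n \<le> card B" using ab by (simp add: cards)
  ultimately have nN: "real n \<le> N" unfolding N_def by linarith
  have N0: "0 < N" using nN n by linarith
  have L0: "0 \<le> ln (real n)" using n by simp
  have "(\<Sum>v\<in>A \<union> B. real (sn k ?G v)) \<le> (\<Sum>v\<in>A \<union> B. C * ln (real n) + (if v \<in> ?bad then N else 0))"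
  proof (rule sum_mono)
    fix u assume u: "u \<in> A \<union> B"
    show "real (sn k ?G u) \<le> C * ln (real n) + (if u \<in> ?bad then N else 0)"
    proof (cases "u \<in> ?bad")
      case True
      have "real (sn k ?G u) \<le> N" using sn_le_card[of ?G k u] fV unfolding v N_def by simp
      moreover have "0 \<le> C * ln (real n)" using C L0 by simp
      ultimately have "real (sn k ?G u) \<le> C * ln (real n) + N" by linarith
      then show ?thesis using True by simp
    next
      case False
      then show ?thesis using good[OF u] u by auto
    qed
  qed
  also have "\<dots> = N * (C * ln (real n)) + real (card ?bad) * N"
  proof -
    have "(A \<union> B) \<inter> {v. v \<in> ?bad} = ?bad" by auto
    then show ?thesis using fV by (simp add: sum.distrib sum.If_cases N_def del: mem_Collect_eq)
  qed
  also have "\<dots> \<le> N * (C * ln (real n)) + ln (real n) * N"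
    using N0 bad by (intro add_left_mono mult_right_mono) auto
  also have "\<dots> = ((C + 1) * ln (real n)) * N" by (simp add: algebra_simps)
  finally have sum: "(\<Sum>v\<in>A \<union> B. real (sn k ?G v)) \<le> ((C + 1) * ln (real n)) * N" .
  have "\<rho> k ?G = (\<Sum>v\<in>A \<union> B. real (sn k ?G v)) / N\<^sup>2" by (simp add: \<rho>_def v N_def)
  also have "\<dots> \<le> (((C + 1) * ln (real n)) * N) / N\<^sup>2" by (intro divide_right_mono sum) simp
  also have "\<dots> = ((C + 1) * ln (real n)) / N" using N0 by (simp add: power2_eq_square)
  also have "\<dots> \<le> ((C + 1) * ln (real n)) / real n"
    using nN n C L0 by (intro divide_left_mono mult_nonneg_nonneg mult_pos_pos) auto
  finally show ?thesis by simp
qed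

lemma rho_ge:
  assumes AB: "A \<inter> B = {}" and R: "R \<in> birel A B a b" and n: "1 \<le> n" and k: "1 \<le> k"
    and ab: "a = k + 1" "b = k + 3" and L: "2 * ln (real (k + 4)) \<le> ln (real n)"
  shows "1 / (2 * ln (real (k + 4)) * real (2 * k + 4)) * (ln (real n) / real n) \<le> \<rho> k (graph_of A B R)"
proof -
  let ?G = "graph_of A B R"
  interpret parity_graph ?G "\<lambda>i. if even i then A else B" "\<lambda>i. if even i then a else b"
    by (rule parity_graph_of[OF AB R])
  have v: "verts ?G = A \<union> B" by (simp add: graph_of_def)
  have N: "card (A \<union> B) = (2 * k + 4) * n" using fin AB ab by (simp add: card_Un_disjoint cards algebra_simps)
  define l where "l = ln (real (k + 4))"
  have l: "0 < l" by (simp add: l_def)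
  \<comment> \<open>This makes (k + 4) ^ m \<le> n. Degrees are at most k + 3, so a ball of radius m
    has at most n vertices and m others remain outside.\<close>
  define m where "m = nat \<lfloor>ln (real n) / l\<rfloor>"
  have q0: "0 \<le> ln (real n) / l" using n l by simp
  have m1: "real m \<le> ln (real n) / l" and m2: "ln (real n) / l - 1 \<le> real m" unfolding m_def using q0 by linarith+
  have "real m * l \<le> ln (real n)" using m1 l by (simp add: field_simps)
  then have "ln (real (k + 4) ^ m) \<le> ln (real n)" unfolding l_def by (subst ln_realpow) auto
  then have "real (k + 4) ^ m \<le> real n" using n by (subst (asm) ln_le_cancel_iff) auto
  then have p: "(k + 4) ^ m \<le> n" unfolding of_nat_power[symmetric] of_nat_le_iff .
  have "m < (k + 4) ^ m" by (rule power_gt_expt) simp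
  then have "(k + 3 + 1) ^ m + m \<le> 2 * n" using p by (simp add: add.commute)
  also have "\<dots> \<le> (2 * k + 4) * n" by (intro mult_le_mono1) simp
  finally have pm: "(k + 3 + 1) ^ m + m \<le> card (verts ?G)" using N v by simp
  have "degree ?G u \<le> k + 3" if "u \<in> verts ?G" for u
    using that deg[of u 0] deg[of u 1] ab by (auto simp: v)
  then have sn: "m \<le> sn k ?G u" if "u \<in> verts ?G" for u
    using sn_ge[OF finite_verts that _ k pm] by blast
  have "ln (real n) / l / 2 \<le> real m"
  proof -
    \<comment> \<open>A quotient of at least 2 loses at most half of itself when rounded
      down.\<close>
    have "2 \<le> ln (real n) / l" using L l by (simp add: l_def field_simps)
    then show ?thesis using m2 by argo
  qed
  then have "real (card (A \<union> B)) * (ln (real n) / l / 2) \<le> real (card (A \<union> B)) * real m" by (rule mult_left_mono) simp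
  also have "\<dots> = (\<Sum>u\<in>verts ?G. real m)" by (simp add: v)
  also have "\<dots> \<le> (\<Sum>u\<in>verts ?G. real (sn k ?G u))" using sn by (intro sum_mono) simp
  finally have s: "real (card (A \<union> B)) * (ln (real n) / l / 2) \<le> (\<Sum>u\<in>verts ?G. real (sn k ?G u))" .
  have "1 / (2 * l * real (2 * k + 4)) * (ln (real n) / real n)
    = real (card (A \<union> B)) * (ln (real n) / l / 2) / (real (card (A \<union> B)))\<^sup>2"
    unfolding N using n by (simp add: power2_eq_square)
  also have "\<dots> \<le> \<rho> k ?G" unfolding \<rho>_def v by (intro divide_right_mono s[unfolded v]) simp
  finally show ?thesis by (simp add: l_def)
qed

lemma markov_not_tree_like:
  assumes AB: "A \<inter> B = {}" and n: "n > 0" "a > 0" "b > 0" "2 * (2 * D + 2 * (a * b)) \<le> a * b * n"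
  shows "x * real (card {R \<in> birel A B a b. x < real (card {v \<in> A \<union> B. \<not> tree_like (graph_of A B R) v D})})
    \<le> (\<Sum>N\<le>2 * D. real N * (2 * real (a + b)) ^ N) * real (card (birel A B a b))"
proof -
  let ?f = "\<lambda>R. real (card {v \<in> A \<union> B. \<not> tree_like (graph_of A B R) v D})"
  let ?Z = "{R \<in> birel A B a b. x < ?f R}"
  have "x * real (card ?Z) = (\<Sum>R\<in>?Z. x)" by (simp add: mult.commute)
  also have "\<dots> \<le> (\<Sum>R\<in>?Z. ?f R)" by (intro sum_mono) auto
  also have "\<dots> \<le> (\<Sum>R\<in>birel A B a b. ?f R)" using fin_birel by (intro sum_mono2) auto
  also have "\<dots> \<le> (\<Sum>N\<le>2 * D. real N * (2 * real (a + b)) ^ N) * real (card (birel A B a b))"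
    by (rule sum_not_tree_like_le[OF AB n])
  finally show ?thesis .
qed

lemma inj_on_graph_of:
  assumes AB: "A \<inter> B = {}"
  shows "inj_on (graph_of A B) (birel A B a b)"
proof (rule inj_onI)
  fix R R' assume R: "R \<in> birel A B a b" "R' \<in> birel A B a b" and eq: "graph_of A B R = graph_of A B R'"
  have *: "(x, y) \<in> R \<longleftrightarrow> x \<in> A \<and> y \<in> B \<and> {x, y} \<in> edges (graph_of A B R)" if "R \<in> birel A B a b" for R x y
    using birelD(1)[OF that] AB unfolding edges_graph_of by auto
  show "R = R'" using *[OF R(1)] *[OF R(2)] eq by (intro set_eqI) (auto simp del: split_paired_All)
qed

end

section \<open>Labelled biregular graphs as relations\<close>

lemma bireg_parts: "bireg (partX n b) (partY n a) a b n"
  by standard (auto simp: partX_def partY_def card_image)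

lemma parts_disjoint: "partX n b \<inter> partY n a = {}"
  by (auto simp: partX_def partY_def)

lemma biregular_graphs_eq:
  "biregular_graphs n a b = graph_of (partX n b) (partY n a) ` birel (partX n b) (partY n a) a b"
proof (intro equalityI subsetI)
  let ?A = "partX n b" and ?B = "partY n a"
  fix G assume G: "G \<in> biregular_graphs n a b"
  then have sg: "simple_graph G" and v: "verts G = ?A \<union> ?B"
    and bip: "\<And>e. e \<in> edges G \<Longrightarrow> \<exists>x\<in>?A. \<exists>y\<in>?B. e = {x, y}"
    and dX: "\<And>x. x \<in> ?A \<Longrightarrow> degree G x = a" and dY: "\<And>y. y \<in> ?B \<Longrightarrow> degree G y = b"
    by (auto simp: biregular_graphs_def)
  define R where "R = {(x, y) \<in> ?A \<times> ?B. {x, y} \<in> edges G}"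
  have R1: "R `` {x} = {w \<in> verts G. {x, w} \<in> edges G}" if "x \<in> ?A" for x
    using that bip parts_disjoint[of n b a] by (fastforce simp: R_def v doubleton_eq_iff)
  have R2: "R\<inverse> `` {y} = {w \<in> verts G. {y, w} \<in> edges G}" if "y \<in> ?B" for y
    using that bip parts_disjoint[of n b a] by (fastforce simp: R_def v doubleton_eq_iff insert_commute)
  have "R \<in> birel ?A ?B a b"
    unfolding birel_def using R1 R2 dX dY by (auto simp: R_def degree_def)
  moreover have "edges G = (\<lambda>(x, y). {x, y}) ` R"
    using bip by (fastforce simp: R_def)
  then have "G = graph_of ?A ?B R" using v by (simp add: graph_of_def prod_eq_iff)
  ultimately show "G \<in> graph_of ?A ?B ` birel ?A ?B a b" by blast
next
  let ?A = "partX n b" and ?B = "partY n a"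
  fix G assume "G \<in> graph_of ?A ?B ` birel ?A ?B a b"
  then obtain R where R: "R \<in> birel ?A ?B a b" and G: "G = graph_of ?A ?B R" by blast
  have v: "verts G = ?A \<union> ?B" and e: "edges G = (\<lambda>(x, y). {x, y}) ` R" by (simp_all add: G graph_of_def)
  have AB: "?A \<inter> ?B = {}" by (rule parts_disjoint)
  interpret parity_graph G "\<lambda>i. if even i then ?A else ?B" "\<lambda>i. if even i then a else b"
    unfolding G by (rule bireg.parity_graph_of[OF bireg_parts AB R])
  have bip: "\<exists>x\<in>?A. \<exists>y\<in>?B. d = {x, y}" if "d \<in> edges G" for d
    using that birelD(1)[OF R] unfolding e by fastforce
  moreover have "d \<subseteq> verts G \<and> card d = 2" if d: "d \<in> edges G" for d
  proof -
    obtain x y where xy: "x \<in> ?A" "y \<in> ?B" "d = {x, y}" using bip[OF d] by blast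
    then have "x \<noteq> y" using AB by auto
    then show ?thesis using xy by (simp add: v)
  qed
  ultimately show "G \<in> biregular_graphs n a b"
    unfolding biregular_graphs_def simple_graph_def using finite_verts v deg[of _ 0] deg[of _ 1] by auto
qed

section \<open>The random graph\<close>

text \<open>\<open>graph_of\<close> is injective on the relations between disjoint parts, with the
  biregular graphs as image, so the uniform distribution can be computed by counting
  relations.\<close>

lemma prob_biregular_graphs:
  assumes n: "1 \<le> n"
  shows "measure_pmf.prob (pmf_of_set (biregular_graphs n a b)) {G. P G}
    = 1 - real (card {R \<in> birel (partX n b) (partY n a) a b. \<not> P (graph_of (partX n b) (partY n a) R)})
        / real (card (birel (partX n b) (partY n a) a b))"
    and "0 < card (birel (partX n b) (partY n a) a b)"
proof -
  let ?X = "birel (partX n b) (partY n a) a b" and ?g = "graph_of (partX n b) (partY n a)"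
  let ?\<G> = "biregular_graphs n a b"
  have inj: "inj_on ?g ?X" by (rule bireg.inj_on_graph_of[OF bireg_parts parts_disjoint])
  have fX: "finite ?X" by (rule bireg.fin_birel[OF bireg_parts])
  have c: "card ?\<G> = card ?X" unfolding biregular_graphs_eq by (rule card_image[OF inj])
  have ne: "?\<G> \<noteq> {}" by (rule biregular_graphs_nonempty[OF n])
  show X0: "0 < card ?X" unfolding c[symmetric] using ne finite_biregular_graphs by (simp add: card_gt_0_iff)
  have "?\<G> \<inter> {G. P G} = ?g ` {R \<in> ?X. P (?g R)}" unfolding biregular_graphs_eq by auto
  then have "card (?\<G> \<inter> {G. P G}) = card {R \<in> ?X. P (?g R)}"
    using card_image[OF inj_on_subset[OF inj, of "{R \<in> ?X. P (?g R)}"]] by simp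
  moreover have "card ?X = card {R \<in> ?X. P (?g R)} + card {R \<in> ?X. \<not> P (?g R)}"
    using card_Un_disjoint[of "{R \<in> ?X. P (?g R)}" "{R \<in> ?X. \<not> P (?g R)}"] fX
    by (simp add: Collect_disj_eq[symmetric] conj_disj_distribL[symmetric] disjoint_iff)
  ultimately have "real (card (?\<G> \<inter> {G. P G})) = real (card ?X) - real (card {R \<in> ?X. \<not> P (?g R)})" by simp
  then show "measure_pmf.prob (pmf_of_set ?\<G>) {G. P G} = 1 - real (card {R \<in> ?X. \<not> P (?g R)}) / real (card ?X)"
    unfolding measure_pmf_of_set[OF ne finite_biregular_graphs] c using X0 by (simp add: field_simps)
qed

text \<open>The order of choices matters: \<open>s0\<close> comes from expansion, \<open>K0\<close>
  from \<open>s0\<close>, the depth D from \<open>K0\<close>, and then C and K from D, all before n.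
  Each of the two expansion events fails with probability at most 1 / n; Markov's inequality with
  threshold ln n contributes K / ln n.\<close>

lemma rho_bounds_aas:
  assumes k: "2 \<le> k"
  shows "\<exists>c>0. \<exists>C>0. \<exists>K. \<forall>\<^sub>F n in sequentially.
    1 - (2 / real n + K / ln (real n)) \<le> measure_pmf.prob (pmf_of_set (biregular_graphs n (k + 1) (k + 3)))
      {G. c * (ln (real n) / real n) \<le> \<rho> k G \<and> \<rho> k G \<le> C * (ln (real n) / real n)}"
proof -
  define a b where "a = k + 1" and "b = k + 3"
  have ab: "a \<ge> 3" "b \<ge> 3" using k by (auto simp: a_def b_def)
  obtain s1 n1 where e1: "\<And>n A B. n1 \<le> n \<Longrightarrow> bireg A (B :: (nat + nat) set) a b n \<Longrightarrow>
    real n * real (card {R \<in> birel A B a b. \<not> expanding R A a b n s1}) \<le> real (card (birel A B a b))"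
    using card_not_expanding_small[OF ab, where 'v = "nat + nat"] by blast
  obtain s2 n2 where e2: "\<And>n A B. n2 \<le> n \<Longrightarrow> bireg A (B :: (nat + nat) set) b a n \<Longrightarrow>
    real n * real (card {R \<in> birel A B b a. \<not> expanding R A b a n s2}) \<le> real (card (birel A B b a))"
    using card_not_expanding_small[OF ab(2,1), where 'v = "nat + nat"] by blast
  define s0 where "s0 = max s1 s2"
  define K0 where "K0 = 400 * real (k + 3) * real k + real (k + 3) * real s0 + 1"
  have K0: "400 * real (k + 3) * real k \<le> K0" "real (k + 3) * real s0 \<le> K0" "1 \<le> K0" by (simp_all add: K0_def)
  obtain D where D: "400 \<le> D" "K0 * (real D + 1) \<le> 3 * real k * (4 / 3) ^ (D - 4)"
    using exists_depth[OF K0(3) k] by blast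
  have "1 \<le> a * b" using ab by simp
  then obtain C where C: "C > 0" and ev: "\<forall>\<^sub>F n in sequentially. \<exists>\<tau>. real (a * b * n) \<le> (401 / 400) ^ \<tau> \<and>
    402 * real (k + 3) + 400 * (real (k + 3) * (real k * (real (D + 2 * \<tau> + 1) + 1))) < real (a * b * n) \<and>
    2 * ((k + 3) * (s0 + 1)) \<le> a * b * n \<and>
    2 * (1 + 201 * (real (k + 3) * (real k * (real (D + 2 * \<tau> + 1) + 1) + real s0))) \<le> C * ln (real n)"
    using exists_time_horizon[of "a * b" k D s0] by blast
  define c where "c = 1 / (2 * ln (real (k + 4)) * real (2 * k + 4))"
  have c0: "0 < c" by (auto simp: c_def intro!: mult_pos_pos)
  define K where "K = (\<Sum>N\<le>2 * D. real N * (2 * real (a + b)) ^ N)"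
  have "\<forall>\<^sub>F n in sequentially. 1 - (2 / real n + K / ln (real n)) \<le>
    measure_pmf.prob (pmf_of_set (biregular_graphs n a b))
      {G. c * (ln (real n) / real n) \<le> \<rho> k G \<and> \<rho> k G \<le> (C + 1) * (ln (real n) / real n)}"
    using ev eventually_ge_at_top[of "n1 + n2 + 1"] eventually_ge_at_top[of "2 * (2 * D + 2 * (a * b))"]
      eventually_le_ln[of 1] eventually_le_ln[of "2 * ln (real (k + 4))"]
  proof eventually_elim
    case (elim n)
    obtain \<tau> where \<tau>: "real (a * b * n) \<le> (401 / 400) ^ \<tau>"
      and large: "402 * real (k + 3) + 400 * (real (k + 3) * (real k * (real (D + 2 * \<tau> + 1) + 1))) < real (a * b * n)"
      and M: "2 * ((k + 3) * (s0 + 1)) \<le> a * b * n"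
      and bound: "2 * (1 + 201 * (real (k + 3) * (real k * (real (D + 2 * \<tau> + 1) + 1) + real s0))) \<le> C * ln (real n)"
      using elim(1) by blast
    let ?A = "partX n b" and ?B = "partY n a"
    let ?X = "birel ?A ?B a b" and ?g = "graph_of ?A ?B"
    let ?P = "\<lambda>G. c * (ln (real n) / real n) \<le> \<rho> k G \<and> \<rho> k G \<le> (C + 1) * (ln (real n) / real n)"
    let ?bad = "\<lambda>R. real (card {v \<in> ?A \<union> ?B. \<not> tree_like (?g R) v D})"
    have n: "1 \<le> n" "n1 \<le> n" "n2 \<le> n" using elim(2) by auto
    have AB: "?A \<inter> ?B = {}" by (rule parts_disjoint)
    interpret bireg ?A ?B a b n by (rule bireg_parts)
    have flip: "bireg ?B ?A b a n" using fin cards by unfold_locales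
    define N1 where "N1 = {R \<in> ?X. \<not> expanding R ?A a b n s1}"
    define N2 where "N2 = {R \<in> ?X. \<not> expanding (R\<inverse>) ?B b a n s2}"
    define N3 where "N3 = {R \<in> ?X. ln (real n) < ?bad R}"
    define X where "X = real (card ?X)"
    have sub: "{R \<in> ?X. \<not> ?P (?g R)} \<subseteq> N1 \<union> N2 \<union> N3"
    proof (rule subsetI, rule ccontr)
      fix R assume "R \<in> {R \<in> ?X. \<not> ?P (?g R)}" and "R \<notin> N1 \<union> N2 \<union> N3"
      then have R: "R \<in> ?X" and nP: "\<not> ?P (?g R)" and x1: "expanding R ?A a b n s1"
        and x2: "expanding (R\<inverse>) ?B b a n s2" and bd: "?bad R \<le> ln (real n)"
        by (auto simp: N1_def N2_def N3_def)
      have x: "expanding R ?A a b n s0" "expanding (R\<inverse>) ?B b a n s0"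
        using expanding_mono[OF x1, of s0] expanding_mono[OF x2, of s0] by (auto simp: s0_def)
      have good: "real (sn k (?g R) v) \<le> C * ln (real n)" if v: "v \<in> ?A \<union> ?B" and tl: "tree_like (?g R) v D" for v
      proof (cases "v \<in> ?A")
        case True
        have "real (sn k (?g R) v) \<le> 2 * (1 + 201 * (real (k + 3) * (real k * (real (D + 2 * \<tau> + 1) + 1) + real s0)))"
          by (rule sn_graph_of_le[OF AB R x k _ True tl D(1) K0 D(2) M \<tau> refl large])
            (simp add: a_def b_def)
        then show ?thesis using bound by linarith
      next
        case False
        then have vB: "v \<in> ?B" using v by blast
        \<comment> \<open>An origin in the second part: the converse relation has the same graph,
          with this part now in the first place.\<close>
        have R': "R\<inverse> \<in> birel ?B ?A b a" using R by (simp add: birel_converse)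
        have gr: "graph_of ?B ?A (R\<inverse>) = ?g R" by (rule graph_of_converse)
        have BA: "?B \<inter> ?A = {}" using AB by blast
        have x': "expanding ((R\<inverse>)\<inverse>) ?A a b n s0" using x(1) by simp
        have tl': "tree_like (graph_of ?B ?A (R\<inverse>)) v D" using tl gr by simp
        have comm: "a * b * n = b * a * n" by simp
        have "real (sn k (graph_of ?B ?A (R\<inverse>)) v) \<le> 2 * (1 + 201 * (real (k + 3) * (real k * (real (D + 2 * \<tau> + 1) + 1) + real s0)))"
          by (rule bireg.sn_graph_of_le[OF flip BA R' x(2) x' k _ vB tl' D(1) K0 D(2)
              M[unfolded comm] \<tau>[unfolded comm] refl large[unfolded comm]]) (simp add: a_def b_def)
        then show ?thesis using bound unfolding gr by linarith
      qed
      have "\<rho> k (?g R) \<le> (C + 1) * (ln (real n) / real n)"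
        by (rule rho_le[OF AB n(1) _ _ good bd]) (use C ab in auto)
      moreover have "c * (ln (real n) / real n) \<le> \<rho> k (?g R)"
        unfolding c_def by (rule rho_ge[OF AB R n(1)]) (use k elim(5) in \<open>auto simp: a_def b_def\<close>)
      ultimately show False using nP by blast
    qed
    have c1: "real n * real (card N1) \<le> X" unfolding N1_def X_def by (rule e1[OF n(2) bireg_parts])
    have c2: "real n * real (card N2) \<le> X"
    proof -
      \<comment> \<open>Failures of expansion from the second part are failures of the converse
        relation, which is uniform on relations with the parts exchanged.\<close>
      have "converse ` N2 = {R \<in> birel ?B ?A b a. \<not> expanding R ?B b a n s2}"
      proof (intro equalityI subsetI)
        fix R assume "R \<in> {R \<in> birel ?B ?A b a. \<not> expanding R ?B b a n s2}"
        then have "R\<inverse> \<in> N2" by (simp add: N2_def birel_converse)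
        then show "R \<in> converse ` N2" by (intro image_eqI[of _ _ "R\<inverse>"]) auto
      qed (auto simp: N2_def birel_converse)
      moreover have "inj_on converse N2" by (rule inj_on_inverseI[where g = converse]) simp
      ultimately have "card N2 = card {R \<in> birel ?B ?A b a. \<not> expanding R ?B b a n s2}"
        using card_image[of converse N2] by simp
      moreover have "card (birel ?B ?A b a) = card ?X"
        by (rule bij_betw_same_card[OF bij_betw_converse_birel])
      ultimately show ?thesis using e2[OF n(3) flip] by (simp add: X_def)
    qed
    have c3: "ln (real n) * real (card N3) \<le> K * X"
      unfolding N3_def X_def K_def
    proof (rule markov_not_tree_like[OF AB])
      have "n \<le> a * b * n" using ab by simp
      then show "2 * (2 * D + 2 * (a * b)) \<le> a * b * n" using elim(3) by linarith
    qed (use n ab in auto)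
    have L: "0 < ln (real n)" using elim(4) by linarith
    have X0: "0 < X" unfolding X_def using prob_biregular_graphs(2)[OF n(1), of b a] by simp
    have "card {R \<in> ?X. \<not> ?P (?g R)} \<le> card (N1 \<union> N2 \<union> N3)"
      using fin_birel by (intro card_mono sub) (auto simp: N1_def N2_def N3_def)
    also have "\<dots> \<le> card N1 + card N2 + card N3"
      using card_Un_le[of "N1 \<union> N2" N3] card_Un_le[of N1 N2] by linarith
    finally have "real (card {R \<in> ?X. \<not> ?P (?g R)}) \<le> real (card N1) + real (card N2) + real (card N3)"
      unfolding of_nat_add[symmetric] of_nat_le_iff .
    also have "\<dots> \<le> X / real n + X / real n + K * X / ln (real n)"
      using c1 c2 c3 L n(1) by (intro add_mono) (auto simp: field_simps)
    also have "\<dots> = (2 / real n + K / ln (real n)) * X" by (simp add: algebra_simps)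
    finally have "real (card {R \<in> ?X. \<not> ?P (?g R)}) / X \<le> 2 / real n + K / ln (real n)"
      using X0 by (simp add: pos_divide_le_eq)
    then show ?case
      unfolding prob_biregular_graphs(1)[OF n(1), where P = ?P] X_def by linarith
  qed
  then show ?thesis unfolding a_def b_def using c0 C by (intro exI[of _ c] exI[of _ "C + 1"] exI[of _ K] conjI) auto
qed

theorem theorem3:
  fixes k :: nat
  assumes "k \<ge> 2"
  shows "(\<exists>c > 0. \<exists>C > 0.
           (\<lambda>n. measure_pmf.prob (pmf_of_set (biregular_graphs n (k + 1) (k + 3)))
                  {G. c * (ln (real n) / real n) \<le> \<rho> k G \<and> \<rho> k G \<le> C * (ln (real n) / real n)})
           \<longlonglongrightarrow> 1) \<and>
         (\<forall>\<epsilon> > 0.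
           (\<lambda>n. measure_pmf.prob (pmf_of_set (biregular_graphs n (k + 1) (k + 3)))
                  {G. \<rho> k G \<le> \<epsilon>})
           \<longlonglongrightarrow> 1)"
proof -
  let ?pr = "\<lambda>n. measure_pmf.prob (pmf_of_set (biregular_graphs n (k + 1) (k + 3)))"
  let ?l = "\<lambda>n. ln (real n) / real n"
  obtain c C K where c: "0 < c" and C: "0 < C" and ev: "\<forall>\<^sub>F n in sequentially.
    1 - (2 / real n + K / ln (real n)) \<le> ?pr n {G. c * ?l n \<le> \<rho> k G \<and> \<rho> k G \<le> C * ?l n}"
    using rho_bounds_aas[OF assms] by blast
  have "(\<lambda>n. inverse (ln (real n))) \<longlonglongrightarrow> 0"
    by (rule tendsto_inverse_0_at_top) (rule filterlim_compose[OF ln_at_top filterlim_real_sequentially])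
  then have "(\<lambda>n. 1 - (2 * inverse (real n) + K * inverse (ln (real n)))) \<longlonglongrightarrow> 1 - (2 * 0 + K * 0)"
    by (intro tendsto_intros lim_inverse_n)
  then have lim: "(\<lambda>n. 1 - (2 / real n + K / ln (real n))) \<longlonglongrightarrow> 1" by (simp add: divide_inverse)
  have first: "(\<lambda>n. ?pr n {G. c * ?l n \<le> \<rho> k G \<and> \<rho> k G \<le> C * ?l n}) \<longlonglongrightarrow> 1"
    by (rule tendsto_sandwich[OF ev _ lim tendsto_const]) simp
  have "(\<lambda>n. ?pr n {G. \<rho> k G \<le> \<epsilon>}) \<longlonglongrightarrow> 1" if \<epsilon>: "0 < \<epsilon>" for \<epsilon>
  proof (rule tendsto_sandwich[OF _ _ lim tendsto_const])
    have "(\<lambda>n. C * ?l n) \<longlonglongrightarrow> C * 0" by (intro tendsto_mult_left lim_ln_over_n)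
    then have "\<forall>\<^sub>F n in sequentially. C * ?l n < \<epsilon>" using \<epsilon> by (intro order_tendstoD) auto
    with ev show "\<forall>\<^sub>F n in sequentially. 1 - (2 / real n + K / ln (real n)) \<le> ?pr n {G. \<rho> k G \<le> \<epsilon>}"
    proof eventually_elim
      case (elim n)
      have "?pr n {G. c * ?l n \<le> \<rho> k G \<and> \<rho> k G \<le> C * ?l n} \<le> ?pr n {G. \<rho> k G \<le> \<epsilon>}"
        using elim(2) by (intro measure_pmf.finite_measure_mono) auto
      then show ?case using elim(1) by linarith
    qed
  qed simp
  then show ?thesis using c C first by blast
qed

end
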